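(* Suppose that either ($\alpha>1/p$, $1\le p<2$ and $1\le q<\infty$) or $\alpha=p=q=1$. Let $(\delta_\varepsilon)_{0<\varepsilon<1}$ be positive and decreasing as $\varepsilon\to0$, and let $(\Pi_\varepsilon)_{0<\varepsilon<1}$ be mean-zero Gaussian (Borel) probability measures on $L^2([0,1])$ such that for every $\eta>0$, $$\sup_{f_0:\|f_0\|_{B^\alpha_{pq}}\le1}P^\varepsilon_{f_0}\Big(\Pi_\varepsilon\big(f:\|f-f_0\|_{L^2}\ge\delta_\varepsilon\,\big|\,Y_\varepsilon\big)\ge\eta\Big)\xrightarrow{\varepsilon\to0}0.$$ Then there is a constant $c>0$ such that $\delta_\varepsilon\ge c\,l_\varepsilon$ for all $0<\varepsilon<1$, where $l_\varepsilon=\varepsilon^{\frac{2\alpha-(2-p)/p}{2\alpha+1-(2-p)/p}}$.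
   Context: Direct white noise regression on $[0,1]$: for $f_0\in L^2([0,1])$ and $\varepsilon>0$ the data are $Y_\varepsilon=f_0+\varepsilon\mathbb W$, where $\mathbb W$ is a Gaussian white noise on $L^2([0,1])$; $P^\varepsilon_{f_0}$ is the law of $Y_\varepsilon$, and $\Pi_\varepsilon(\cdot|Y_\varepsilon)$ is the posterior distribution (Bayes' formula with likelihood $\exp(\varepsilon^{-2}\langle Y_\varepsilon,f\rangle-\frac1{2\varepsilon^2}\|f\|^2_{L^2})$). $B^\alpha_{pq}=B^\alpha_{pq}([0,1])$ denotes the usual Besov space on $[0,1]$ and the supremum is over $f_0$ in its closed unit ball. *)

theory Defs
  imports "HOL-Probability.Probability"
begin

definition L2_01 :: "(real \<Rightarrow> real) set" where
  "L2_01 = {f. set_borel_measurable lborel {0..1} f \<and>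
               set_integrable lborel {0..1} (\<lambda>x. (f x)\<^sup>2)}"

definition inner01 :: "(real \<Rightarrow> real) \<Rightarrow> (real \<Rightarrow> real) \<Rightarrow> real" where
  "inner01 f g = (LINT x:{0..1}|lborel. f x * g x)"

definition L2norm01 :: "(real \<Rightarrow> real) \<Rightarrow> real" where
  "L2norm01 f = sqrt (LINT x:{0..1}|lborel. (f x)\<^sup>2)"

text \<open>Borel sigma-algebra of L^2([0,1]) (on square-integrable representatives):
  generated by the open L^2-balls (L^2 is separable, so this is the Borel sigma-algebra).\<close>
definition L2_borel :: "(real \<Rightarrow> real) measure" where
  "L2_borel = sigma L2_01
     {{f \<in> L2_01. L2norm01 (\<lambda>x. f x - g x) < r} | g r. g \<in> L2_01}"

definition centered_gaussian_L2 :: "(real \<Rightarrow> real) measure \<Rightarrow> bool" where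
  "centered_gaussian_L2 Pr \<longleftrightarrow> prob_space Pr \<and> sets Pr = sets L2_borel \<and>
     (\<forall>g\<in>L2_01. \<exists>\<sigma>\<ge>0. distr Pr borel (\<lambda>f. inner01 f g) =
        (if \<sigma> = 0 then return borel 0 else density lborel (normal_density 0 \<sigma>)))"

definition cosbasis :: "nat \<Rightarrow> real \<Rightarrow> real" where
  "cosbasis k x = (if k = 0 then 1 else sqrt 2 * cos (real k * pi * x))"

definition coef :: "(real \<Rightarrow> real) \<Rightarrow> nat \<Rightarrow> real" where
  "coef f k = inner01 f (cosbasis k)"

text \<open>Law of the observation Y = f0 + eps W, recorded through its coordinates
  Y_k = <Y, e_k> = <f0,e_k> + eps Z_k with Z_k i.i.d. N(0,1).\<close>
definition data_law :: "real \<Rightarrow> (real \<Rightarrow> real) \<Rightarrow> (nat \<Rightarrow> real) measure" where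
  "data_law \<epsilon> f0 = (\<Pi>\<^sub>M k\<in>UNIV. density lborel (normal_density (coef f0 k) \<epsilon>))"

text \<open>The stochastic integral <Y,f> = sum_k Y_k <f,e_k>.\<close>
definition data_inner :: "(nat \<Rightarrow> real) \<Rightarrow> (real \<Rightarrow> real) \<Rightarrow> real" where
  "data_inner Y f = (\<Sum>k. Y k * coef f k)"

definition likelihood :: "real \<Rightarrow> (nat \<Rightarrow> real) \<Rightarrow> (real \<Rightarrow> real) \<Rightarrow> real" where
  "likelihood \<epsilon> Y f = exp (data_inner Y f / \<epsilon>\<^sup>2 - (L2norm01 f)\<^sup>2 / (2 * \<epsilon>\<^sup>2))"

definition posterior ::
  "real \<Rightarrow> (real \<Rightarrow> real) measure \<Rightarrow> (nat \<Rightarrow> real) \<Rightarrow> (real \<Rightarrow> real) set \<Rightarrow> real" where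
  "posterior \<epsilon> Pr Y A =
     (LINT f|Pr. indicator A f * likelihood \<epsilon> Y f) / (LINT f|Pr. likelihood \<epsilon> Y f)"

definition Lp_norm_on :: "real \<Rightarrow> real \<Rightarrow> real \<Rightarrow> (real \<Rightarrow> real) \<Rightarrow> real" where
  "Lp_norm_on p a b g = (LINT x:{a..b}|lborel. \<bar>g x\<bar> powr p) powr (1 / p)"

definition fdiff :: "nat \<Rightarrow> real \<Rightarrow> (real \<Rightarrow> real) \<Rightarrow> real \<Rightarrow> real" where
  "fdiff r h f x = (\<Sum>j\<le>r. (-1) ^ (r - j) * real (r choose j) * f (x + real j * h))"

definition modsmooth :: "nat \<Rightarrow> real \<Rightarrow> (real \<Rightarrow> real) \<Rightarrow> real \<Rightarrow> real" where
  "modsmooth r p f t = (SUP h\<in>{0<..t}. Lp_norm_on p 0 (1 - real r * h) (fdiff r h f))"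

definition besov_r :: "real \<Rightarrow> nat" where
  "besov_r \<alpha> = nat \<lfloor>\<alpha>\<rfloor> + 1"

definition besov_seminorm_enn :: "real \<Rightarrow> real \<Rightarrow> real \<Rightarrow> (real \<Rightarrow> real) \<Rightarrow> ennreal" where
  "besov_seminorm_enn \<alpha> p q f =
     (\<integral>\<^sup>+ t. indicator {0<..1} t *
        ennreal ((t powr (-\<alpha>) * modsmooth (besov_r \<alpha>) p f t) powr q / t) \<partial>lborel)"

definition in_besov :: "real \<Rightarrow> real \<Rightarrow> real \<Rightarrow> (real \<Rightarrow> real) \<Rightarrow> bool" where
  "in_besov \<alpha> p q f \<longleftrightarrow> set_borel_measurable lborel {0..1} f \<and>
     set_integrable lborel {0..1} (\<lambda>x. \<bar>f x\<bar> powr p) \<and>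
     besov_seminorm_enn \<alpha> p q f < \<infinity>"

definition besov_norm :: "real \<Rightarrow> real \<Rightarrow> real \<Rightarrow> (real \<Rightarrow> real) \<Rightarrow> real" where
  "besov_norm \<alpha> p q f =
     Lp_norm_on p 0 1 f + enn2real (besov_seminorm_enn \<alpha> p q f) powr (1 / q)"

definition besov_unit_ball :: "real \<Rightarrow> real \<Rightarrow> real \<Rightarrow> (real \<Rightarrow> real) set" where
  "besov_unit_ball \<alpha> p q = {f. in_besov \<alpha> p q f \<and> besov_norm \<alpha> p q f \<le> 1}"

end

theory Submission
  imports Defs
begin

text \<open>The proof compares posteriors for different data. A centred Gaussian prior is invariant under
  the rotation \<open>(f, f') \<mapsto> ((f + f') / \<surd>2, (f - f') / \<surd>2)\<close> of two independent draws, and the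
  log-likelihood is quadratic; hence the difference of independent draws from the posteriors for the
  data \<open>Y\<close> and \<open>Y'\<close> is \<open>\<surd>2\<close> times a draw from the posterior for \<open>(Y - Y') / \<surd>2\<close>.
  With \<open>Y = Y' = 0\<close> this makes the law of \<open>\<langle>f, g\<rangle>\<close> under the posterior for \<open>0\<close> stable, so it is
  \<open>N(0, \<sigma>\<^sup>2)\<close> with some \<open>\<sigma>\<close> depending on \<open>g\<close>.
  With \<open>Y = Y' + a g\<close>, contraction at rate \<open>\<delta> \<le> a / 4\<close> around \<open>a g\<close> and around \<open>0\<close> forces
  \<open>\<sigma>\<^sup>2 \<ge> \<epsilon>\<^sup>2 / 2\<close>. With \<open>Y = Y'\<close>, every posterior then spreads over a distance of order \<open>\<epsilon>\<close> in the
  direction \<open>g\<close>.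
  Take for \<open>g\<close> the members of an orthonormal family of \<open>N\<close> disjoint bumps, for which \<open>a g\<close> lies in
  the Besov ball when \<open>a\<close> is a small multiple of \<open>N\<close> to the power \<open>-s\<close>, \<open>s = \<alpha> - 1/p + 1/2\<close>.
  By Bessel's inequality, \<open>\<delta>\<^sup>2\<close> is at least of order \<open>N \<epsilon>\<^sup>2\<close> unless \<open>\<delta> > a / 4\<close>, and the choice of \<open>N\<close>
  of order \<open>\<epsilon>\<close> to the power \<open>-2 / (2 s + 1)\<close> balances the two bounds.\<close>

section \<open>The space L^2([0,1]) and the cosine basis\<close>

text \<open>The rotation takes the place of the explicit conjugate formulas: no covariance operator
  is diagonalised and no posterior mean is computed from the data. The obstacle is that the pairing
  of data and parameter is an infinite series which converges only almost surely, and that the ratio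
  defining the posterior is informative only when its denominator is finite. Everything is therefore
  moved to coefficient sequences and restricted to \<open>good\<close> data. Almost every noise
  sequence is good, even after a shift, and goodness passes from \<open>Y\<close> and
  \<open>Y'\<close> to \<open>(Y - Y') / sqrt 2\<close> through the same rotation identity that
  compares the posteriors. Contraction enters only at the level 1/8: two data events of probability
  below 1/8 leave a sample that is favourable at both centres, and two posterior masses of at most
  1/8 together with one half stay below one. The spread in a direction depends on the prior and on
  \<open>\<epsilon>\<close>, but not on the data; this lets samples chosen separately for each bump
  control one common posterior.\<close>

abbreviation unit_lebesgue :: "real measure" where
  "unit_lebesgue \<equiv> restrict_space lborel {0..1}"

lemma unit_Icc_sets [simp]: "{0..1::real} \<inter> space lborel \<in> sets lborel"
  by simp

lemma L2_01_iff:
  "f \<in> L2_01 \<longleftrightarrow> f \<in> borel_measurable unit_lebesgue \<and> integrable unit_lebesgue (\<lambda>x. (f x)\<^sup>2)"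
  unfolding L2_01_def set_borel_measurable_def set_integrable_def
  by (subst borel_measurable_restrict_space_iff[OF unit_Icc_sets])
     (subst integrable_restrict_space[OF unit_Icc_sets], simp)

lemma L2_01_measurable: "f \<in> L2_01 \<Longrightarrow> f \<in> borel_measurable unit_lebesgue"
  by (simp add: L2_01_iff)

lemma L2_01_square_integrable: "f \<in> L2_01 \<Longrightarrow> integrable unit_lebesgue (\<lambda>x. (f x)\<^sup>2)"
  by (simp add: L2_01_iff)

lemma inner01_eq: "inner01 f g = (LINT x|unit_lebesgue. f x * g x)"
  unfolding inner01_def set_lebesgue_integral_def
  by (subst integral_restrict_space[OF unit_Icc_sets]) simp

lemma L2norm01_sq: "(L2norm01 f)\<^sup>2 = inner01 f f"
proof -
  have "0 \<le> (LINT x:{0..1}|lborel. (f x)\<^sup>2)"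
    unfolding set_lebesgue_integral_def by (intro integral_nonneg_AE) auto
  then show ?thesis
    unfolding L2norm01_def inner01_def by (simp add: power2_eq_square)
qed

lemma L2norm01_eq: "L2norm01 f = sqrt (inner01 f f)"
  unfolding L2norm01_def inner01_def by (simp add: power2_eq_square)

lemma L2norm01_nonneg [simp]: "0 \<le> L2norm01 f"
proof -
  have "0 \<le> (LINT x:{0..1}|lborel. (f x)\<^sup>2)"
    unfolding set_lebesgue_integral_def by (intro integral_nonneg_AE) auto
  then show ?thesis
    unfolding L2norm01_def by simp
qed

lemma inner01_self_nonneg [simp]: "0 \<le> inner01 f f"
  by (metis L2norm01_sq zero_le_power2)

lemma inner01_commute: "inner01 f g = inner01 g f"
  unfolding inner01_def by (simp add: mult.commute)

lemma L2_01_mult_integrable: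
  assumes "f \<in> L2_01" "g \<in> L2_01"
  shows "integrable unit_lebesgue (\<lambda>x. f x * g x)"
proof (rule Bochner_Integration.integrable_bound)
  show "integrable unit_lebesgue (\<lambda>x. (f x)\<^sup>2 + (g x)\<^sup>2)"
    using assms by (intro Bochner_Integration.integrable_add L2_01_square_integrable)
  show "(\<lambda>x. f x * g x) \<in> borel_measurable unit_lebesgue"
    using assms[THEN L2_01_measurable] by measurable
  have "\<bar>a * b\<bar> \<le> a\<^sup>2 + b\<^sup>2" for a b :: real
  proof -
    have "2 * \<bar>a * b\<bar> \<le> a\<^sup>2 + b\<^sup>2"
      using sum_squares_bound[of "\<bar>a\<bar>" "\<bar>b\<bar>"] by (simp add: abs_mult)
    then show ?thesis
      using abs_ge_zero[of "a * b"] by linarith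
  qed
  then show "AE x in unit_lebesgue. norm (f x * g x) \<le> norm ((f x)\<^sup>2 + (g x)\<^sup>2)"
    by (auto simp del: abs_mult)
qed

lemma L2_01_scale: "f \<in> L2_01 \<Longrightarrow> (\<lambda>x. c * f x) \<in> L2_01"
  unfolding L2_01_iff power_mult_distrib
  by (intro conjI borel_measurable_times borel_measurable_const integrable_mult_right) blast+

lemma L2_01_add:
  assumes "f \<in> L2_01" "g \<in> L2_01"
  shows "(\<lambda>x. f x + g x) \<in> L2_01"
proof -
  have "integrable unit_lebesgue (\<lambda>x. (f x)\<^sup>2 + (g x)\<^sup>2 + 2 * (f x * g x))"
    using assms by (intro Bochner_Integration.integrable_add L2_01_square_integrable
      integrable_mult_right L2_01_mult_integrable)
  then have "integrable unit_lebesgue (\<lambda>x. (f x + g x)\<^sup>2)"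
    by (simp add: power2_sum mult.assoc)
  then show ?thesis
    using assms[THEN L2_01_measurable] unfolding L2_01_iff by (intro conjI borel_measurable_add)
qed

lemma L2_01_diff:
  assumes "f \<in> L2_01" "g \<in> L2_01"
  shows "(\<lambda>x. f x - g x) \<in> L2_01"
  using L2_01_add[OF assms(1) L2_01_scale[OF assms(2), of "-1"]] by simp

lemma L2_01_zero [simp]: "(\<lambda>x. 0) \<in> L2_01"
  by (simp add: L2_01_iff)

lemma L2_01_sum: "(\<And>i. i \<in> I \<Longrightarrow> f i \<in> L2_01) \<Longrightarrow> (\<lambda>x. \<Sum>i\<in>I. f i x) \<in> L2_01"
  by (induction I rule: infinite_finite_induct) (auto intro: L2_01_add)

lemma unit_lebesgue_emeasure_space [simp]: "emeasure unit_lebesgue {0..1} = 1"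
  by (simp add: emeasure_restrict_space)

lemma unit_lebesgue_space [simp]: "space unit_lebesgue = {0..1}"
  by (simp add: space_restrict_space)

lemma unit_lebesgue_prob_space: "prob_space unit_lebesgue"
  by (rule prob_spaceI) simp

lemma L2_01_bounded:
  assumes "f \<in> borel_measurable unit_lebesgue" "\<And>x. x \<in> {0..1} \<Longrightarrow> \<bar>f x\<bar> \<le> B"
  shows "f \<in> L2_01"
proof -
  interpret prob_space unit_lebesgue by (rule unit_lebesgue_prob_space)
  have "integrable unit_lebesgue (\<lambda>x. (f x)\<^sup>2)"
  proof (rule integrable_const_bound)
    show "AE x in unit_lebesgue. norm ((f x)\<^sup>2) \<le> B\<^sup>2"
    proof (rule AE_I2)
      fix x assume "x \<in> space unit_lebesgue"
      then have "\<bar>f x\<bar>\<^sup>2 \<le> B\<^sup>2"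
        by (intro power_mono assms(2)) auto
      then show "norm ((f x)\<^sup>2) \<le> B\<^sup>2" by simp
    qed
  qed (use assms(1) in measurable)
  then show ?thesis using assms(1) by (simp add: L2_01_iff)
qed

lemma L2_01_continuous:
  assumes "continuous_on UNIV f" shows "f \<in> L2_01"
proof -
  have [measurable]: "f \<in> borel_measurable borel"
    using assms by (rule borel_measurable_continuous_onI)
  have "compact (f ` {0..1})"
    using assms by (intro compact_continuous_image) (auto intro: continuous_on_subset)
  from compact_imp_bounded[OF this] obtain B where B: "\<And>x. x \<in> {0..1} \<Longrightarrow> \<bar>f x\<bar> \<le> B"
    unfolding bounded_iff real_norm_def by (meson imageI)
  show ?thesis
    by (rule L2_01_bounded[OF _ B]) (rule measurable_restrict_space1, simp_all)
qed

lemma inner01_add_left: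
  "f \<in> L2_01 \<Longrightarrow> g \<in> L2_01 \<Longrightarrow> h \<in> L2_01 \<Longrightarrow>
    inner01 (\<lambda>x. f x + g x) h = inner01 f h + inner01 g h"
  unfolding inner01_eq by (simp add: distrib_right L2_01_mult_integrable)

lemma inner01_diff_left:
  "f \<in> L2_01 \<Longrightarrow> g \<in> L2_01 \<Longrightarrow> h \<in> L2_01 \<Longrightarrow>
    inner01 (\<lambda>x. f x - g x) h = inner01 f h - inner01 g h"
  unfolding inner01_eq by (simp add: left_diff_distrib L2_01_mult_integrable)

lemma inner01_scale_left: "inner01 (\<lambda>x. c * f x) h = c * inner01 f h"
  unfolding inner01_eq by (simp add: mult.assoc)

lemma inner01_scale_right: "inner01 f (\<lambda>x. c * h x) = c * inner01 f h"
  by (metis inner01_commute inner01_scale_left)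

lemma inner01_add_right:
  "f \<in> L2_01 \<Longrightarrow> g \<in> L2_01 \<Longrightarrow> h \<in> L2_01 \<Longrightarrow>
    inner01 f (\<lambda>x. g x + h x) = inner01 f g + inner01 f h"
  by (simp add: inner01_commute[of f] inner01_add_left)

lemma inner01_diff_right:
  "f \<in> L2_01 \<Longrightarrow> g \<in> L2_01 \<Longrightarrow> h \<in> L2_01 \<Longrightarrow>
    inner01 f (\<lambda>x. g x - h x) = inner01 f g - inner01 f h"
  by (simp add: inner01_commute[of f] inner01_diff_left)

lemma inner01_zero [simp]: "inner01 (\<lambda>x. 0) h = 0" "inner01 h (\<lambda>x. 0) = 0"
  by (simp_all add: inner01_eq)

lemma inner01_sum_left:
  assumes "finite I" "\<And>i. i \<in> I \<Longrightarrow> f i \<in> L2_01" "h \<in> L2_01"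
  shows "inner01 (\<lambda>x. \<Sum>i\<in>I. f i x) h = (\<Sum>i\<in>I. inner01 (f i) h)"
  using assms by (induction I) (auto simp: inner01_add_left L2_01_sum)

lemma inner01_sum_right:
  assumes "finite I" "\<And>i. i \<in> I \<Longrightarrow> f i \<in> L2_01" "h \<in> L2_01"
  shows "inner01 h (\<lambda>x. \<Sum>i\<in>I. f i x) = (\<Sum>i\<in>I. inner01 h (f i))"
  using inner01_sum_left[OF assms] by (simp add: inner01_commute[of h])

lemma inner01_diff_self:
  "f \<in> L2_01 \<Longrightarrow> g \<in> L2_01 \<Longrightarrow>
    inner01 (\<lambda>x. f x - g x) (\<lambda>x. f x - g x) = inner01 f f - 2 * inner01 f g + inner01 g g"
  by (simp add: inner01_diff_left inner01_diff_right L2_01_diff inner01_commute[of g f])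

lemma inner01_add_self:
  "f \<in> L2_01 \<Longrightarrow> g \<in> L2_01 \<Longrightarrow>
    inner01 (\<lambda>x. f x + g x) (\<lambda>x. f x + g x) = inner01 f f + 2 * inner01 f g + inner01 g g"
  by (simp add: inner01_add_left inner01_add_right L2_01_add inner01_commute[of g f])

lemma inner01_Cauchy_Schwarz:
  assumes "f \<in> L2_01" "g \<in> L2_01"
  shows "\<bar>inner01 f g\<bar> \<le> L2norm01 f * L2norm01 g"
proof -
  have quad: "0 \<le> inner01 f f - 2 * t * inner01 f g + t\<^sup>2 * inner01 g g" for t
    using inner01_diff_self[OF assms(1) L2_01_scale[OF assms(2), of t]]
      inner01_self_nonneg[of "\<lambda>x. f x - t * g x"]
    by (simp add: inner01_scale_left inner01_scale_right power2_eq_square)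
  have "(inner01 f g)\<^sup>2 \<le> inner01 f f * inner01 g g"
  proof (cases "inner01 g g = 0")
    case True
    \<comment> \<open>With a degenerate \<open>g\<close> the form \<open>quad\<close> is affine in
      \<open>t\<close>; the value of \<open>t\<close> inserted below would make it equal to
      -1.\<close>
    have "inner01 f g = 0"
    proof (rule ccontr)
      assume "inner01 f g \<noteq> 0"
      then show False
        using quad[of "(inner01 f f + 1) / (2 * inner01 f g)"] True by simp
    qed
    then show ?thesis by (simp add: True)
  next
    case False
    then have pos: "inner01 g g > 0"
      using inner01_self_nonneg[of g] by linarith
    show ?thesis
    proof -
      define t where "t = inner01 f g / inner01 g g"
      have t: "inner01 f g = t * inner01 g g"
        using pos by (simp add: t_def)
      have "0 \<le> inner01 f f - t * (t * inner01 g g)"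
        using quad[of t] unfolding t by (simp add: power2_eq_square algebra_simps)
      then have "0 \<le> (inner01 f f - t * (t * inner01 g g)) * inner01 g g"
        using pos by (intro mult_nonneg_nonneg) auto
      then show ?thesis unfolding t by (simp add: power2_eq_square algebra_simps)
    qed
  qed
  then show ?thesis
    by (simp add: L2norm01_eq flip: real_sqrt_mult real_sqrt_abs)
qed

text \<open>Completing the square, with arbitrary coefficients \<open>c\<close>. Fourier
  coefficients in place of \<open>c\<close> give Bessel's inequality; any other choice shows that
  the Fourier partial sum approximates at least as well, which is what Parseval's identity
  needs.\<close>

lemma orthonormal_diff_self:
  assumes "finite I" "\<And>i. i \<in> I \<Longrightarrow> e i \<in> L2_01" "f \<in> L2_01"
    and orth: "\<And>i j. i \<in> I \<Longrightarrow> j \<in> I \<Longrightarrow> inner01 (e i) (e j) = (if i = j then 1 else 0)"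
  shows "inner01 (\<lambda>x. f x - (\<Sum>i\<in>I. c i * e i x)) (\<lambda>x. f x - (\<Sum>i\<in>I. c i * e i x)) =
    inner01 f f - (\<Sum>i\<in>I. (inner01 f (e i))\<^sup>2) + (\<Sum>i\<in>I. (c i - inner01 f (e i))\<^sup>2)"
proof -
  have m: "(\<lambda>x. c i * e i x) \<in> L2_01" if "i \<in> I" for i
    using assms(2)[OF that] by (rule L2_01_scale)
  have s: "(\<lambda>x. \<Sum>i\<in>I. c i * e i x) \<in> L2_01"
    by (intro L2_01_sum m)
  have 1: "inner01 f (\<lambda>x. \<Sum>i\<in>I. c i * e i x) = (\<Sum>i\<in>I. c i * inner01 f (e i))"
    using assms(1,3) m by (subst inner01_sum_right) (auto simp: inner01_scale_right)
  have "inner01 (\<lambda>x. \<Sum>i\<in>I. c i * e i x) (\<lambda>x. \<Sum>i\<in>I. c i * e i x) =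
      (\<Sum>i\<in>I. c i * (\<Sum>j\<in>I. c j * inner01 (e i) (e j)))"
    using assms(1,2) m s
    by (simp add: inner01_sum_left inner01_sum_right inner01_scale_left inner01_scale_right)
  also have "\<dots> = (\<Sum>i\<in>I. (c i)\<^sup>2)"
    using assms(1) by (intro sum.cong) (auto simp: orth power2_eq_square if_distrib[of "(*) _"] cong: if_cong)
  finally have 2: "inner01 (\<lambda>x. \<Sum>i\<in>I. c i * e i x) (\<lambda>x. \<Sum>i\<in>I. c i * e i x) = (\<Sum>i\<in>I. (c i)\<^sup>2)" .
  have "(\<Sum>i\<in>I. (c i - inner01 f (e i))\<^sup>2) = (\<Sum>i\<in>I. (c i)\<^sup>2) -
      2 * (\<Sum>i\<in>I. c i * inner01 f (e i)) + (\<Sum>i\<in>I. (inner01 f (e i))\<^sup>2)"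
    unfolding sum_distrib_left sum_subtractf[symmetric] sum.distrib[symmetric]
    by (intro sum.cong refl) (simp add: power2_diff)
  then show ?thesis
    unfolding inner01_diff_self[OF assms(3) s] 1 2 by linarith
qed

lemma Bessel_inequality:
  assumes "finite I" "\<And>i. i \<in> I \<Longrightarrow> e i \<in> L2_01" "f \<in> L2_01"
    and "\<And>i j. i \<in> I \<Longrightarrow> j \<in> I \<Longrightarrow> inner01 (e i) (e j) = (if i = j then 1 else 0)"
  shows "(\<Sum>i\<in>I. (inner01 f (e i))\<^sup>2) \<le> inner01 f f"
  using orthonormal_diff_self[OF assms, of "\<lambda>i. inner01 f (e i)"]
    inner01_self_nonneg[of "\<lambda>x. f x - (\<Sum>i\<in>I. inner01 f (e i) * e i x)"] by simp

section \<open>Orthonormality of the cosine basis\<close>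

lemma cosbasis_L2 [simp]: "cosbasis k \<in> L2_01"
proof (rule L2_01_continuous)
  have "cosbasis k = (\<lambda>x. (if k = 0 then 1 else sqrt 2) * cos (real k * pi * x))"
    by (rule ext) (simp add: cosbasis_def)
  then show "continuous_on UNIV (cosbasis k)"
    by (simp only:) (intro continuous_intros)
qed

text \<open>The frequency is an integer because a product of two cosines produces the difference of
  their frequencies, which may be negative.\<close>

lemma integral_cos_pi:
  "(LINT x|unit_lebesgue. cos (of_int m * pi * x)) = (if m = 0 then 1 else 0)"
proof (cases "m = 0")
  case True
  interpret prob_space unit_lebesgue by (rule unit_lebesgue_prob_space)
  show ?thesis using prob_space by (simp add: True)
next
  case False
  have "(LINT x:{0..1}|lborel. cos (of_int m * pi * x)) =
      sin (of_int m * pi * 1) / (of_int m * pi) - sin (of_int m * pi * 0) / (of_int m * pi)"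
    unfolding set_lebesgue_integral_def real_scaleR_def mult.commute[of "indicat_real _ _"]
  proof (rule integral_FTC_Icc_real)
    show "DERIV (\<lambda>x. sin (of_int m * pi * x) / (of_int m * pi)) x :> cos (of_int m * pi * x)" for x
      using False by (auto intro!: derivative_eq_intros)
  qed (auto intro!: continuous_intros)
  moreover have "sin (of_int m * pi) = 0"
    unfolding sin_zero_iff_int2 by blast
  ultimately show ?thesis
    using False by (subst integral_restrict_space[OF unit_Icc_sets]) (simp add: set_lebesgue_integral_def)
qed

lemma cosbasis_orthonormal:
  "inner01 (cosbasis j) (cosbasis k) = (if j = k then 1 else 0)"
proof -
  have c: "cosbasis n x = (if n = 0 then 1 else sqrt 2) * cos (real n * pi * x)" for n x
    by (simp add: cosbasis_def)
  have i: "integrable unit_lebesgue (\<lambda>x. cos (of_int m * pi * x))" for m :: int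
  proof -
    interpret prob_space unit_lebesgue by (rule unit_lebesgue_prob_space)
    show ?thesis
      by (rule integrable_const_bound[of _ 1]) (simp, rule measurable_restrict_space1, simp)
  qed
  have prod_cos: "(c * cos (real j * pi * x)) * (d * cos (real k * pi * x)) = c * d / 2 *
      (cos (of_int (int j - int k) * pi * x) + cos (of_int (int j + int k) * pi * x))" for x c d
  proof -
    have "(c * cos (real j * pi * x)) * (d * cos (real k * pi * x)) =
        c * d * (cos (real j * pi * x) * cos (real k * pi * x))"
      by (simp only: mult_ac)
    also have "\<dots> = c * d / 2 * (cos (real j * pi * x - real k * pi * x) + cos (real j * pi * x + real k * pi * x))"
      by (simp add: cos_times_cos)
    finally show ?thesis by (simp add: left_diff_distrib distrib_right)
  qed
  have "inner01 (cosbasis j) (cosbasis k) =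
      (LINT x|unit_lebesgue. (if j = 0 then 1 else sqrt 2) * (if k = 0 then 1 else sqrt 2) / 2 *
        (cos (of_int (int j - int k) * pi * x) + cos (of_int (int j + int k) * pi * x)))"
    unfolding inner01_eq c
    by (intro Bochner_Integration.integral_cong refl) (simp only: prod_cos)
  also have "\<dots> = (if j = 0 then 1 else sqrt 2) * (if k = 0 then 1 else sqrt 2) / 2 *
        ((LINT x|unit_lebesgue. cos (of_int (int j - int k) * pi * x)) +
         (LINT x|unit_lebesgue. cos (of_int (int j + int k) * pi * x)))"
    by (subst integral_mult_right_zero) (subst Bochner_Integration.integral_add[OF i i], rule refl)
  also have "\<dots> = (if j = k then 1 else 0)"
    unfolding integral_cos_pi by auto
  finally show ?thesis .
qed

section \<open>Density of the cosine polynomials\<close>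

inductive cosine_polynomial :: "(real \<Rightarrow> real) \<Rightarrow> bool" where
  base: "cosine_polynomial (cosbasis k)"
| add: "cosine_polynomial f \<Longrightarrow> cosine_polynomial g \<Longrightarrow> cosine_polynomial (\<lambda>x. f x + g x)"
| scale: "cosine_polynomial f \<Longrightarrow> cosine_polynomial (\<lambda>x. c * f x)"

lemma cosine_polynomial_expansion:
  assumes "cosine_polynomial f"
  shows "\<exists>n c. f = (\<lambda>x. \<Sum>k<n. c k * cosbasis k x)"
  using assms
proof induction
  case (base k)
  have "cosbasis k = (\<lambda>x. \<Sum>i<Suc k. (if i = k then 1 else 0) * cosbasis i x)"
    by (rule ext) simp
  then show ?case
    by (intro exI[of _ "Suc k"] exI[of _ "\<lambda>i. if i = k then 1 else 0"])
next
  case (add f g)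
  then obtain n c m d where f: "f = (\<lambda>x. \<Sum>k<n. c k * cosbasis k x)"
    and g: "g = (\<lambda>x. \<Sum>k<m. d k * cosbasis k x)" by blast
  define c' where "c' k = (if k < n then c k else 0)" for k
  define d' where "d' k = (if k < m then d k else 0)" for k
  have "(\<Sum>k<n. c k * cosbasis k x) = (\<Sum>k<n+m. c' k * cosbasis k x)" for x
    by (rule sum.mono_neutral_cong_left) (auto simp: c'_def)
  moreover have "(\<Sum>k<m. d k * cosbasis k x) = (\<Sum>k<n+m. d' k * cosbasis k x)" for x
    by (rule sum.mono_neutral_cong_left) (auto simp: d'_def)
  ultimately have "(\<lambda>x. f x + g x) = (\<lambda>x. \<Sum>k<n+m. (c' k + d' k) * cosbasis k x)"
    by (simp add: f g distrib_right sum.distrib)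
  then show ?case
    by (intro exI[of _ "n + m"] exI[of _ "\<lambda>k. c' k + d' k"])
next
  case (scale f c)
  then obtain n d where "f = (\<lambda>x. \<Sum>k<n. d k * cosbasis k x)" by blast
  then have "(\<lambda>x. c * f x) = (\<lambda>x. \<Sum>k<n. (c * d k) * cosbasis k x)"
    by (simp add: sum_distrib_left mult.assoc)
  then show ?case
    by (intro exI[of _ n] exI[of _ "\<lambda>k. c * d k"])
qed

lemma cosine_polynomial_cos: "cosine_polynomial (\<lambda>x. cos (real k * pi * x))"
proof -
  have "(\<lambda>x. cos (real k * pi * x)) = (\<lambda>x. (if k = 0 then 1 else 1 / sqrt 2) * cosbasis k x)"
    by (rule ext) (simp add: cosbasis_def)
  then show ?thesis
    by (simp only:) (intro cosine_polynomial.intros)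
qed

text \<open>The product formula for cosines replaces a frequency by its two neighbours. With the
  linear closure rules this makes every polynomial in \<open>cos (pi * x)\<close> a cosine
  polynomial, by Horner's scheme.\<close>

lemma cosine_polynomial_times_cos:
  "cosine_polynomial f \<Longrightarrow> cosine_polynomial (\<lambda>x. cos (pi * x) * f x)"
proof (induction rule: cosine_polynomial.induct)
  case (base k)
  \<comment> \<open>For \<open>k = 0\<close> the lower neighbour is the frequency -1, which evenness
    of the cosine turns into 1.\<close>
  have cospoly: "cosine_polynomial (\<lambda>x. cos (real k * pi * x - pi * x))"
  proof (cases k)
    case 0
    then show ?thesis using cosine_polynomial_cos[of 1] by simp
  next
    case (Suc n)
    have "real k * pi * x - pi * x = real n * pi * x" for x
      by (simp add: Suc algebra_simps)
    then show ?thesis using cosine_polynomial_cos[of n] by simp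
  qed
  have "real k * pi * x + pi * x = real (Suc k) * pi * x" for x
    by (simp add: algebra_simps)
  then have 1: "cosine_polynomial (\<lambda>x. cos (real k * pi * x + pi * x))"
    using cosine_polynomial_cos[of "Suc k"] by simp
  have "(\<lambda>x. cos (pi * x) * cosbasis k x) = (\<lambda>x. (if k = 0 then 1/2 else sqrt 2/2) *
      (cos (real k * pi * x - pi * x) + cos (real k * pi * x + pi * x)))"
    by (rule ext) (simp add: cosbasis_def cos_add cos_diff)
  then show ?case
    by (simp only:) (intro cosine_polynomial.scale cosine_polynomial.add 1 cospoly)
next
  case (add f g)
  then show ?case
    using cosine_polynomial.add[OF add.IH] by (simp add: distrib_left)
next
  case (scale f c)
  then show ?case
    using cosine_polynomial.scale[OF scale.IH, of c] by (simp add: mult.left_commute)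
qed

lemma cosine_polynomial_poly_cos: "cosine_polynomial (\<lambda>x. poly P (cos (pi * x)))"
proof (induction P)
  case 0
  show ?case using cosine_polynomial.scale[OF cosine_polynomial_cos[of 0], of 0] by simp
next
  case (pCons a P)
  have "cosine_polynomial (\<lambda>x. a)"
    using cosine_polynomial.scale[OF cosine_polynomial_cos[of 0], of a] by simp
  from cosine_polynomial.add[OF this cosine_polynomial_times_cos[OF pCons.IH]]
  show ?case by simp
qed

lemma cosine_polynomial_L2: "cosine_polynomial f \<Longrightarrow> f \<in> L2_01"
  by (induction rule: cosine_polynomial.induct) (auto intro: L2_01_add L2_01_scale)

text \<open>Stone-Weierstrass for the algebra of polynomials in \<open>cos (pi * x)\<close>. It
  separates the points of the unit interval because the cosine is injective between 0 and pi, so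
  that no boundary condition on \<open>g\<close> is required.\<close>

lemma cosine_polynomial_uniform_approx:
  assumes "continuous_on {0..1} g" "e > 0"
  shows "\<exists>f. cosine_polynomial f \<and> (\<forall>x\<in>{0..1}. \<bar>g x - f x\<bar> < e)"
proof -
  let ?R = "range (\<lambda>P x. poly P (cos (pi * x)))"
  interpret function_ring_on ?R "{0..1::real}"
  proof
    show "compact {0..1::real}" by simp
  next
    fix f assume "f \<in> ?R"
    then show "continuous_on {0..1} f" by (auto intro!: continuous_intros)
  next
    fix f g assume "f \<in> ?R" "g \<in> ?R"
    then obtain P Q where "f = (\<lambda>x. poly P (cos (pi * x)))" "g = (\<lambda>x. poly Q (cos (pi * x)))"
      by blast
    then have "(\<lambda>x. f x + g x) = (\<lambda>x. poly (P + Q) (cos (pi * x)))"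
      "(\<lambda>x. f x * g x) = (\<lambda>x. poly (P * Q) (cos (pi * x)))" by auto
    then show "(\<lambda>x. f x + g x) \<in> ?R" "(\<lambda>x. f x * g x) \<in> ?R" by blast+
  next
    fix c :: real
    have "(\<lambda>_. c) = (\<lambda>x::real. poly [:c:] (cos (pi * x)))" by simp
    then show "(\<lambda>_. c) \<in> ?R" by blast
  next
    fix x y :: real assume xy: "x \<in> {0..1}" "y \<in> {0..1}" "x \<noteq> y"
    have "cos (pi * x) \<noteq> cos (pi * y)"
    proof
      assume eq: "cos (pi * x) = cos (pi * y)"
      have "pi * x = pi * y"
        by (rule cos_inj_pi[OF _ _ _ _ eq]) (use xy in \<open>auto simp: mult_le_cancel_left1\<close>)
      then show False using xy by simp
    qed
    then have "poly [:0, 1:] (cos (pi * x)) \<noteq> poly [:0, 1:] (cos (pi * y))" by simp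
    then show "\<exists>f\<in>?R. f x \<noteq> f y"
      by (rule bexI[of _ "\<lambda>x. poly [:0, 1:] (cos (pi * x))"]) (rule rangeI)
  qed
  from Stone_Weierstrass_basic[OF assms] obtain f where "f \<in> ?R"
    and f: "\<forall>x\<in>{0..1}. \<bar>g x - f x\<bar> < e"
    by (elim bexE)
  then have "cosine_polynomial f"
    using cosine_polynomial_poly_cos by auto
  with f show ?thesis by blast
qed

text \<open>The parallelogram law with one square dropped; it keeps the density argument in terms of
  squared norms.\<close>

lemma inner01_diff_self_triangle:
  assumes "f \<in> L2_01" "g \<in> L2_01" "h \<in> L2_01"
  shows "inner01 (\<lambda>x. f x - h x) (\<lambda>x. f x - h x) \<le>
    2 * inner01 (\<lambda>x. f x - g x) (\<lambda>x. f x - g x) + 2 * inner01 (\<lambda>x. g x - h x) (\<lambda>x. g x - h x)"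
proof -
  have "0 \<le> inner01 (\<lambda>x. (f x - g x) - (g x - h x)) (\<lambda>x. (f x - g x) - (g x - h x))"
    by simp
  moreover have "inner01 (\<lambda>x. (f x - g x) + (g x - h x)) (\<lambda>x. (f x - g x) + (g x - h x)) =
      inner01 (\<lambda>x. f x - h x) (\<lambda>x. f x - h x)"
    by simp
  ultimately show ?thesis
    using inner01_diff_self[OF L2_01_diff[OF assms(1,2)] L2_01_diff[OF assms(2,3)]]
      inner01_add_self[OF L2_01_diff[OF assms(1,2)] L2_01_diff[OF assms(2,3)]] by linarith
qed

lemma inner01_self_le_sup:
  assumes "f \<in> L2_01" "\<And>x. x \<in> {0..1} \<Longrightarrow> \<bar>f x\<bar> \<le> e"
  shows "inner01 f f \<le> e\<^sup>2"
proof -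
  interpret prob_space unit_lebesgue by (rule unit_lebesgue_prob_space)
  have "inner01 f f \<le> (LINT x|unit_lebesgue. e\<^sup>2)"
    unfolding inner01_eq
  proof (rule integral_mono)
    show "integrable unit_lebesgue (\<lambda>x. f x * f x)" using assms(1) by (rule L2_01_mult_integrable) fact
    fix x assume "x \<in> space unit_lebesgue"
    then have "\<bar>f x\<bar>\<^sup>2 \<le> e\<^sup>2" by (intro power_mono assms(2)) auto
    then show "f x * f x \<le> e\<^sup>2" by (simp add: power2_eq_square)
  qed simp
  then show ?thesis using prob_space by simp
qed

definition clip :: "real \<Rightarrow> real \<Rightarrow> real" where
  "clip B y = max (- B) (min B y)"

lemma clip_bound: "0 \<le> B \<Longrightarrow> \<bar>clip B y\<bar> \<le> B"
  by (auto simp: clip_def)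

lemma clip_abs_le: "0 \<le> B \<Longrightarrow> \<bar>clip B y - y\<bar> \<le> \<bar>y\<bar>"
  by (auto simp: clip_def)

lemma clip_id: "\<bar>y\<bar> \<le> B \<Longrightarrow> clip B y = y"
  by (auto simp: clip_def)

lemma continuous_on_clip [continuous_intros]:
  "continuous_on S f \<Longrightarrow> continuous_on S (\<lambda>x. clip B (f x))"
  unfolding clip_def by (intro continuous_intros)

lemma clip_measurable [measurable]: "clip B \<in> borel_measurable borel"
  unfolding clip_def[abs_def] by measurable

lemma L2_01_clip: "f \<in> L2_01 \<Longrightarrow> 0 \<le> B \<Longrightarrow> (\<lambda>x. clip B (f x)) \<in> L2_01"
  using measurable_compose[OF L2_01_measurable[of f] clip_measurable]
  by (intro L2_01_bounded[where B=B] clip_bound) auto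

lemma L2_01_clip_tendsto:
  assumes f: "f \<in> L2_01"
  shows "(\<lambda>n. inner01 (\<lambda>x. clip (real n) (f x) - f x) (\<lambda>x. clip (real n) (f x) - f x)) \<longlonglongrightarrow> 0"
proof -
  note [measurable] = L2_01_measurable[OF f]
  have "(\<lambda>n. LINT x|unit_lebesgue. (clip (real n) (f x) - f x) * (clip (real n) (f x) - f x))
      \<longlonglongrightarrow> (LINT x|unit_lebesgue. 0)"
  proof (rule integral_dominated_convergence[where w="\<lambda>x. (f x)\<^sup>2"])
    show "integrable unit_lebesgue (\<lambda>x. (f x)\<^sup>2)" using f by (rule L2_01_square_integrable)
    show "AE x in unit_lebesgue. (\<lambda>n. (clip (real n) (f x) - f x) * (clip (real n) (f x) - f x)) \<longlonglongrightarrow> 0"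
    proof (rule AE_I2, rule tendsto_eventually)
      fix x
      show "\<forall>\<^sub>F n in sequentially. (clip (real n) (f x) - f x) * (clip (real n) (f x) - f x) = 0"
        using eventually_ge_at_top[of "nat \<lceil>\<bar>f x\<bar>\<rceil>"]
        by eventually_elim (simp add: clip_id nat_le_iff ceiling_le_iff)
    qed
    have "\<bar>clip (real n) y - y\<bar>\<^sup>2 \<le> \<bar>y\<bar>\<^sup>2" for n y
      by (intro power_mono clip_abs_le) auto
    then show "AE x in unit_lebesgue. norm ((clip (real n) (f x) - f x) * (clip (real n) (f x) - f x)) \<le> (f x)\<^sup>2" for n
      by (simp add: power2_eq_square abs_mult)
  qed simp_all
  then show ?thesis by (simp add: inner01_eq)
qed

text \<open>Measurability supplies continuous functions converging to \<open>f\<close> off a null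
  set, with no bound on them. Clipping at \<open>B\<close> keeps them continuous, leaves the limit
  unchanged and gives a constant majorant, so that dominated convergence applies.\<close>

lemma L2_01_bounded_continuous_approx:
  assumes f: "f \<in> L2_01" "0 \<le> B" and b: "\<And>x. \<bar>f x\<bar> \<le> B" and e: "e > 0"
  shows "\<exists>g. continuous_on UNIV g \<and> inner01 (\<lambda>x. f x - g x) (\<lambda>x. f x - g x) < e"
proof -
  interpret prob_space unit_lebesgue by (rule unit_lebesgue_prob_space)
  note [measurable] = L2_01_measurable[OF f(1)]
  have "(\<lambda>x. indicat_real {0..1} x *\<^sub>R f x) \<in> borel_measurable lborel"
    using f(1) unfolding L2_01_def set_borel_measurable_def by blast
  then have "(\<lambda>x. indicat_real {0..1} x *\<^sub>R f x) \<in> borel_measurable lebesgue"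
    by (simp add: measurable_completion)
  then have "f \<in> borel_measurable (lebesgue_on {0..1})"
    by (subst borel_measurable_restrict_space_iff) auto
  then have "f measurable_on {0..1}"
    by (simp add: measurable_on_iff_borel_measurable)
  then obtain N g where N: "negligible N" and g: "\<And>n. continuous_on UNIV (g n)"
    and lim: "\<And>x. x \<notin> N \<Longrightarrow> (\<lambda>n. g n x) \<longlonglongrightarrow> (if x \<in> {0..1} then f x else 0)"
    unfolding measurable_on_def by blast
  have [measurable]: "g n \<in> borel_measurable unit_lebesgue" for n :: nat
    by (rule measurable_restrict_space1) (simp add: borel_measurable_continuous_onI[OF g])
  have "AE x in lebesgue. x \<notin> N"
    using N by (simp add: negligible_iff_null_sets AE_not_in)
  then have "AE x in lborel. x \<notin> N"
    by (simp add: AE_completion_iff)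
  then have AE_N: "AE x in unit_lebesgue. x \<notin> N"
    by (subst AE_restrict_space_iff) (auto elim: eventually_mono)
  have "(\<lambda>n. LINT x|unit_lebesgue. (f x - clip B (g n x)) * (f x - clip B (g n x)))
      \<longlonglongrightarrow> (LINT x|unit_lebesgue. 0)"
  proof (rule integral_dominated_convergence[where w="\<lambda>x. (2 * B)\<^sup>2"])
    show "AE x in unit_lebesgue. (\<lambda>n. (f x - clip B (g n x)) * (f x - clip B (g n x))) \<longlonglongrightarrow> 0"
      using AE_N AE_space
    proof eventually_elim
      case (elim x)
      have "isCont (clip B) (f x)"
        using continuous_on_clip[OF continuous_on_id, of UNIV B] by (simp add: continuous_on_eq_continuous_at)
      then have "(\<lambda>n. clip B (g n x)) \<longlonglongrightarrow> clip B (f x)"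
        using lim[of x] elim by (intro isCont_tendsto_compose[of _ "clip B"]) auto
      then have "(\<lambda>n. (f x - clip B (g n x)) * (f x - clip B (g n x))) \<longlonglongrightarrow> (f x - f x) * (f x - f x)"
        using b[of x] by (intro tendsto_intros) (simp_all add: clip_id)
      then show ?case by simp
    qed
    have "\<bar>f x - clip B y\<bar>\<^sup>2 \<le> (2 * B)\<^sup>2" for x y
    proof (rule power_mono)
      show "\<bar>f x - clip B y\<bar> \<le> 2 * B" using b[of x] clip_bound[OF f(2), of y] by linarith
    qed simp
    then show "AE x in unit_lebesgue. norm ((f x - clip B (g n x)) * (f x - clip B (g n x))) \<le> (2 * B)\<^sup>2" for n
      by (simp add: power2_eq_square abs_mult)
  qed simp_all
  then have "(\<lambda>n. inner01 (\<lambda>x. f x - clip B (g n x)) (\<lambda>x. f x - clip B (g n x))) \<longlonglongrightarrow> 0"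
    by (simp add: inner01_eq)
  then have "\<forall>\<^sub>F n in sequentially. inner01 (\<lambda>x. f x - clip B (g n x)) (\<lambda>x. f x - clip B (g n x)) < e"
    using e by (rule order_tendstoD)
  then obtain n where "inner01 (\<lambda>x. f x - clip B (g n x)) (\<lambda>x. f x - clip B (g n x)) < e"
    by (auto simp: eventually_sequentially)
  then show ?thesis
    using g[of n] by (intro exI[of _ "\<lambda>x. clip B (g n x)"]) (auto intro: continuous_on_clip)
qed

lemma L2_01_cosine_polynomial_approx:
  assumes f: "f \<in> L2_01" and e: "e > 0"
  shows "\<exists>p. cosine_polynomial p \<and> inner01 (\<lambda>x. f x - p x) (\<lambda>x. f x - p x) < e"
proof -
  have "\<forall>\<^sub>F n in sequentially. inner01 (\<lambda>x. clip (real n) (f x) - f x) (\<lambda>x. clip (real n) (f x) - f x) < e / 16"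
    using L2_01_clip_tendsto[OF f] e by (intro order_tendstoD(2)) auto
  then obtain n where n: "inner01 (\<lambda>x. clip (real n) (f x) - f x) (\<lambda>x. clip (real n) (f x) - f x) < e / 16"
    by (auto simp: eventually_sequentially)
  define h where "h = (\<lambda>x. clip (real n) (f x))"
  have h: "h \<in> L2_01" unfolding h_def using f by (rule L2_01_clip) simp
  have nh: "inner01 (\<lambda>x. f x - h x) (\<lambda>x. f x - h x) < e / 16"
    using n unfolding h_def inner01_eq by (simp add: algebra_simps)
  obtain g where g: "continuous_on UNIV g" and hg: "inner01 (\<lambda>x. h x - g x) (\<lambda>x. h x - g x) < e / 16"
    using L2_01_bounded_continuous_approx[OF h, of "real n" "e / 16"] e clip_bound[of "real n"]
    by (auto simp: h_def)
  have gL: "g \<in> L2_01" using g by (rule L2_01_continuous)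
  obtain p where p: "cosine_polynomial p" and gp: "\<And>x. x \<in> {0..1} \<Longrightarrow> \<bar>g x - p x\<bar> < sqrt (e / 16)"
    using cosine_polynomial_uniform_approx[of g "sqrt (e / 16)"] g e continuous_on_subset by force
  have pL: "p \<in> L2_01" using p by (rule cosine_polynomial_L2)
  have "inner01 (\<lambda>x. g x - p x) (\<lambda>x. g x - p x) \<le> (sqrt (e / 16))\<^sup>2"
    using gp by (intro inner01_self_le_sup L2_01_diff gL pL) (auto intro: less_imp_le)
  then have gp': "inner01 (\<lambda>x. g x - p x) (\<lambda>x. g x - p x) \<le> e / 16" using e by simp
  \<comment> \<open>The two squared triangle inequalities weigh the errors by 2, 4 and 4, so the
    total is at most 10/16 of \<open>e\<close>.\<close>
  have "inner01 (\<lambda>x. f x - p x) (\<lambda>x. f x - p x) < e"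
    using inner01_diff_self_triangle[OF f h pL] inner01_diff_self_triangle[OF h gL pL] nh hg gp' e
    by linarith
  then show ?thesis using p by blast
qed

section \<open>Parseval's identity\<close>

lemma coef_Bessel: "f \<in> L2_01 \<Longrightarrow> (\<Sum>k<n. (coef f k)\<^sup>2) \<le> inner01 f f"
  unfolding coef_def by (rule Bessel_inequality) (auto simp: cosbasis_orthonormal)

theorem Parseval_self:
  assumes f: "f \<in> L2_01"
  shows "(\<lambda>k. (coef f k)\<^sup>2) sums inner01 f f"
  unfolding sums_def
proof (rule increasing_LIMSEQ)
  show "(\<Sum>k<n. (coef f k)\<^sup>2) \<le> (\<Sum>k<Suc n. (coef f k)\<^sup>2)" for n by simp
  show "(\<Sum>k<n. (coef f k)\<^sup>2) \<le> inner01 f f" for n using f by (rule coef_Bessel)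
  fix e :: real assume "e > 0"
  then obtain p where p: "cosine_polynomial p" and fp: "inner01 (\<lambda>x. f x - p x) (\<lambda>x. f x - p x) < e"
    using L2_01_cosine_polynomial_approx[OF f] by blast
  obtain n c where pe: "p = (\<lambda>x. \<Sum>k<n. c k * cosbasis k x)"
    using cosine_polynomial_expansion[OF p] by blast
  \<comment> \<open>The approximant \<open>p\<close> is not the Fourier projection, but its excess
    error is a sum of squares and may be discarded.\<close>
  have "inner01 (\<lambda>x. f x - p x) (\<lambda>x. f x - p x) =
      inner01 f f - (\<Sum>k<n. (coef f k)\<^sup>2) + (\<Sum>k<n. (c k - coef f k)\<^sup>2)"
    unfolding pe coef_def using f
    by (intro orthonormal_diff_self) (auto simp: cosbasis_orthonormal)
  moreover have "0 \<le> (\<Sum>k<n. (c k - coef f k)\<^sup>2)" by (simp add: sum_nonneg)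
  ultimately show "\<exists>n. inner01 f f \<le> (\<Sum>k<n. (coef f k)\<^sup>2) + e"
    using fp by (intro exI[of _ n]) linarith
qed

lemma coef_add: "f \<in> L2_01 \<Longrightarrow> g \<in> L2_01 \<Longrightarrow> coef (\<lambda>x. f x + g x) k = coef f k + coef g k"
  unfolding coef_def by (simp add: inner01_add_left)

lemma coef_diff: "f \<in> L2_01 \<Longrightarrow> g \<in> L2_01 \<Longrightarrow> coef (\<lambda>x. f x - g x) k = coef f k - coef g k"
  unfolding coef_def by (simp add: inner01_diff_left)

lemma coef_scale: "coef (\<lambda>x. c * f x) k = c * coef f k"
  unfolding coef_def by (simp add: inner01_scale_left)

text \<open>Polarisation of \<open>Parseval_self\<close>.\<close>

theorem Parseval:
  assumes f: "f \<in> L2_01" and g: "g \<in> L2_01"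
  shows "(\<lambda>k. coef f k * coef g k) sums inner01 f g"
proof -
  have "(\<lambda>k. ((coef (\<lambda>x. f x + g x) k)\<^sup>2 - (coef (\<lambda>x. f x - g x) k)\<^sup>2) / 4) sums
      ((inner01 (\<lambda>x. f x + g x) (\<lambda>x. f x + g x) - inner01 (\<lambda>x. f x - g x) (\<lambda>x. f x - g x)) / 4)"
    using f g by (intro sums_divide sums_diff Parseval_self L2_01_add L2_01_diff)
  moreover have "((coef (\<lambda>x. f x + g x) k)\<^sup>2 - (coef (\<lambda>x. f x - g x) k)\<^sup>2) / 4 = coef f k * coef g k" for k
    using f g by (simp add: coef_add coef_diff power2_eq_square algebra_simps)
  moreover have "(inner01 (\<lambda>x. f x + g x) (\<lambda>x. f x + g x) - inner01 (\<lambda>x. f x - g x) (\<lambda>x. f x - g x)) / 4 =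
      inner01 f g"
    using f g by (simp add: inner01_diff_self inner01_add_self)
  ultimately show ?thesis by simp
qed

section \<open>Gaussian noise sequences\<close>

abbreviation gauss :: "real \<Rightarrow> real measure" where
  "gauss \<sigma> \<equiv> density lborel (normal_density 0 \<sigma>)"

abbreviation real_sequences :: "(nat \<Rightarrow> real) measure" where
  "real_sequences \<equiv> \<Pi>\<^sub>M k\<in>UNIV. borel"

definition noise :: "real \<Rightarrow> (nat \<Rightarrow> real) measure" where
  "noise \<epsilon> = (\<Pi>\<^sub>M k\<in>UNIV. gauss \<epsilon>)"

lemma sets_noise [measurable_cong]: "sets (noise \<epsilon>) = sets real_sequences"
  unfolding noise_def by (intro sets_PiM_cong) auto

lemma space_noise [simp]: "space (noise \<epsilon>) = UNIV"
  unfolding noise_def by (simp add: space_PiM)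

lemma space_real_sequences [simp]: "space real_sequences = UNIV"
  by (simp add: space_PiM)

lemma noise_prob_space: "\<epsilon> > 0 \<Longrightarrow> prob_space (noise \<epsilon>)"
  unfolding noise_def by (intro prob_space_PiM prob_space_normal_density) auto

section \<open>Integrals against one-dimensional normal laws\<close>

lemma gauss_quadratic:
  assumes "\<epsilon> > 0" and that: "\<And>y. 0 \<le> a + b * y + c * y\<^sup>2"
  shows "(\<integral>\<^sup>+ y. ennreal (a + b * y + c * y\<^sup>2) \<partial>gauss \<epsilon>) = ennreal (a + c * \<epsilon>\<^sup>2)"
proof -
  have m1: "has_bochner_integral lborel (\<lambda>y. normal_density 0 \<epsilon> y * y) 0"
    using normal_moment_nz_1[of \<epsilon> 0] assms by simp
  have m2: "has_bochner_integral lborel (\<lambda>y. normal_density 0 \<epsilon> y * y\<^sup>2) (\<epsilon>\<^sup>2)"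
    using normal_moment_even[of \<epsilon> 0 1] assms by simp
  have m0: "has_bochner_integral lborel (normal_density 0 \<epsilon>) 1"
    using assms by (simp add: has_bochner_integral_iff)
  have "has_bochner_integral lborel (\<lambda>y. a * normal_density 0 \<epsilon> y + b * (normal_density 0 \<epsilon> y * y)
      + c * (normal_density 0 \<epsilon> y * y\<^sup>2)) (a * 1 + b * 0 + c * \<epsilon>\<^sup>2)"
    by (intro has_bochner_integral_add has_bochner_integral_mult_right m0 m1 m2)
  then have "has_bochner_integral lborel (\<lambda>y. normal_density 0 \<epsilon> y * (a + b * y + c * y\<^sup>2)) (a + c * \<epsilon>\<^sup>2)"
    by (simp add: algebra_simps)
  then have h: "integrable lborel (\<lambda>y. normal_density 0 \<epsilon> y * (a + b * y + c * y\<^sup>2))"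
    "(\<integral>y. normal_density 0 \<epsilon> y * (a + b * y + c * y\<^sup>2) \<partial>lborel) = a + c * \<epsilon>\<^sup>2"
    by (simp_all add: has_bochner_integral_iff)
  have "(\<integral>\<^sup>+ y. ennreal (a + b * y + c * y\<^sup>2) \<partial>gauss \<epsilon>) =
      (\<integral>\<^sup>+ y. ennreal (normal_density 0 \<epsilon> y * (a + b * y + c * y\<^sup>2)) \<partial>lborel)"
    by (subst nn_integral_density) (auto simp: ennreal_mult' that intro!: nn_integral_cong)
  also have "\<dots> = ennreal (a + c * \<epsilon>\<^sup>2)"
    using h that by (subst nn_integral_eq_integral) auto
  finally show ?thesis .
qed

lemma normal_density_tilt:
  assumes "\<sigma> > 0"
  shows "exp (t * y) * normal_density 0 \<sigma> y = exp (t\<^sup>2 * \<sigma>\<^sup>2 / 2) * normal_density (t * \<sigma>\<^sup>2) \<sigma> y"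
proof -
  have "t * y + - y\<^sup>2 / (2 * \<sigma>\<^sup>2) = t\<^sup>2 * \<sigma>\<^sup>2 / 2 + - (y - t * \<sigma>\<^sup>2)\<^sup>2 / (2 * \<sigma>\<^sup>2)"
    using assms by (simp add: field_simps power2_eq_square)
  then have "exp (t * y) * exp (- y\<^sup>2 / (2 * \<sigma>\<^sup>2)) =
      exp (t\<^sup>2 * \<sigma>\<^sup>2 / 2) * exp (- (y - t * \<sigma>\<^sup>2)\<^sup>2 / (2 * \<sigma>\<^sup>2))"
    by (simp flip: exp_add)
  then show ?thesis
    unfolding normal_density_def by simp
qed

text \<open>The one-dimensional Cameron-Martin shift: an exponential weight moves the mean by
  \<open>t\<close> times the variance and leaves the variance alone. This is the source of the
  proportionality between the posterior mean and the posterior variance in a fixed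
  direction.\<close>

lemma nn_integral_gauss_tilt:
  assumes "\<sigma> > 0" and [measurable]: "h \<in> borel_measurable borel"
  shows "(\<integral>\<^sup>+ y. h y * ennreal (exp (t * y)) \<partial>gauss \<sigma>) =
    ennreal (exp (t\<^sup>2 * \<sigma>\<^sup>2 / 2)) * (\<integral>\<^sup>+ y. h y \<partial>density lborel (normal_density (t * \<sigma>\<^sup>2) \<sigma>))"
proof -
  have "(\<integral>\<^sup>+ y. h y * ennreal (exp (t * y)) \<partial>gauss \<sigma>) =
      (\<integral>\<^sup>+ y. ennreal (exp (t\<^sup>2 * \<sigma>\<^sup>2 / 2)) * (ennreal (normal_density (t * \<sigma>\<^sup>2) \<sigma> y) * h y) \<partial>lborel)"
  proof (subst nn_integral_density, simp, simp, rule nn_integral_cong)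
    fix y
    have "ennreal (normal_density 0 \<sigma> y) * (h y * ennreal (exp (t * y))) =
        h y * ennreal (exp (t * y) * normal_density 0 \<sigma> y)"
      by (simp add: ennreal_mult' mult_ac)
    also have "\<dots> = ennreal (exp (t\<^sup>2 * \<sigma>\<^sup>2 / 2)) * (ennreal (normal_density (t * \<sigma>\<^sup>2) \<sigma> y) * h y)"
      unfolding normal_density_tilt[OF assms(1)] by (simp add: ennreal_mult' mult_ac)
    finally show "ennreal (normal_density 0 \<sigma> y) * (h y * ennreal (exp (t * y))) = \<dots>" .
  qed
  also have "\<dots> = ennreal (exp (t\<^sup>2 * \<sigma>\<^sup>2 / 2)) * (\<integral>\<^sup>+ y. h y \<partial>density lborel (normal_density (t * \<sigma>\<^sup>2) \<sigma>))"
    by (subst nn_integral_cmult) (auto simp: nn_integral_density)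
  finally show ?thesis .
qed

lemma nn_integral_exp_gauss:
  assumes "\<sigma> > 0"
  shows "(\<integral>\<^sup>+ y. ennreal (exp (t * y)) \<partial>gauss \<sigma>) = ennreal (exp (t\<^sup>2 * \<sigma>\<^sup>2 / 2))"
  using nn_integral_gauss_tilt[OF assms, of "\<lambda>_. 1" t]
    prob_space.emeasure_space_1[OF prob_space_normal_density[OF assms, of "t * \<sigma>\<^sup>2"]]
  by (simp add: nn_integral_const)

section \<open>Random series under the noise\<close>

lemma nn_integral_noise_split:
  assumes "\<epsilon> > 0" and [measurable]: "F \<in> borel_measurable real_sequences"
  shows "(\<integral>\<^sup>+ Y. F Y \<partial>noise \<epsilon>) = (\<integral>\<^sup>+ y. \<integral>\<^sup>+ \<omega>. F (case_nat y \<omega>) \<partial>noise \<epsilon> \<partial>gauss \<epsilon>)"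
proof -
  interpret N: prob_space "gauss \<epsilon>"
    using assms(1) by (rule prob_space_normal_density)
  interpret sequence_space "gauss \<epsilon>" ..
  have F: "F \<in> borel_measurable (\<Pi>\<^sub>M i\<in>UNIV. gauss \<epsilon>)"
    using assms(2) sets_noise[of \<epsilon>] unfolding noise_def by (simp cong: measurable_cong_sets)
  \<comment> \<open>An i.i.d. sequence keeps its law when an independent coordinate is put in front.
    Inductions over partial sums of the noise remove this first coordinate.\<close>
  have "(\<integral>\<^sup>+ Y. F Y \<partial>noise \<epsilon>) = (\<integral>\<^sup>+ Y. F Y \<partial>distr (gauss \<epsilon> \<Otimes>\<^sub>M S) S (\<lambda>(s, \<omega>). case_nat s \<omega>))"
    unfolding PiM_iter by (simp add: noise_def)
  also have "\<dots> = (\<integral>\<^sup>+ (y, \<omega>). F (case_nat y \<omega>) \<partial>(gauss \<epsilon> \<Otimes>\<^sub>M S))"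
    using F by (subst nn_integral_distr) (auto simp: split_beta')
  also have "\<dots> = (\<integral>\<^sup>+ y. \<integral>\<^sup>+ \<omega>. F (case_nat y \<omega>) \<partial>S \<partial>gauss \<epsilon>)"
    using F by (subst P.nn_integral_fst[symmetric]) (auto simp: split_beta')
  finally show ?thesis by (simp add: noise_def)
qed

text \<open>Kolmogorov's inequality, started at an arbitrary point \<open>s\<close>: this generality lets one condition
  on the first coordinate.\<close>

lemma noise_maximal_inequality:
  assumes eps: "\<epsilon> > 0" and lam: "r > 0"
  shows "emeasure (noise \<epsilon>) {Y. \<exists>m\<le>n. r \<le> \<bar>s + (\<Sum>k<m. Y k * x k)\<bar>} \<le>
    ennreal ((s\<^sup>2 + \<epsilon>\<^sup>2 * (\<Sum>k<n. (x k)\<^sup>2)) / r\<^sup>2)"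
proof (induction n arbitrary: s x)
  case 0
  interpret prob_space "noise \<epsilon>" using eps by (rule noise_prob_space)
  show ?case
  proof (cases "r \<le> \<bar>s\<bar>")
    case True
    then have "r\<^sup>2 \<le> s\<^sup>2" using lam by (metis abs_le_square_iff abs_of_pos)
    then have "1 \<le> s\<^sup>2 / r\<^sup>2" using lam by simp
    then have "1 \<le> ennreal (s\<^sup>2 / r\<^sup>2)" using ennreal_leI by fastforce
    with emeasure_le_1 show ?thesis by (rule order_trans[THEN order_trans[OF _ eq_refl]]) simp
  qed simp
next
  case (Suc n)
  interpret prob_space "noise \<epsilon>" using eps by (rule noise_prob_space)
  let ?E = "\<lambda>n s x. {Y. \<exists>m\<le>n. r \<le> \<bar>s + (\<Sum>k<m. Y k * x k)\<bar>}"
  have E [measurable]: "?E n s x \<in> sets real_sequences" for n s x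
  proof -
    have "{Y \<in> space real_sequences. \<exists>m\<le>n. r \<le> \<bar>s + (\<Sum>k<m. Y k * x k)\<bar>} \<in> sets real_sequences"
      by measurable
    then show ?thesis by simp
  qed
  define V where "V = \<epsilon>\<^sup>2 * (\<Sum>k<n. (x (Suc k))\<^sup>2)"
  have V: "0 \<le> V" by (simp add: V_def sum_nonneg)
  have VS: "\<epsilon>\<^sup>2 * (\<Sum>k<Suc n. (x k)\<^sup>2) = \<epsilon>\<^sup>2 * (x 0)\<^sup>2 + V"
    by (simp add: V_def sum.lessThan_Suc_shift algebra_simps del: sum.lessThan_Suc)
  show ?case
  proof (cases "r \<le> \<bar>s\<bar>")
    case True
    then have "r\<^sup>2 \<le> s\<^sup>2" using lam by (metis abs_le_square_iff abs_of_pos)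
    then have "1 \<le> (s\<^sup>2 + (\<epsilon>\<^sup>2 * (x 0)\<^sup>2 + V)) / r\<^sup>2"
      using lam V by (simp add: add_increasing2)
    then have "1 \<le> ennreal ((s\<^sup>2 + (\<epsilon>\<^sup>2 * (x 0)\<^sup>2 + V)) / r\<^sup>2)"
      using ennreal_leI by fastforce
    then show ?thesis unfolding VS using emeasure_le_1 order_trans by blast
  next
    case False
    \<comment> \<open>The walk has not crossed at time 0 because \<open>s\<close> is below the level
      in absolute value. So a crossing is one of the walk restarted at \<open>s + y * x 0\<close>,
      with one step fewer and shifted weights.\<close>
    have ev: "case_nat y \<omega> \<in> ?E (Suc n) s x \<longleftrightarrow> \<omega> \<in> ?E n (s + y * x 0) (\<lambda>k. x (Suc k))" for y \<omega>
    proof -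
      have "(\<Sum>k<Suc m. case_nat y \<omega> k * x k) = y * x 0 + (\<Sum>k<m. \<omega> k * x (Suc k))" for m
        by (simp add: sum.lessThan_Suc_shift del: sum.lessThan_Suc)
      then have sumS: "s + (\<Sum>k<Suc m. case_nat y \<omega> k * x k) = s + y * x 0 + (\<Sum>k<m. \<omega> k * x (Suc k))" for m
        by simp
      show ?thesis
      proof
        assume "case_nat y \<omega> \<in> ?E (Suc n) s x"
        then obtain m where m: "m \<le> Suc n" "r \<le> \<bar>s + (\<Sum>k<m. case_nat y \<omega> k * x k)\<bar>" by blast
        with False obtain m' where "m = Suc m'" by (cases m) auto
        with m sumS[of m'] show "\<omega> \<in> ?E n (s + y * x 0) (\<lambda>k. x (Suc k))" by auto
      next
        assume "\<omega> \<in> ?E n (s + y * x 0) (\<lambda>k. x (Suc k))"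
        then obtain m where "m \<le> n" "r \<le> \<bar>s + y * x 0 + (\<Sum>k<m. \<omega> k * x (Suc k))\<bar>" by blast
        then have "Suc m \<le> Suc n \<and> r \<le> \<bar>s + (\<Sum>k<Suc m. case_nat y \<omega> k * x k)\<bar>"
          unfolding sumS by simp
        then show "case_nat y \<omega> \<in> ?E (Suc n) s x" by blast
      qed
    qed
    have "emeasure (noise \<epsilon>) (?E (Suc n) s x) = (\<integral>\<^sup>+ Y. indicator (?E (Suc n) s x) Y \<partial>noise \<epsilon>)"
      using E by (subst nn_integral_indicator) (simp_all add: sets_noise)
    also have "\<dots> = (\<integral>\<^sup>+ y. \<integral>\<^sup>+ \<omega>. indicator (?E (Suc n) s x) (case_nat y \<omega>) \<partial>noise \<epsilon> \<partial>gauss \<epsilon>)"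
      using eps by (rule nn_integral_noise_split) (rule borel_measurable_indicator[OF E])
    also have "\<dots> = (\<integral>\<^sup>+ y. emeasure (noise \<epsilon>) (?E n (s + y * x 0) (\<lambda>k. x (Suc k))) \<partial>gauss \<epsilon>)"
    proof (rule nn_integral_cong)
      fix y
      have "(\<integral>\<^sup>+ \<omega>. indicator (?E (Suc n) s x) (case_nat y \<omega>) \<partial>noise \<epsilon>) =
          (\<integral>\<^sup>+ \<omega>. indicator (?E n (s + y * x 0) (\<lambda>k. x (Suc k))) \<omega> \<partial>noise \<epsilon>)"
        by (rule nn_integral_cong) (simp only: indicator_def ev)
      also have "\<dots> = emeasure (noise \<epsilon>) (?E n (s + y * x 0) (\<lambda>k. x (Suc k)))"
        using E by (subst nn_integral_indicator) (simp_all add: sets_noise)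
      finally show "(\<integral>\<^sup>+ \<omega>. indicator (?E (Suc n) s x) (case_nat y \<omega>) \<partial>noise \<epsilon>) = \<dots>" .
    qed
    \<comment> \<open>The induction hypothesis is quadratic in the starting point. Averaging over
      \<open>y\<close> removes the cross term and adds the variance of the first step.\<close>
    also have "\<dots> \<le> (\<integral>\<^sup>+ y. ennreal (((s + y * x 0)\<^sup>2 + V) / r\<^sup>2) \<partial>gauss \<epsilon>)"
      unfolding V_def by (intro nn_integral_mono Suc.IH)
    also have "\<dots> = (\<integral>\<^sup>+ y. ennreal ((s\<^sup>2 + V) / r\<^sup>2 + (2 * s * x 0 / r\<^sup>2) * y + ((x 0)\<^sup>2 / r\<^sup>2) * y\<^sup>2) \<partial>gauss \<epsilon>)"
      by (intro nn_integral_cong arg_cong[where f=ennreal]) (simp add: power2_sum power_mult_distrib add_divide_distrib mult_ac)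
    also have "\<dots> = ennreal ((s\<^sup>2 + V) / r\<^sup>2 + (x 0)\<^sup>2 / r\<^sup>2 * \<epsilon>\<^sup>2)"
    proof (rule gauss_quadratic[OF eps])
      fix y
      have "(s\<^sup>2 + V) / r\<^sup>2 + (2 * s * x 0 / r\<^sup>2) * y + ((x 0)\<^sup>2 / r\<^sup>2) * y\<^sup>2 = ((s + y * x 0)\<^sup>2 + V) / r\<^sup>2"
        by (simp add: power2_sum power_mult_distrib add_divide_distrib mult_ac)
      also have "0 \<le> \<dots>" using V by simp
      finally show "0 \<le> (s\<^sup>2 + V) / r\<^sup>2 + (2 * s * x 0 / r\<^sup>2) * y + ((x 0)\<^sup>2 / r\<^sup>2) * y\<^sup>2" .
    qed
    also have "(s\<^sup>2 + V) / r\<^sup>2 + (x 0)\<^sup>2 / r\<^sup>2 * \<epsilon>\<^sup>2 = (s\<^sup>2 + \<epsilon>\<^sup>2 * (\<Sum>k<Suc n. (x k)\<^sup>2)) / r\<^sup>2"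
      unfolding VS by (simp add: add_divide_distrib mult.commute)
    finally show ?thesis .
  qed
qed

text \<open>Setting the first \<open>n\<close> weights to zero turns the block sums from
  \<open>n\<close> on into partial sums started at 0. The maximal inequality then has a bound that
  is uniform in the horizon \<open>N\<close>, and the events increase with \<open>N\<close>.\<close>

lemma noise_tail_inequality:
  assumes eps: "\<epsilon> > 0" and lam: "r > 0" and x: "summable (\<lambda>k. (x k)\<^sup>2)"
  shows "emeasure (noise \<epsilon>) {Y. \<exists>m\<ge>n. r \<le> \<bar>\<Sum>k=n..<m. Y k * x k\<bar>} \<le>
    ennreal (\<epsilon>\<^sup>2 * (\<Sum>k. (x (k + n))\<^sup>2) / r\<^sup>2)"
proof -
  define x' where "x' k = (if k < n then 0 else x k)" for k
  let ?E = "\<lambda>N. {Y. \<exists>m\<le>N. r \<le> \<bar>0 + (\<Sum>k<m. Y k * x' k)\<bar>}"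
  have sum0: "(\<Sum>k<m. Y k * x' k) = 0" if "m \<le> n" for m and Y :: "nat \<Rightarrow> real"
    using that by (intro sum.neutral) (auto simp: x'_def)
  have sumn: "(\<Sum>k<m. Y k * x' k) = (\<Sum>k=n..<m. Y k * x k)" for m and Y :: "nat \<Rightarrow> real"
    by (rule sum.mono_neutral_cong_right) (auto simp: x'_def)
  have E: "?E N \<in> sets (noise \<epsilon>)" for N
  proof -
    have "{Y \<in> space real_sequences. \<exists>m\<le>N. r \<le> \<bar>0 + (\<Sum>k<m. Y k * x' k)\<bar>} \<in> sets real_sequences"
      by measurable
    then show ?thesis by (simp add: sets_noise)
  qed
  have eqU: "{Y. \<exists>m\<ge>n. r \<le> \<bar>\<Sum>k=n..<m. Y k * x k\<bar>} = (\<Union>N. ?E N)"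
  proof (intro equalityI subsetI)
    fix Y assume "Y \<in> {Y. \<exists>m\<ge>n. r \<le> \<bar>\<Sum>k=n..<m. Y k * x k\<bar>}"
    then obtain m where "r \<le> \<bar>\<Sum>k=n..<m. Y k * x k\<bar>" by blast
    then have "Y \<in> ?E m" by (auto simp: sumn)
    then show "Y \<in> (\<Union>N. ?E N)" by blast
  next
    fix Y assume "Y \<in> (\<Union>N. ?E N)"
    then obtain m where m: "r \<le> \<bar>\<Sum>k<m. Y k * x' k\<bar>" by auto
    then have "n \<le> m" using lam sum0[of m Y] by (cases "m \<le> n") auto
    then show "Y \<in> {Y. \<exists>m\<ge>n. r \<le> \<bar>\<Sum>k=n..<m. Y k * x k\<bar>}" using m by (auto simp: sumn)
  qed
  have tail: "summable (\<lambda>k. (x (k + n))\<^sup>2)"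
    using summable_ignore_initial_segment[OF x, of n] .
  have "emeasure (noise \<epsilon>) (\<Union>N. ?E N) = (SUP N. emeasure (noise \<epsilon>) (?E N))"
    using E by (intro SUP_emeasure_incseq[symmetric]) (auto simp: incseq_def intro: order_trans)
  also have "\<dots> \<le> ennreal (\<epsilon>\<^sup>2 * (\<Sum>k. (x (k + n))\<^sup>2) / r\<^sup>2)"
  proof (rule SUP_least)
    fix N
    have "(\<Sum>k<N. (x' k)\<^sup>2) \<le> (\<Sum>k<N+n. (x' k)\<^sup>2)"
      by (intro sum_mono2) auto
    also have "\<dots> = (\<Sum>k=n..<N+n. (x k)\<^sup>2)"
      by (rule sum.mono_neutral_cong_right) (auto simp: x'_def)
    also have "\<dots> = (\<Sum>k<N. (x (k + n))\<^sup>2)"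
      by (rule sum.reindex_bij_witness[of _ "\<lambda>k. k + n" "\<lambda>k. k - n"]) auto
    also have "\<dots> \<le> (\<Sum>k. (x (k + n))\<^sup>2)"
      using tail by (intro sum_le_suminf) auto
    finally have "\<epsilon>\<^sup>2 * (\<Sum>k<N. (x' k)\<^sup>2) / r\<^sup>2 \<le> \<epsilon>\<^sup>2 * (\<Sum>k. (x (k + n))\<^sup>2) / r\<^sup>2"
      by (intro divide_right_mono mult_left_mono) auto
    then show "emeasure (noise \<epsilon>) (?E N) \<le> ennreal (\<epsilon>\<^sup>2 * (\<Sum>k. (x (k + n))\<^sup>2) / r\<^sup>2)"
      using noise_maximal_inequality[OF eps lam, of N 0 x'] by (simp add: ennreal_leI order_trans)
  qed
  finally show ?thesis unfolding eqU .
qed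

text \<open>Kolmogorov's argument: the tail bound tends to 0 with the remainder of the square sum,
  so for each level an oscillation beyond every index is a null event. The countably many levels
  \<open>1 / real (Suc i)\<close> then give the Cauchy property almost surely.\<close>

theorem noise_AE_summable:
  assumes eps: "\<epsilon> > 0" and x: "summable (\<lambda>k. (x k)\<^sup>2)"
  shows "AE Y in noise \<epsilon>. summable (\<lambda>k. Y k * x k)"
proof -
  let ?E = "\<lambda>n r. {Y. \<exists>m\<ge>n. r \<le> \<bar>\<Sum>k=n..<m. Y k * x k\<bar>}"
  have E: "?E n r \<in> sets (noise \<epsilon>)" for n and r :: real
  proof -
    have "{Y \<in> space real_sequences. \<exists>m\<in>{n..}. r \<le> \<bar>\<Sum>k=n..<m. Y k * x k\<bar>} \<in> sets real_sequences"
      by measurable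
    moreover have "{Y \<in> space real_sequences. \<exists>m\<in>{n..}. r \<le> \<bar>\<Sum>k=n..<m. Y k * x k\<bar>} = ?E n r"
      by auto
    ultimately show ?thesis by (simp add: sets_noise)
  qed
  have null: "(\<Inter>n. ?E n r) \<in> null_sets (noise \<epsilon>)" if lam: "r > 0" for r
  proof (rule null_setsI)
    have "(\<lambda>n. \<Sum>k. (x (k + n))\<^sup>2) \<longlonglongrightarrow> 0"
      using suminf_exist_split2[OF x] .
    then have "(\<lambda>n. \<epsilon>\<^sup>2 * (\<Sum>k. (x (k + n))\<^sup>2) / r\<^sup>2) \<longlonglongrightarrow> \<epsilon>\<^sup>2 * 0 / r\<^sup>2"
      using lam by (intro tendsto_intros) auto
    then have lim: "(\<lambda>n. ennreal (\<epsilon>\<^sup>2 * (\<Sum>k. (x (k + n))\<^sup>2) / r\<^sup>2)) \<longlonglongrightarrow> 0"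
      using tendsto_ennrealI by fastforce
    have "emeasure (noise \<epsilon>) (\<Inter>n. ?E n r) \<le> ennreal (\<epsilon>\<^sup>2 * (\<Sum>k. (x (k + n))\<^sup>2) / r\<^sup>2)" for n
    proof -
      have "emeasure (noise \<epsilon>) (\<Inter>n. ?E n r) \<le> emeasure (noise \<epsilon>) (?E n r)"
        by (intro emeasure_mono E) blast
      also have "\<dots> \<le> ennreal (\<epsilon>\<^sup>2 * (\<Sum>k. (x (k + n))\<^sup>2) / r\<^sup>2)"
        by (rule noise_tail_inequality[OF eps lam x])
      finally show ?thesis .
    qed
    then have "emeasure (noise \<epsilon>) (\<Inter>n. ?E n r) \<le> 0"
      by (intro LIMSEQ_le_const[OF lim]) auto
    then show "emeasure (noise \<epsilon>) (\<Inter>n. ?E n r) = 0" by simp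
    show "(\<Inter>n. ?E n r) \<in> sets (noise \<epsilon>)" using E by (intro sets.countable_INT) auto
  qed
  have "AE Y in noise \<epsilon>. \<forall>i. \<exists>n. Y \<notin> ?E n (1 / real (Suc i))"
  proof (subst AE_all_countable, rule allI)
    fix i
    show "AE Y in noise \<epsilon>. \<exists>n. Y \<notin> ?E n (1 / real (Suc i))"
      by (rule AE_I'[OF null[of "1 / real (Suc i)"]]) auto
  qed
  then show ?thesis
  proof (rule eventually_mono)
    fix Y assume Y: "\<forall>i. \<exists>n. Y \<notin> ?E n (1 / real (Suc i))"
    show "summable (\<lambda>k. Y k * x k)"
      unfolding summable_iff_convergent
    proof (rule Cauchy_convergent, rule metric_CauchyI)
      fix e :: real assume "e > 0"
      then obtain i where i: "1 / real (Suc i) < e / 2"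
        using reals_Archimedean[of "e / 2"] by (auto simp: inverse_eq_divide)
      obtain n where n: "Y \<notin> ?E n (1 / real (Suc i))" using Y by blast
      have b: "\<bar>(\<Sum>k<m. Y k * x k) - (\<Sum>k<n. Y k * x k)\<bar> < e / 2" if "n \<le> m" for m
      proof -
        have "(\<Sum>k<m. Y k * x k) - (\<Sum>k<n. Y k * x k) = (\<Sum>k=n..<m. Y k * x k)"
          using that sum_diff_nat_ivl[of 0 n m "\<lambda>k. Y k * x k"] by (simp add: atLeast0LessThan)
        then show ?thesis using n i that by (force simp: not_le)
      qed
      show "\<exists>M. \<forall>m\<ge>M. \<forall>n\<ge>M. dist (\<Sum>k<m. Y k * x k) (\<Sum>k<n. Y k * x k) < e"
      proof (intro exI[of _ n] allI impI)
        fix m m' assume "n \<le> m" "n \<le> m'"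
        then show "dist (\<Sum>k<m. Y k * x k) (\<Sum>k<m'. Y k * x k) < e"
          using b[of m] b[of m'] unfolding dist_real_def by linarith
      qed
    qed
  qed
qed

lemma nn_integral_noise_exp_partial:
  assumes eps: "\<epsilon> > 0"
  shows "(\<integral>\<^sup>+ Y. ennreal (exp (\<Sum>k<n. Y k * x k)) \<partial>noise \<epsilon>) = ennreal (exp (\<epsilon>\<^sup>2 * (\<Sum>k<n. (x k)\<^sup>2) / 2))"
proof (induction n arbitrary: x)
  case 0
  interpret prob_space "noise \<epsilon>" using eps by (rule noise_prob_space)
  show ?case using emeasure_space_1 by simp
next
  case (Suc n)
  let ?v = "\<epsilon>\<^sup>2 * (\<Sum>k<n. (x (Suc k))\<^sup>2) / 2"
  have "(\<integral>\<^sup>+ Y. ennreal (exp (\<Sum>k<Suc n. Y k * x k)) \<partial>noise \<epsilon>) =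
      (\<integral>\<^sup>+ y. \<integral>\<^sup>+ \<omega>. ennreal (exp (\<Sum>k<Suc n. case_nat y \<omega> k * x k)) \<partial>noise \<epsilon> \<partial>gauss \<epsilon>)"
    using eps by (rule nn_integral_noise_split) measurable
  also have "\<dots> = (\<integral>\<^sup>+ y. \<integral>\<^sup>+ \<omega>. ennreal (exp (x 0 * y)) * ennreal (exp (\<Sum>k<n. \<omega> k * x (Suc k))) \<partial>noise \<epsilon> \<partial>gauss \<epsilon>)"
    by (simp add: sum.lessThan_Suc_shift exp_add ennreal_mult mult.commute del: sum.lessThan_Suc)
  also have "\<dots> = (\<integral>\<^sup>+ y. ennreal (exp (x 0 * y)) * ennreal (exp ?v) \<partial>gauss \<epsilon>)"
    by (subst nn_integral_cmult) (simp_all add: Suc.IH)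
  also have "\<dots> = ennreal (exp ((x 0)\<^sup>2 * \<epsilon>\<^sup>2 / 2)) * ennreal (exp ?v)"
    by (subst nn_integral_multc) (simp_all add: nn_integral_exp_gauss[OF eps])
  also have "\<dots> = ennreal (exp (\<epsilon>\<^sup>2 * (\<Sum>k<Suc n. (x k)\<^sup>2) / 2))"
    by (simp add: sum.lessThan_Suc_shift ennreal_mult[symmetric] algebra_simps add_divide_distrib
      del: sum.lessThan_Suc flip: exp_add)
  finally show ?case .
qed

text \<open>Fatou's lemma passes from the partial sums to the series. The resulting inequality is
  what the finiteness of evidences rests on.\<close>

lemma nn_integral_noise_exp_le:
  assumes eps: "\<epsilon> > 0" and x: "summable (\<lambda>k. (x k)\<^sup>2)"
  shows "(\<integral>\<^sup>+ Y. ennreal (exp (\<Sum>k. Y k * x k)) \<partial>noise \<epsilon>) \<le> ennreal (exp (\<epsilon>\<^sup>2 * (\<Sum>k. (x k)\<^sup>2) / 2))"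
proof -
  have "(\<integral>\<^sup>+ Y. ennreal (exp (\<Sum>k. Y k * x k)) \<partial>noise \<epsilon>) =
      (\<integral>\<^sup>+ Y. liminf (\<lambda>n. ennreal (exp (\<Sum>k<n. Y k * x k))) \<partial>noise \<epsilon>)"
  proof (rule nn_integral_cong_AE)
    show "AE Y in noise \<epsilon>. ennreal (exp (\<Sum>k. Y k * x k)) = liminf (\<lambda>n. ennreal (exp (\<Sum>k<n. Y k * x k)))"
      using noise_AE_summable[OF eps x]
    proof eventually_elim
      case (elim Y)
      then have "(\<lambda>n. ennreal (exp (\<Sum>k<n. Y k * x k))) \<longlonglongrightarrow> ennreal (exp (\<Sum>k. Y k * x k))"
        by (intro tendsto_ennrealI tendsto_exp summable_LIMSEQ)
      then show ?case by (rule lim_imp_Liminf[OF trivial_limit_sequentially, symmetric])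
    qed
  qed
  also have "\<dots> \<le> liminf (\<lambda>n. \<integral>\<^sup>+ Y. ennreal (exp (\<Sum>k<n. Y k * x k)) \<partial>noise \<epsilon>)"
    by (rule nn_integral_liminf) measurable
  also have "\<dots> \<le> ennreal (exp (\<epsilon>\<^sup>2 * (\<Sum>k. (x k)\<^sup>2) / 2))"
  proof (rule order_trans[OF Liminf_le_Limsup Limsup_bounded])
    show "\<forall>\<^sub>F n in sequentially. (\<integral>\<^sup>+ Y. ennreal (exp (\<Sum>k<n. Y k * x k)) \<partial>noise \<epsilon>) \<le> ennreal (exp (\<epsilon>\<^sup>2 * (\<Sum>k. (x k)\<^sup>2) / 2))"
      unfolding nn_integral_noise_exp_partial[OF eps]
      using x by (intro always_eventually allI ennreal_leI) (auto intro!: divide_right_mono mult_left_mono sum_le_suminf)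
  qed simp
  finally show ?thesis .
qed

text \<open>All data laws become translates of one noise law. This couples the experiments for
  different regression functions: the same noise sequence yields data around \<open>0\<close> and
  around \<open>a * g\<close>.\<close>

lemma data_law_eq_distr_noise:
  assumes eps: "\<epsilon> > 0"
  shows "data_law \<epsilon> f = distr (noise \<epsilon>) real_sequences (\<lambda>Y k. Y k + coef f k)"
proof -
  interpret N: prob_space "gauss \<epsilon>"
    using eps by (rule prob_space_normal_density)
  interpret I: product_prob_space "\<lambda>k. gauss \<epsilon>" "UNIV :: nat set" ..
  have ps: "prob_space (density lborel (normal_density c \<epsilon>))" for c
    using eps by (rule prob_space_normal_density)
  interpret D: product_prob_space "\<lambda>k. density lborel (normal_density (coef f k) \<epsilon>)" "UNIV :: nat set"
    unfolding product_prob_space_def product_prob_space_axioms_def product_sigma_finite_def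
    using ps prob_space_imp_sigma_finite by blast
  have T [measurable]: "(\<lambda>Y k. Y k + coef f k) \<in> noise \<epsilon> \<rightarrow>\<^sub>M real_sequences"
    by (rule measurable_PiM_single') (auto simp: sets_noise cong: measurable_cong_sets)
  have shift: "emeasure (density lborel (normal_density c \<epsilon>)) A = emeasure (gauss \<epsilon>) {y. y + c \<in> A}"
    if A: "A \<in> sets borel" for A c
  proof -
    have "distributed (gauss \<epsilon>) lborel (\<lambda>y. y) (normal_density 0 \<epsilon>)"
      unfolding distributed_def by (auto simp: distr_id2 sets_eq_imp_space_eq)
    from N.normal_density_affine[OF this eps, of 1 c]
    have "distr (gauss \<epsilon>) lborel (\<lambda>y. c + y) = density lborel (normal_density c \<epsilon>)"
      by (simp add: distributed_def eps abs_of_pos)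
    then have "emeasure (density lborel (normal_density c \<epsilon>)) A = emeasure (distr (gauss \<epsilon>) lborel (\<lambda>y. c + y)) A"
      by simp
    also have "\<dots> = emeasure (gauss \<epsilon>) {y. y + c \<in> A}"
      using A by (subst emeasure_distr) (auto simp: vimage_def add.commute)
    finally show ?thesis .
  qed
  show ?thesis
    unfolding data_law_def
  proof (rule D.PiM_eq[symmetric])
    show "sets (distr (noise \<epsilon>) real_sequences (\<lambda>Y k. Y k + coef f k)) =
        sets (\<Pi>\<^sub>M k\<in>UNIV. density lborel (normal_density (coef f k) \<epsilon>))"
      unfolding sets_distr by (intro sets_PiM_cong) auto
    fix J :: "nat set" and F :: "nat \<Rightarrow> real set"
    assume J: "finite J" "J \<subseteq> UNIV" and F: "\<And>j. j \<in> J \<Longrightarrow> F j \<in> sets (density lborel (normal_density (coef f j) \<epsilon>))"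
    let ?X = "prod_emb UNIV (\<lambda>k. density lborel (normal_density (coef f k) \<epsilon>)) J (\<Pi>\<^sub>E j\<in>J. F j)"
    let ?X' = "prod_emb UNIV (\<lambda>k. gauss \<epsilon>) J (\<Pi>\<^sub>E j\<in>J. {y. y + coef f j \<in> F j})"
    have F': "{y. y + coef f j \<in> F j} \<in> sets borel" if "j \<in> J" for j
    proof -
      have "F j \<in> sets borel" using F[OF that] by simp
      then have "(\<lambda>y. y + coef f j) -` F j \<inter> space borel \<in> sets borel" by (intro measurable_sets) auto
      then show ?thesis by (simp add: vimage_def)
    qed
    have "?X = prod_emb UNIV (\<lambda>k. borel) J (\<Pi>\<^sub>E j\<in>J. F j)"
      by (simp add: prod_emb_def)
    also have "\<dots> \<in> sets real_sequences"
      using J F by (intro sets_PiM_I) auto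
    finally have X: "?X \<in> sets real_sequences" .
    have "emeasure (distr (noise \<epsilon>) real_sequences (\<lambda>Y k. Y k + coef f k)) ?X = emeasure (noise \<epsilon>) ?X'"
      using X by (subst emeasure_distr[OF T]) (auto simp: prod_emb_def vimage_def PiE_iff extensional_def intro!: arg_cong[where f="emeasure (noise \<epsilon>)"])
    also have "\<dots> = (\<Prod>j\<in>J. emeasure (gauss \<epsilon>) {y. y + coef f j \<in> F j})"
      unfolding noise_def by (rule I.emeasure_PiM_emb[OF J(2,1)]) (simp only: sets_density sets_lborel F')
    also have "\<dots> = (\<Prod>j\<in>J. emeasure (density lborel (normal_density (coef f j) \<epsilon>)) (F j))"
      using F by (intro prod.cong refl shift[symmetric]) simp
    finally show "emeasure (distr (noise \<epsilon>) real_sequences (\<lambda>Y k. Y k + coef f k)) ?X = \<dots>" .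
  qed
qed

section \<open>Uniqueness of the characteristic functional\<close>

text \<open>Normalisation to the probability case: the characteristic functions at 0 show that the
  total masses agree, and a common mass of 0 makes both measures null.\<close>

lemma Levy_uniqueness_finite:
  assumes fin: "finite_measure M1" "finite_measure M2"
    and sets: "sets M1 = sets borel" "sets M2 = sets borel"
    and ch: "\<And>t. char M1 t = char M2 t"
  shows "M1 = M2"
proof -
  interpret M1: finite_measure M1 by fact
  interpret M2: finite_measure M2 by fact
  have sp: "space M1 = UNIV" "space M2 = UNIV"
    using sets[THEN sets_eq_imp_space_eq] by simp_all
  have tot: "char M1 0 = of_real (measure M1 UNIV)" "char M2 0 = of_real (measure M2 UNIV)"
    unfolding char_def by (simp_all add: sp scaleR_conv_of_real)
  define c where "c = measure M1 UNIV"
  have c1: "emeasure M1 UNIV = ennreal c" by (simp add: M1.emeasure_eq_measure c_def)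
  have "measure M2 UNIV = c" using tot ch[of 0] by (simp add: c_def)
  then have c2: "emeasure M2 UNIV = ennreal c" by (simp add: M2.emeasure_eq_measure)
  show ?thesis
  proof (cases "c = 0")
    case True
    show ?thesis
    proof (rule measure_eqI)
      fix A
      show "emeasure M1 A = emeasure M2 A"
        using emeasure_space[of M1 A] emeasure_space[of M2 A] c1 c2 by (simp add: True sp)
    qed (simp add: sets)
  next
    case False
    then have c: "c > 0" by (simp add: c_def order_less_le)
    define N where "N M = density M (\<lambda>_. ennreal (1 / c))" for M :: "real measure"
    have em: "emeasure (N M) A = ennreal (1 / c) * emeasure M A" if "A \<in> sets M" for A and M :: "real measure"
      using that by (simp add: N_def emeasure_density_const)
    have rd: "real_distribution (N M)" if M: "emeasure M UNIV = ennreal c" "sets M = sets borel" for M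
    proof -
      have "prob_space (N M)"
        using M sets_eq_imp_space_eq[OF M(2)] c
        by (intro prob_spaceI) (simp add: N_def emeasure_density_const ennreal_mult[symmetric])
      then show ?thesis
        unfolding real_distribution_def real_distribution_axioms_def
        using M sets_eq_imp_space_eq[OF M(2)] by (simp add: N_def)
    qed
    have "char (N M) t = (1 / c) *\<^sub>R char M t" if "sets M = sets borel" for M t
    proof -
      have "(\<lambda>x. iexp (t * x)) \<in> borel_measurable M"
        using that by (simp cong: measurable_cong_sets)
      then show ?thesis
        unfolding N_def char_def using c by (subst integral_density) auto
    qed
    then have "char (N M1) = char (N M2)" using ch sets by auto
    then have N: "N M1 = N M2"
      using rd[OF c1 sets(1)] rd[OF c2 sets(2)] by (intro Levy_uniqueness)
    show ?thesis
    proof (rule measure_eqI)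
      fix A assume A: "A \<in> sets M1"
      then have "ennreal (1 / c) * emeasure M1 A = ennreal (1 / c) * emeasure M2 A"
        using em[of A M1] em[of A M2] sets N by simp
      then show "emeasure M1 A = emeasure M2 A"
        using c by (simp add: ennreal_mult_cancel_left)
    qed (simp add: sets)
  qed
qed

text \<open>The phase lets real cosine integrals carry the whole characteristic function of the law
  of \<open>X\<close> weighted by \<open>w\<close>: the phases 0 and \<open>- pi / 2\<close> yield
  its real and its imaginary part.\<close>

lemma weighted_law_eqI:
  fixes X :: "'a \<Rightarrow> real" and X' :: "'b \<Rightarrow> real"
  assumes M: "prob_space M" "prob_space M'"
    and meas [measurable]: "X \<in> borel_measurable M" "X' \<in> borel_measurable M'"
      "w \<in> borel_measurable M" "w' \<in> borel_measurable M'"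
    and w: "\<And>\<omega>. 0 \<le> w \<omega>" "\<And>\<omega>. w \<omega> \<le> B" and w': "\<And>\<omega>. 0 \<le> w' \<omega>" "\<And>\<omega>. w' \<omega> \<le> B"
    and eq: "\<And>\<phi> t. (LINT \<omega>|M. w \<omega> * cos (\<phi> + t * X \<omega>)) = (LINT \<omega>|M'. w' \<omega> * cos (\<phi> + t * X' \<omega>))"
    and A [measurable]: "A \<in> sets borel"
  shows "(LINT \<omega>|M. w \<omega> * indicator A (X \<omega>)) = (LINT \<omega>|M'. w' \<omega> * indicator A (X' \<omega>))"
proof -
  have fin: "finite_measure (distr (density M (\<lambda>\<omega>. ennreal (w \<omega>))) borel X)"
    if M: "prob_space M" and m [measurable]: "X \<in> borel_measurable M" "w \<in> borel_measurable M"
      and w: "\<And>\<omega>. 0 \<le> w \<omega>" "\<And>\<omega>. w \<omega> \<le> B" for M and X :: "'c \<Rightarrow> real" and w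
  proof (rule finite_measureI)
    interpret prob_space M by fact
    have "emeasure (distr (density M (\<lambda>\<omega>. ennreal (w \<omega>))) borel X) (space (distr (density M (\<lambda>\<omega>. ennreal (w \<omega>))) borel X)) =
        (\<integral>\<^sup>+ \<omega>. ennreal (w \<omega>) \<partial>M)"
      by (simp add: emeasure_distr emeasure_density)
    also have "\<dots> \<le> (\<integral>\<^sup>+ \<omega>. ennreal B \<partial>M)" using w by (intro nn_integral_mono ennreal_leI)
    also have "\<dots> < \<infinity>" by (simp add: emeasure_space_1)
    finally show "emeasure (distr (density M (\<lambda>\<omega>. ennreal (w \<omega>))) borel X) (space (distr (density M (\<lambda>\<omega>. ennreal (w \<omega>))) borel X)) \<noteq> \<infinity>"
      by simp
  qed
  have ch: "char (distr (density M (\<lambda>\<omega>. ennreal (w \<omega>))) borel X) t =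
      Complex (LINT \<omega>|M. w \<omega> * cos (0 + t * X \<omega>)) (LINT \<omega>|M. w \<omega> * cos (- pi / 2 + t * X \<omega>))"
    if M: "prob_space M" and m [measurable]: "X \<in> borel_measurable M" "w \<in> borel_measurable M"
      and w: "\<And>\<omega>. 0 \<le> w \<omega>" "\<And>\<omega>. w \<omega> \<le> B" for M and X :: "'c \<Rightarrow> real" and w t
  proof -
    interpret prob_space M by fact
    have int: "integrable M (\<lambda>\<omega>. w \<omega> *\<^sub>R iexp (t * X \<omega>))"
      by (rule integrable_const_bound[of _ B]) (use w in \<open>auto simp: abs_of_nonneg\<close>)
    have "char (distr (density M (\<lambda>\<omega>. ennreal (w \<omega>))) borel X) t = (LINT \<omega>|M. w \<omega> *\<^sub>R iexp (t * X \<omega>))"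
      unfolding char_def using w by (simp add: integral_distr integral_density)
    also have "\<dots> = Complex (LINT \<omega>|M. Re (w \<omega> *\<^sub>R iexp (t * X \<omega>))) (LINT \<omega>|M. Im (w \<omega> *\<^sub>R iexp (t * X \<omega>)))"
      using integral_Re[OF int] integral_Im[OF int] by (simp add: complex_eq_iff)
    also have "(\<lambda>\<omega>. Re (w \<omega> *\<^sub>R iexp (t * X \<omega>))) = (\<lambda>\<omega>. w \<omega> * cos (0 + t * X \<omega>))"
      by (rule ext) (simp add: Re_exp)
    also have "(\<lambda>\<omega>. Im (w \<omega> *\<^sub>R iexp (t * X \<omega>))) = (\<lambda>\<omega>. w \<omega> * cos (- pi / 2 + t * X \<omega>))"
      by (rule ext) (simp add: Im_exp cos_diff)
    finally show ?thesis .
  qed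
  have "distr (density M (\<lambda>\<omega>. ennreal (w \<omega>))) borel X = distr (density M' (\<lambda>\<omega>. ennreal (w' \<omega>))) borel X'"
  proof (rule Levy_uniqueness_finite)
    show "char (distr (density M (\<lambda>\<omega>. ennreal (w \<omega>))) borel X) t =
        char (distr (density M' (\<lambda>\<omega>. ennreal (w' \<omega>))) borel X') t" for t
      unfolding ch[OF M(1) meas(1,3) w] ch[OF M(2) meas(2,4) w'] eq by simp
  qed (use fin[OF M(1) meas(1,3) w] fin[OF M(2) meas(2,4) w'] in auto)
  then have "(LINT x|distr (density M (\<lambda>\<omega>. ennreal (w \<omega>))) borel X. indicat_real A x) =
      (LINT x|distr (density M' (\<lambda>\<omega>. ennreal (w' \<omega>))) borel X'. indicat_real A x)" by simp
  then show ?thesis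
    using w w' by (simp add: integral_distr integral_density del: integral_indicator Bochner_Integration.integral_indicator)
qed

text \<open>Uniqueness of joint laws, reduced to one coordinate at a time. In each step of the
  induction the product already turned into indicators becomes part of a weight, and one-dimensional
  uniqueness inserts the indicator of one more coordinate. The frequencies on all of
  \<open>J\<close> stay arbitrary so that the induction can go on.\<close>

lemma indicator_prod_trig_eq:
  fixes X :: "'i \<Rightarrow> 'a \<Rightarrow> real" and X' :: "'i \<Rightarrow> 'b \<Rightarrow> real"
  assumes M: "prob_space M" "prob_space M'"
    and X [measurable]: "\<And>i. X i \<in> borel_measurable M" and X' [measurable]: "\<And>i. X' i \<in> borel_measurable M'"
    and J: "finite J" and "I \<subseteq> J"
    and A: "\<And>i. i \<in> J \<Longrightarrow> A i \<in> sets borel"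
    and eq: "\<And>\<theta> s. (LINT \<omega>|M. cos (\<theta> + (\<Sum>i\<in>J. s i * X i \<omega>))) = (LINT \<omega>|M'. cos (\<theta> + (\<Sum>i\<in>J. s i * X' i \<omega>)))"
  shows "(LINT \<omega>|M. (\<Prod>i\<in>I. indicator (A i) (X i \<omega>)) * cos (\<theta> + (\<Sum>i\<in>J. s i * X i \<omega>))) =
    (LINT \<omega>|M'. (\<Prod>i\<in>I. indicator (A i) (X' i \<omega>)) * cos (\<theta> + (\<Sum>i\<in>J. s i * X' i \<omega>)))"
proof -
  have "finite I" using J \<open>I \<subseteq> J\<close> by (rule rev_finite_subset)
  then show ?thesis using \<open>I \<subseteq> J\<close>
  proof (induction I arbitrary: \<theta> s)
    case empty
    then show ?case using eq by simp
  next
    case (insert j I)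
    then have j: "j \<in> J" and I: "I \<subseteq> J" by auto
    interpret M: prob_space M by fact
    interpret M': prob_space M' by fact
    define P where "P \<omega> = (\<Prod>i\<in>I. indicator (A i) (X i \<omega>) :: real)" for \<omega>
    define P' where "P' \<omega> = (\<Prod>i\<in>I. indicator (A i) (X' i \<omega>) :: real)" for \<omega>
    define L where "L s \<omega> = (\<Sum>i\<in>J. s i * X i \<omega>)" for s :: "'i \<Rightarrow> real" and \<omega>
    define L' where "L' s \<omega> = (\<Sum>i\<in>J. s i * X' i \<omega>)" for s :: "'i \<Rightarrow> real" and \<omega>
    have [measurable]: "A i \<in> sets borel" if "i \<in> I" for i using A I that by blast
    have Aj [measurable]: "A j \<in> sets borel" using A j by blast
    have mP [measurable]: "P \<in> borel_measurable M" unfolding P_def[abs_def]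
      by (intro borel_measurable_prod measurable_compose[OF X] borel_measurable_indicator) (use A I in auto)
    have mP' [measurable]: "P' \<in> borel_measurable M'" unfolding P'_def[abs_def]
      by (intro borel_measurable_prod measurable_compose[OF X'] borel_measurable_indicator) (use A I in auto)
    have mL [measurable]: "L s \<in> borel_measurable M" and mL' [measurable]: "L' s \<in> borel_measurable M'" for s
      unfolding L_def[abs_def] L'_def[abs_def] by measurable
    have P: "0 \<le> P \<omega>" "P \<omega> \<le> 1" for \<omega>
      unfolding P_def by (auto intro!: prod_nonneg prod_le_1)
    have P': "0 \<le> P' \<omega>" "P' \<omega> \<le> 1" for \<omega>
      unfolding P'_def by (auto intro!: prod_nonneg prod_le_1)
    have IH: "(LINT \<omega>|M. P \<omega> * cos (\<theta> + L s \<omega>)) = (LINT \<omega>|M'. P' \<omega> * cos (\<theta> + L' s \<omega>))" for \<theta> s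
      unfolding P_def P'_def L_def L'_def using insert.IH[OF I] .
    have bnd: "\<bar>p * c\<bar> \<le> 1" if "0 \<le> p" "p \<le> 1" "\<bar>c\<bar> \<le> 1" for p c :: real
      using that mult_mono[of "\<bar>p\<bar>" 1 "\<bar>c\<bar>" 1] by (simp add: abs_mult)
    have int: "integrable M (\<lambda>\<omega>. P \<omega> * cos (\<theta> + L s \<omega>))" for \<theta> s
      by (rule M.integrable_const_bound[of _ 1]) (use P bnd in auto)
    have int': "integrable M' (\<lambda>\<omega>. P' \<omega> * cos (\<theta> + L' s \<omega>))" for \<theta> s
      by (rule M'.integrable_const_bound[of _ 1]) (use P' bnd in auto)
    have shift: "L (\<lambda>i. s i + (if i = j then t else 0)) \<omega> = L s \<omega> + t * X j \<omega>" for s t \<omega>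
      unfolding L_def using J j by (simp add: distrib_right sum.distrib if_distrib[of "\<lambda>x. x * _"] cong: if_cong)
    have shift': "L' (\<lambda>i. s i + (if i = j then t else 0)) \<omega> = L' s \<omega> + t * X' j \<omega>" for s t \<omega>
      unfolding L'_def using J j by (simp add: distrib_right sum.distrib if_distrib[of "\<lambda>x. x * _"] cong: if_cong)
    have L0: "L (\<lambda>i. 0) \<omega> = 0" "L' (\<lambda>i. 0) \<omega>' = 0" for \<omega> \<omega>' by (simp_all add: L_def L'_def)
    have w0: "(LINT \<omega>|M. P \<omega> * cos (\<phi> + t * X j \<omega>)) = (LINT \<omega>|M'. P' \<omega> * cos (\<phi> + t * X' j \<omega>))" for \<phi> t
      using IH[of \<phi> "\<lambda>i. 0 + (if i = j then t else 0)"] unfolding shift shift' L0 by simp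
    \<comment> \<open>A cosine changes sign and cannot serve as a density. The weight
      \<open>1 + cos\<close> lies between 0 and 2, and the contribution of the constant, known from
      \<open>w0\<close>, is subtracted at the end. The product of two cosines is a sum of cosines
      whose frequency at \<open>j\<close> is moved by \<open>t\<close> or
      \<open>- t\<close>.\<close>
    have w1: "(LINT \<omega>|M. P \<omega> * (1 + cos (\<theta> + L s \<omega>)) * cos (\<phi> + t * X j \<omega>)) =
        (LINT \<omega>|M'. P' \<omega> * (1 + cos (\<theta> + L' s \<omega>)) * cos (\<phi> + t * X' j \<omega>))" for \<phi> t
    proof -
      let ?s = "\<lambda>u i. s i + (if i = j then u else 0)" and ?e = "\<lambda>i. if i = j then t else 0"
      have eX: "L ?e \<omega> = t * X j \<omega>" "L' ?e \<omega>' = t * X' j \<omega>'" for \<omega> \<omega>'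
        using shift[of "\<lambda>i. 0" t \<omega>] shift'[of "\<lambda>i. 0" t \<omega>'] by (simp_all add: L0)
      have trig: "p * (1 + cos (\<theta> + l)) * cos (\<phi> + u) =
          p * cos (\<phi> + (0 + u)) + (p * cos ((\<theta> + \<phi>) + (l + u)) / 2 + p * cos ((\<theta> - \<phi>) + (l + - u)) / 2)"
        for p l u :: real
      proof -
        have "cos (\<theta> + l) * cos (\<phi> + u) = (cos ((\<theta> - \<phi>) + (l + - u)) + cos ((\<theta> + \<phi>) + (l + u))) / 2"
          unfolding cos_times_cos by (simp add: algebra_simps)
        moreover have "p * (1 + cos (\<theta> + l)) * cos (\<phi> + u) = p * cos (\<phi> + u) + p * (cos (\<theta> + l) * cos (\<phi> + u))"
          by (simp add: algebra_simps)
        ultimately show ?thesis by (simp only:) (simp add: distrib_left add_divide_distrib)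
      qed
      have "(LINT \<omega>|M. P \<omega> * (1 + cos (\<theta> + L s \<omega>)) * cos (\<phi> + t * X j \<omega>)) =
          (LINT \<omega>|M. P \<omega> * cos (\<phi> + L ?e \<omega>)) + ((LINT \<omega>|M. P \<omega> * cos ((\<theta> + \<phi>) + L (?s t) \<omega>)) / 2 +
          (LINT \<omega>|M. P \<omega> * cos ((\<theta> - \<phi>) + L (?s (- t)) \<omega>)) / 2)"
        unfolding trig mult_minus_left[symmetric] shift[symmetric]
        using int[of \<phi> ?e] int by (simp add: eX)
      also have "\<dots> = (LINT \<omega>|M'. P' \<omega> * cos (\<phi> + L' ?e \<omega>)) + ((LINT \<omega>|M'. P' \<omega> * cos ((\<theta> + \<phi>) + L' (?s t) \<omega>)) / 2 +
          (LINT \<omega>|M'. P' \<omega> * cos ((\<theta> - \<phi>) + L' (?s (- t)) \<omega>)) / 2)"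
        unfolding IH ..
      also have "\<dots> = (LINT \<omega>|M'. P' \<omega> * (1 + cos (\<theta> + L' s \<omega>)) * cos (\<phi> + t * X' j \<omega>))"
        unfolding trig mult_minus_left[symmetric] shift'[symmetric]
        using int'[of \<phi> ?e] int' by (simp add: eX)
      finally show ?thesis .
    qed
    have wb: "0 \<le> p * (1 + cos (x::real))" "p * (1 + cos x) \<le> 2" if "0 \<le> p" "p \<le> 1" for p x :: real
    proof -
      have c: "0 \<le> 1 + cos x" "1 + cos x \<le> 2"
        using cos_ge_minus_one[of x] cos_le_one[of x] by linarith+
      show "0 \<le> p * (1 + cos x)" using that c by simp
      show "p * (1 + cos x) \<le> 2" using mult_mono[of p 1 "1 + cos x" 2] that c by simp
    qed
    have r0: "(LINT \<omega>|M. P \<omega> * indicator (A j) (X j \<omega>)) = (LINT \<omega>|M'. P' \<omega> * indicator (A j) (X' j \<omega>))"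
      by (rule weighted_law_eqI[OF M X X' mP mP' P P' w0 Aj])
    have mw: "(\<lambda>\<omega>. P \<omega> * (1 + cos (\<theta> + L s \<omega>))) \<in> borel_measurable M"
      "(\<lambda>\<omega>. P' \<omega> * (1 + cos (\<theta> + L' s \<omega>))) \<in> borel_measurable M'" by measurable
    have r1: "(LINT \<omega>|M. P \<omega> * (1 + cos (\<theta> + L s \<omega>)) * indicator (A j) (X j \<omega>)) =
        (LINT \<omega>|M'. P' \<omega> * (1 + cos (\<theta> + L' s \<omega>)) * indicator (A j) (X' j \<omega>))"
      using weighted_law_eqI[OF M X X' mw wb[OF P] wb[OF P'] w1 Aj] .
    have iA: "integrable M (\<lambda>\<omega>. P \<omega> * indicator (A j) (X j \<omega>))" "integrable M (\<lambda>\<omega>. P \<omega> * (1 + cos (\<theta> + L s \<omega>)) * indicator (A j) (X j \<omega>))"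
      using P order_trans[OF P(2), of 2] wb[OF P] by (auto intro!: M.integrable_const_bound[of _ 2] AE_I2 simp: indicator_def abs_of_nonneg)
    have iA': "integrable M' (\<lambda>\<omega>. P' \<omega> * indicator (A j) (X' j \<omega>))" "integrable M' (\<lambda>\<omega>. P' \<omega> * (1 + cos (\<theta> + L' s \<omega>)) * indicator (A j) (X' j \<omega>))"
      using P' order_trans[OF P'(2), of 2] wb[OF P'] by (auto intro!: M'.integrable_const_bound[of _ 2] AE_I2 simp: indicator_def abs_of_nonneg)
    have sub: "P \<omega> * cos (\<theta> + L s \<omega>) * indicator (A j) (X j \<omega>) =
        P \<omega> * (1 + cos (\<theta> + L s \<omega>)) * indicator (A j) (X j \<omega>) - P \<omega> * indicator (A j) (X j \<omega>)" for \<omega>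
      by (simp add: algebra_simps)
    have sub': "P' \<omega> * cos (\<theta> + L' s \<omega>) * indicator (A j) (X' j \<omega>) =
        P' \<omega> * (1 + cos (\<theta> + L' s \<omega>)) * indicator (A j) (X' j \<omega>) - P' \<omega> * indicator (A j) (X' j \<omega>)" for \<omega>
      by (simp add: algebra_simps)
    have "(LINT \<omega>|M. P \<omega> * cos (\<theta> + L s \<omega>) * indicator (A j) (X j \<omega>)) =
        (LINT \<omega>|M'. P' \<omega> * cos (\<theta> + L' s \<omega>) * indicator (A j) (X' j \<omega>))"
      unfolding sub sub' using r0 r1 iA iA' by (simp only: Bochner_Integration.integral_diff)
    then show ?case
      using insert.hyps unfolding P_def P'_def L_def L'_def by (simp add: mult_ac)
  qed
qed

text \<open>With \<open>I = J\<close> and all frequencies zero,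
  \<open>indicator_prod_trig_eq\<close> compares the probabilities of cylinder sets, and these
  determine a finite measure on the product.\<close>

theorem distr_eq_of_characteristic_functional:
  fixes X :: "'i \<Rightarrow> 'a \<Rightarrow> real" and X' :: "'i \<Rightarrow> 'b \<Rightarrow> real"
  assumes M: "prob_space M" "prob_space M'"
    and X [measurable]: "\<And>i. X i \<in> borel_measurable M" and X' [measurable]: "\<And>i. X' i \<in> borel_measurable M'"
    and eq: "\<And>J \<theta> s. finite J \<Longrightarrow>
      (LINT \<omega>|M. cos (\<theta> + (\<Sum>i\<in>J. s i * X i \<omega>))) = (LINT \<omega>|M'. cos (\<theta> + (\<Sum>i\<in>J. s i * X' i \<omega>)))"
  shows "distr M (\<Pi>\<^sub>M i\<in>UNIV. borel) (\<lambda>\<omega> i. X i \<omega>) = distr M' (\<Pi>\<^sub>M i\<in>UNIV. borel) (\<lambda>\<omega> i. X' i \<omega>)"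
proof (rule measure_eqI_PiM_infinite)
  interpret M: prob_space M by fact
  interpret M': prob_space M' by fact
  have mX: "(\<lambda>\<omega> i. X i \<omega>) \<in> M \<rightarrow>\<^sub>M (\<Pi>\<^sub>M i\<in>UNIV. borel)" and mX': "(\<lambda>\<omega> i. X' i \<omega>) \<in> M' \<rightarrow>\<^sub>M (\<Pi>\<^sub>M i\<in>UNIV. borel)"
    by (auto intro!: measurable_PiM_single')
  show "finite_measure (distr M (\<Pi>\<^sub>M i\<in>UNIV. borel) (\<lambda>\<omega> i. X i \<omega>))"
    using M.prob_space_distr[OF mX] by (simp add: prob_space_def)
  fix A and J :: "'i set"
  assume J: "finite J" "J \<subseteq> UNIV" and A: "\<And>i. i \<in> J \<Longrightarrow> A i \<in> sets (borel :: real measure)"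
  let ?E = "prod_emb UNIV (\<lambda>i. borel) J (Pi\<^sub>E J A)"
  have E: "?E \<in> sets (\<Pi>\<^sub>M i\<in>UNIV. borel)"
    using J A by (intro sets_PiM_I) auto
  have ind: "indicat_real ?E x = (\<Prod>i\<in>J. indicator (A i) (x i))" for x
    using J by (auto simp: indicator_def prod_emb_def PiE_iff restrict_def extensional_def)
  have "measure (distr M (\<Pi>\<^sub>M i\<in>UNIV. borel) (\<lambda>\<omega> i. X i \<omega>)) ?E = (LINT \<omega>|M. indicat_real ?E (\<lambda>i. X i \<omega>))"
    using E by (subst integral_distr[OF mX, symmetric]) auto
  also have "\<dots> = (LINT \<omega>|M. (\<Prod>i\<in>J. indicator (A i) (X i \<omega>)) * cos (0 + (\<Sum>i\<in>J. 0 * X i \<omega>)))"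
    unfolding ind by simp
  also have "\<dots> = (LINT \<omega>|M'. (\<Prod>i\<in>J. indicator (A i) (X' i \<omega>)) * cos (0 + (\<Sum>i\<in>J. 0 * X' i \<omega>)))"
    using J A eq[OF J(1)] by (intro indicator_prod_trig_eq[OF M X X']) auto
  also have "\<dots> = (LINT \<omega>|M'. indicat_real ?E (\<lambda>i. X' i \<omega>))"
    unfolding ind by simp
  also have "\<dots> = measure (distr M' (\<Pi>\<^sub>M i\<in>UNIV. borel) (\<lambda>\<omega> i. X' i \<omega>)) ?E"
    using E by (subst integral_distr[OF mX', symmetric]) auto
  finally show "emeasure (distr M (\<Pi>\<^sub>M i\<in>UNIV. borel) (\<lambda>\<omega> i. X i \<omega>)) ?E =
      emeasure (distr M' (\<Pi>\<^sub>M i\<in>UNIV. borel) (\<lambda>\<omega> i. X' i \<omega>)) ?E"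
    using M.prob_space_distr[OF mX] M'.prob_space_distr[OF mX']
    by (simp add: finite_measure.emeasure_eq_measure prob_space_def)
qed simp_all

section \<open>A characterisation of the centred normal laws\<close>

lemma pair_expectation_mult:
  fixes f :: "'a \<Rightarrow> 'c::{real_normed_field, banach, second_countable_topology}"
  assumes "prob_space M" "prob_space N"
    and [measurable]: "f \<in> borel_measurable M" "g \<in> borel_measurable N"
    and bd: "\<And>x. norm (f x) \<le> B" "\<And>y. norm (g y) \<le> B"
  shows "(LINT z|(M \<Otimes>\<^sub>M N). f (fst z) * g (snd z)) = (LINT x|M. f x) * (LINT y|N. g y)"
proof -
  interpret M: prob_space M by fact
  interpret N: prob_space N by fact
  interpret pair_prob_space M N ..
  have B: "0 \<le> B" using order_trans[OF norm_ge_zero bd(1)] .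
  have "integrable (M \<Otimes>\<^sub>M N) (\<lambda>z. f (fst z) * g (snd z))"
    by (rule P.integrable_const_bound[of _ "B * B"])
      (use bd B in \<open>auto simp: norm_mult intro!: mult_mono\<close>)
  from integral_fst'[OF this] show ?thesis by simp
qed

lemma char_gauss:
  assumes "\<sigma> > 0"
  shows "char (gauss \<sigma>) t = of_real (exp (- (\<sigma>\<^sup>2 * t\<^sup>2) / 2))"
proof -
  interpret real_distribution std_normal_distribution by (rule real_dist_normal_dist)
  have "distributed std_normal_distribution lborel (\<lambda>y. y) (normal_density 0 1)"
    unfolding distributed_def by (auto simp: distr_id2 sets_eq_imp_space_eq)
  from normal_density_affine[OF this, of \<sigma> 0]
  have "distr std_normal_distribution lborel (\<lambda>y. \<sigma> * y) = gauss \<sigma>"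
    using assms by (simp add: distributed_def)
  then have "char (gauss \<sigma>) t = char (distr std_normal_distribution lborel (\<lambda>y. \<sigma> * y)) t" by simp
  also have "\<dots> = char std_normal_distribution (t * \<sigma>)"
    unfolding char_def by (subst integral_distr) (auto simp: mult.assoc)
  finally show ?thesis
    unfolding char_std_normal_distribution by (simp add: power_mult_distrib mult.commute)
qed

lemma gauss_real_distribution: "\<sigma> > 0 \<Longrightarrow> real_distribution (gauss \<sigma>)"
  unfolding real_distribution_def real_distribution_axioms_def
  by (auto intro: prob_space_normal_density)

text \<open>The hypothesis says that the law is fixed by symmetrised rescaled convolution, so that all the
  normalised sums with \<open>2^n\<close> terms in the central limit theorem have the same law.\<close>

theorem stable_imp_gauss:
  assumes \<nu>: "real_distribution \<nu>" and int2: "integrable \<nu> (\<lambda>x. x\<^sup>2)"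
    and stable: "distr (\<nu> \<Otimes>\<^sub>M \<nu>) borel (\<lambda>z. (fst z - snd z) / sqrt 2) = \<nu>"
  shows "\<exists>\<sigma>\<ge>0. \<nu> = (if \<sigma> = 0 then return borel 0 else gauss \<sigma>)"
proof -
  interpret real_distribution \<nu> by fact
  interpret PP: pair_prob_space \<nu> \<nu> ..
  have [measurable_cong]: "sets \<nu> = sets borel" by simp
  have idm: "(\<lambda>x. x) \<in> borel_measurable \<nu>" by measurable
  have int1: "integrable \<nu> (\<lambda>x. x)"
    by (rule square_integrable_imp_integrable[OF idm]) (use int2 in simp)
  define \<phi> where "\<phi> = char \<nu>"
  have \<phi>_mult: "\<phi> t = \<phi> (t / sqrt 2) * \<phi> (- (t / sqrt 2))" for t
  proof -
    have "\<phi> t = char (distr (\<nu> \<Otimes>\<^sub>M \<nu>) borel (\<lambda>z. (fst z - snd z) / sqrt 2)) t"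
      unfolding stable \<phi>_def ..
    also have "\<dots> = (CLINT z|(\<nu> \<Otimes>\<^sub>M \<nu>). iexp (t * ((fst z - snd z) / sqrt 2)))"
      unfolding char_def by (subst integral_distr) auto
    also have "\<dots> = (CLINT z|(\<nu> \<Otimes>\<^sub>M \<nu>). iexp (t / sqrt 2 * fst z) * iexp (- (t / sqrt 2) * snd z))"
      by (simp add: exp_add[symmetric] algebra_simps diff_divide_distrib)
    also have "\<dots> = \<phi> (t / sqrt 2) * \<phi> (- (t / sqrt 2))"
      unfolding \<phi>_def char_def
      by (rule pair_expectation_mult[where B=1]) (auto intro: prob_space_axioms)
    finally show ?thesis .
  qed
  \<comment> \<open>Exchanging the two independent copies changes the sign of their difference. So
    \<open>\<phi>\<close> is even, and the difference behaves like a sum.\<close>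
  have even: "\<phi> (- t) = \<phi> t" for t
    using \<phi>_mult[of t] \<phi>_mult[of "- t"] by (simp add: mult.commute)
  have half: "\<phi> t = (\<phi> (t / sqrt 2))\<^sup>2" for t
    using \<phi>_mult[of t] by (simp add: even power2_eq_square)
  have iter: "\<phi> t = (\<phi> (t / sqrt (2 ^ k))) ^ (2 ^ k)" for t k
  proof (induction k)
    case (Suc k)
    have "\<phi> t = ((\<phi> (t / sqrt (2 ^ k) / sqrt 2))\<^sup>2) ^ (2 ^ k)"
      using Suc half by metis
    also have "\<dots> = \<phi> (t / sqrt (2 ^ Suc k)) ^ (2 ^ Suc k)"
      by (simp add: real_sqrt_mult power_mult[symmetric] mult.commute)
    finally show ?case .
  qed simp
  \<comment> \<open>The central limit theorem asks for centred variables; stability writes the mean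
    as a difference of two equal means.\<close>
  have mean0: "(LINT x|\<nu>. x) = 0"
  proof -
    have i: "integrable (\<nu> \<Otimes>\<^sub>M \<nu>) fst" "integrable (\<nu> \<Otimes>\<^sub>M \<nu>) snd"
    proof -
      have "integrable (distr (\<nu> \<Otimes>\<^sub>M \<nu>) \<nu> fst) (\<lambda>x. x)"
        using int1 by (simp add: PP.distr_pair_fst distr_pair_fst)
      then show "integrable (\<nu> \<Otimes>\<^sub>M \<nu>) fst" by (subst (asm) integrable_distr_eq) auto
      then show "integrable (\<nu> \<Otimes>\<^sub>M \<nu>) snd"
        using PP.integrable_product_swap_iff[of fst] by (simp add: split_beta')
    qed
    have "(LINT x|\<nu>. x) = (LINT x|distr (\<nu> \<Otimes>\<^sub>M \<nu>) borel (\<lambda>z. (fst z - snd z) / sqrt 2). x)"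
      by (simp add: stable)
    also have "\<dots> = (LINT z|(\<nu> \<Otimes>\<^sub>M \<nu>). (fst z - snd z) / sqrt 2)"
      by (subst integral_distr) auto
    also have "\<dots> = ((LINT z|(\<nu> \<Otimes>\<^sub>M \<nu>). fst z) - (LINT z|(\<nu> \<Otimes>\<^sub>M \<nu>). snd z)) / sqrt 2"
      using i by simp
    also have "(LINT z|(\<nu> \<Otimes>\<^sub>M \<nu>). snd z) = (LINT z|(\<nu> \<Otimes>\<^sub>M \<nu>). fst z)"
      using PP.integral_product_swap[of fst] by (simp add: split_beta')
    finally show ?thesis by simp
  qed
  define v where "v = (LINT x|\<nu>. x\<^sup>2)"
  have v: "0 \<le> v" unfolding v_def by simp
  show ?thesis
  proof (cases "v = 0")
    case True
    have "AE x in \<nu>. x\<^sup>2 = 0"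
      using True int2 integral_nonneg_eq_0_iff_AE[of \<nu> "\<lambda>x. x\<^sup>2"] by (simp add: v_def)
    then have AE0: "AE x in \<nu>. x = 0" by simp
    have "\<nu> = return borel 0"
    proof (rule measure_eqI)
      fix A assume "A \<in> sets \<nu>"
      then have A: "A \<in> sets borel" by simp
      have "emeasure \<nu> A = (\<integral>\<^sup>+ x. indicator A x \<partial>\<nu>)" using A by simp
      also have "\<dots> = (\<integral>\<^sup>+ x. indicator A 0 \<partial>\<nu>)"
        using AE0 by (intro nn_integral_cong_AE) auto
      also have "\<dots> = emeasure (return borel 0) A"
        using A emeasure_space_1 by simp
      finally show "emeasure \<nu> A = emeasure (return borel 0) A" .
    qed simp
    then show ?thesis by (intro exI[of _ 0]) simp
  next
    case False
    define \<sigma> where "\<sigma> = sqrt v"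
    have \<sigma>: "\<sigma> > 0" "\<sigma>\<^sup>2 = v" using False v by (auto simp: \<sigma>_def)
    interpret PS: product_prob_space "\<lambda>i. \<nu>" "UNIV :: nat set" ..
    let ?P = "\<Pi>\<^sub>M i\<in>(UNIV :: nat set). \<nu>"
    have dist: "distr ?P \<nu> (\<lambda>\<omega>. \<omega> i) = \<nu>" for i
      by (rule distr_PiM_component) (auto intro: prob_space_axioms)
    have dist': "distr ?P borel (\<lambda>\<omega>. \<omega> i) = \<nu>" for i
      using dist[of i] by (simp cong: distr_cong)
    have X: "(\<lambda>\<omega>. \<omega> i) \<in> borel_measurable ?P" for i
      using measurable_component_singleton[of i UNIV "\<lambda>i. \<nu>"] by (simp cong: measurable_cong_sets)
    have indep: "PS.indep_vars (\<lambda>i. borel) (\<lambda>i \<omega>. \<omega> i) UNIV"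
    proof (subst PS.indep_vars_iff_distr_eq_PiM')
      show "distr ?P (Pi\<^sub>M UNIV (\<lambda>i. borel)) (\<lambda>x. \<lambda>i\<in>UNIV. x i) = (\<Pi>\<^sub>M i\<in>UNIV. distr ?P borel (\<lambda>\<omega>. \<omega> i))"
        unfolding dist' restrict_UNIV by (rule distr_id2) (rule sets_PiM_cong, auto)
    qed (use X in auto)
    have tr: "(LINT \<omega>|?P. h (\<omega> i)) = (LINT x|\<nu>. h x)" "integrable ?P (\<lambda>\<omega>. h (\<omega> i)) \<longleftrightarrow> integrable \<nu> h"
      if "h \<in> borel_measurable borel" for h :: "real \<Rightarrow> real" and i
      using integral_distr[OF X that, of i] integrable_distr_eq[OF X that, of i] unfolding dist' by simp_all
    have "weak_conv_m (\<lambda>n. distr ?P borel (\<lambda>\<omega>. (\<Sum>i<n. \<omega> i) / sqrt (n * \<sigma>\<^sup>2))) std_normal_distribution"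
    proof (rule PS.central_limit_theorem_zero_mean[OF indep _ \<sigma>(1)])
      show e: "PS.expectation (\<lambda>\<omega>. \<omega> n) = 0" for n using tr(1)[of "\<lambda>x. x" n] mean0 by simp
      show "integrable ?P (\<lambda>\<omega>. (\<omega> n)\<^sup>2)" for n using tr(2)[of "\<lambda>x. x\<^sup>2" n] int2 by simp
      show "PS.variance (\<lambda>\<omega>. \<omega> n) = \<sigma>\<^sup>2" for n
        using tr(1)[of "\<lambda>x. x\<^sup>2" n] by (simp add: e \<sigma> v_def)
    qed (rule dist')
    then have "(\<lambda>n. char (distr ?P borel (\<lambda>\<omega>. (\<Sum>i<n. \<omega> i) / sqrt (n * \<sigma>\<^sup>2))) s) \<longlonglongrightarrow> char std_normal_distribution s" for s
    proof (rule levy_continuity1[rotated 2])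
      fix n
      show "real_distribution (distr ?P borel (\<lambda>\<omega>. (\<Sum>i<n. \<omega> i) / sqrt (n * \<sigma>\<^sup>2)))"
        using X by (intro PS.real_distribution_distr) auto
    qed (rule real_dist_normal_dist)
    moreover have "char (distr ?P borel (\<lambda>\<omega>. (\<Sum>i<n. \<omega> i) / sqrt (n * \<sigma>\<^sup>2))) s = \<phi> (s / \<sigma> / sqrt n) ^ n" for n s
    proof -
      have m: "(\<lambda>\<omega>. \<Sum>i<n. \<omega> i) \<in> borel_measurable ?P" using X by measurable
      have "char (distr ?P borel (\<lambda>\<omega>. (\<Sum>i<n. \<omega> i) / sqrt (n * \<sigma>\<^sup>2))) s =
          char (distr ?P borel (\<lambda>\<omega>. \<Sum>i<n. \<omega> i)) (s / \<sigma> / sqrt n)"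
        unfolding char_def using m \<sigma>(1) by (simp add: integral_distr real_sqrt_mult mult.commute)
      also have "\<dots> = (\<Prod>i<n. char (distr ?P borel (\<lambda>\<omega>. \<omega> i)) (s / \<sigma> / sqrt n))"
        by (rule PS.char_distr_sum) (rule PS.indep_vars_subset[OF indep], simp)
      finally show ?thesis unfolding dist' by (simp add: \<phi>_def)
    qed
    ultimately have "(\<lambda>n. \<phi> (s / \<sigma> / sqrt (real n)) ^ n) \<longlonglongrightarrow> char std_normal_distribution s" for s
      by simp
    from LIMSEQ_subseq_LIMSEQ[OF this, of "\<lambda>k. 2 ^ k"]
    have "(\<lambda>k. \<phi> (s / \<sigma> / sqrt (2 ^ k)) ^ (2 ^ k)) \<longlonglongrightarrow> char std_normal_distribution s" for s
      by (simp add: comp_def strict_mono_def)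
    then have "(\<lambda>k::nat. \<phi> (s / \<sigma>)) \<longlonglongrightarrow> char std_normal_distribution s" for s
      unfolding iter[symmetric] .
    then have "\<phi> (s / \<sigma>) = char std_normal_distribution s" for s
      by (simp add: LIMSEQ_const_iff)
    from this[of "_ * \<sigma>"] have "char \<nu> t = char (gauss \<sigma>) t" for t
      using \<sigma>(1) unfolding char_std_normal_distribution char_gauss[OF \<sigma>(1)]
      by (simp add: \<phi>_def power_mult_distrib mult.commute)
    then have "\<nu> = gauss \<sigma>"
      using \<nu> gauss_real_distribution[OF \<sigma>(1)] by (intro Levy_uniqueness) auto
    then show ?thesis using \<sigma>(1) by (intro exI[of _ \<sigma>]) auto
  qed
qed

section \<open>Gaussian priors\<close>

lemma space_L2_borel: "space L2_borel = L2_01"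
  unfolding L2_borel_def by (rule space_measure_of) auto

lemma L2_ball_sets: "g \<in> L2_01 \<Longrightarrow> {f \<in> L2_01. L2norm01 (\<lambda>x. f x - g x) < r} \<in> sets L2_borel"
  unfolding L2_borel_def by (rule in_measure_of) auto

lemma L2norm01_diff_measurable [measurable]:
  assumes "g \<in> L2_01"
  shows "(\<lambda>f. L2norm01 (\<lambda>x. f x - g x)) \<in> borel_measurable L2_borel"
  by (rule borel_measurableI_less) (use L2_ball_sets[OF assms] in \<open>simp add: space_L2_borel\<close>)

text \<open>The generating sets speak only of distances to fixed functions. Polarisation recovers
  the inner product from the distances to \<open>0\<close> and to \<open>g\<close>.\<close>

lemma inner01_measurable:
  assumes g: "g \<in> L2_01"
  shows "(\<lambda>f. inner01 f g) \<in> borel_measurable L2_borel"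
proof -
  have [measurable]: "(\<lambda>f. L2norm01 (\<lambda>x. f x - g x)) \<in> borel_measurable L2_borel"
    "(\<lambda>f. L2norm01 (\<lambda>x. f x - 0)) \<in> borel_measurable L2_borel"
    using L2norm01_diff_measurable[OF g] L2norm01_diff_measurable[of "\<lambda>x. 0"] by simp_all
  have "(\<lambda>f. ((L2norm01 (\<lambda>x. f x - 0))\<^sup>2 + inner01 g g - (L2norm01 (\<lambda>x. f x - g x))\<^sup>2) / 2) \<in> borel_measurable L2_borel"
    by measurable
  then show ?thesis
  proof (rule subst[OF measurable_cong, rotated])
    fix f assume "f \<in> space L2_borel"
    then have "f \<in> L2_01" by (simp add: space_L2_borel)
    then show "((L2norm01 (\<lambda>x. f x - 0))\<^sup>2 + inner01 g g - (L2norm01 (\<lambda>x. f x - g x))\<^sup>2) / 2 = inner01 f g"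
      using g by (simp add: L2norm01_sq inner01_diff_self)
  qed
qed

lemma coef_measurable: "(\<lambda>f. coef f k) \<in> borel_measurable L2_borel"
  unfolding coef_def by (rule inner01_measurable) simp

section \<open>Rotation invariance of the prior\<close>

definition trig_poly :: "nat set \<Rightarrow> (nat \<Rightarrow> real) \<Rightarrow> real \<Rightarrow> real" where
  "trig_poly K t x = (\<Sum>k\<in>K. t k * cosbasis k x)"

lemma trig_poly_L2 [simp]: "trig_poly K t \<in> L2_01"
  unfolding trig_poly_def[abs_def] by (intro L2_01_sum L2_01_scale cosbasis_L2)

lemma inner01_trig_poly:
  assumes "f \<in> L2_01"
  shows "inner01 f (trig_poly K t) = (\<Sum>k\<in>K. t k * coef f k)"
proof (cases "finite K")
  case True
  then show ?thesis
    unfolding trig_poly_def[abs_def] using assms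
    by (subst inner01_sum_right) (auto simp: inner01_scale_right coef_def intro: L2_01_scale)
next
  case False
  then show ?thesis by (simp add: trig_poly_def[abs_def])
qed

text \<open>This map is symmetric as well as orthogonal, hence its own inverse: moved across the
  pairing with the data, it acts on \<open>(Y, Y')\<close> by the same formula.\<close>

definition rotate_pair :: "(nat \<Rightarrow> real) \<times> (nat \<Rightarrow> real) \<Rightarrow> (nat \<Rightarrow> real) \<times> (nat \<Rightarrow> real)" where
  "rotate_pair z = ((\<lambda>k. (fst z k + snd z k) / sqrt 2), (\<lambda>k. (fst z k - snd z k) / sqrt 2))"

lemma rotate_pair_measurable [measurable]:
  "rotate_pair \<in> real_sequences \<Otimes>\<^sub>M real_sequences \<rightarrow>\<^sub>M real_sequences \<Otimes>\<^sub>M real_sequences"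
  unfolding rotate_pair_def[abs_def]
  by (intro measurable_Pair measurable_PiM_single') (auto simp: space_pair_measure)

locale gaussian_prior =
  fixes M :: "(real \<Rightarrow> real) measure"
  assumes gaussian: "centered_gaussian_L2 M"
begin

sublocale prob_space M
  using gaussian by (simp add: centered_gaussian_L2_def)

lemma sets_eq [measurable_cong]: "sets M = sets L2_borel"
  using gaussian by (simp add: centered_gaussian_L2_def)

lemma space_eq: "space M = L2_01"
  using sets_eq_imp_space_eq[OF sets_eq] by (simp add: space_L2_borel)

lemma inner_measurable: "g \<in> L2_01 \<Longrightarrow> (\<lambda>f. inner01 f g) \<in> borel_measurable M"
  using inner01_measurable[of g] by (simp cong: measurable_cong_sets add: sets_eq)

lemma inner_law:
  assumes "g \<in> L2_01"
  obtains \<sigma> where "\<sigma> \<ge> 0" "distr M borel (\<lambda>f. inner01 f g) = (if \<sigma> = 0 then return borel 0 else gauss \<sigma>)"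
  using gaussian assms by (auto simp: centered_gaussian_L2_def)

text \<open>The quadratic form of the covariance operator of the prior.\<close>

definition V :: "(real \<Rightarrow> real) \<Rightarrow> real" where
  "V g = (LINT f|M. (inner01 f g)\<^sup>2)"

text \<open>Everything is read off the one-dimensional law in the direction \<open>g\<close>, a
  point mass or a normal law. The cosine and sine means describe the characteristic functional; the
  exponential moment bounds the evidence for shifted data.\<close>

lemma inner_moments:
  assumes g: "g \<in> L2_01"
  shows "integrable M (\<lambda>f. (inner01 f g)\<^sup>2)"
    and "(LINT f|M. cos (inner01 f g)) = exp (- V g / 2)"
    and "(LINT f|M. sin (inner01 f g)) = 0"
    and "(\<integral>\<^sup>+ f. ennreal (exp (t * inner01 f g)) \<partial>M) < \<infinity>"
proof -
  note [measurable] = inner_measurable[OF g]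
  obtain \<sigma> where \<sigma>: "\<sigma> \<ge> 0" and law: "distr M borel (\<lambda>f. inner01 f g) = (if \<sigma> = 0 then return borel 0 else gauss \<sigma>)"
    using inner_law[OF g] .
  let ?D = "distr M borel (\<lambda>f. inner01 f g)"
  interpret D: real_distribution ?D by (rule real_distribution_distr) simp
  have "integrable ?D (\<lambda>x. x\<^sup>2) \<and> (LINT x|?D. x\<^sup>2) = \<sigma>\<^sup>2 \<and> char ?D 1 = of_real (exp (- \<sigma>\<^sup>2 / 2)) \<and>
      (\<integral>\<^sup>+ x. ennreal (exp (t * x)) \<partial>?D) < \<infinity>"
  proof (cases "\<sigma> = 0")
    case True
    have "integrable (return borel 0) (\<lambda>x::real. x\<^sup>2)"
      unfolding integrable_iff_bounded by (simp add: nn_integral_return)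
    then show ?thesis
      unfolding law using True by (simp add: integral_return char_def nn_integral_return)
  next
    case False
    then have pos: "\<sigma> > 0" using \<sigma> by simp
    have m2: "has_bochner_integral lborel (\<lambda>y. normal_density 0 \<sigma> y * y\<^sup>2) (\<sigma>\<^sup>2)"
      using normal_moment_even[of \<sigma> 0 1] pos by simp
    have "integrable (gauss \<sigma>) (\<lambda>x. x\<^sup>2)"
      using m2 by (subst integrable_density) (auto simp: has_bochner_integral_iff)
    moreover have "(LINT x|gauss \<sigma>. x\<^sup>2) = \<sigma>\<^sup>2"
      using m2 by (subst integral_density) (auto simp: has_bochner_integral_iff)
    ultimately show ?thesis
      unfolding law using False char_gauss[OF pos, of 1] nn_integral_exp_gauss[OF pos, of t] by simp
  qed
  then have i: "integrable ?D (\<lambda>x. x\<^sup>2)" and m: "(LINT x|?D. x\<^sup>2) = \<sigma>\<^sup>2"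
    and c: "char ?D 1 = of_real (exp (- \<sigma>\<^sup>2 / 2))" and e: "(\<integral>\<^sup>+ x. ennreal (exp (t * x)) \<partial>?D) < \<infinity>" by auto
  show "integrable M (\<lambda>f. (inner01 f g)\<^sup>2)" using i by (subst (asm) integrable_distr_eq) auto
  have V: "V g = \<sigma>\<^sup>2" unfolding V_def m[symmetric] by (subst integral_distr) auto
  have int: "integrable M (\<lambda>f. iexp (1 * inner01 f g))"
    by (rule integrable_const_bound[of _ 1]) auto
  have "char ?D 1 = (CLINT f|M. iexp (1 * inner01 f g))"
    unfolding char_def by (subst integral_distr) auto
  then have "(CLINT f|M. iexp (1 * inner01 f g)) = complex_of_real (exp (- V g / 2))"
    unfolding c V by simp
  then have "Re (CLINT f|M. iexp (1 * inner01 f g)) = exp (- V g / 2)" "Im (CLINT f|M. iexp (1 * inner01 f g)) = 0"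
    by (simp_all only: Re_complex_of_real Im_complex_of_real)
  then show "(LINT f|M. cos (inner01 f g)) = exp (- V g / 2)" "(LINT f|M. sin (inner01 f g)) = 0"
    using integral_Re[OF int] integral_Im[OF int] by (simp_all add: Re_exp Im_exp)
  show "(\<integral>\<^sup>+ f. ennreal (exp (t * inner01 f g)) \<partial>M) < \<infinity>"
    using e by (subst (asm) nn_integral_distr) auto
qed

lemma expectation_cos_pair:
  assumes a: "a \<in> L2_01" and b: "b \<in> L2_01"
  shows "(LINT z|(M \<Otimes>\<^sub>M M). cos (\<theta> + (inner01 (fst z) a + inner01 (snd z) b))) = cos \<theta> * exp (- (V a + V b) / 2)"
proof -
  note [measurable] = inner_measurable[OF a] inner_measurable[OF b]
  interpret MM: pair_prob_space M M ..
  have ps: "prob_space M" by (rule prob_space_axioms)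
  have bnd: "\<bar>x * y\<bar> \<le> 1" if "\<bar>x\<bar> \<le> 1" "\<bar>y\<bar> \<le> 1" for x y :: real
    using mult_mono[of "\<bar>x\<bar>" 1 "\<bar>y\<bar>" 1] that by (simp add: abs_mult)
  have i: "integrable (M \<Otimes>\<^sub>M M) (\<lambda>z. cos (inner01 (fst z) a) * cos (inner01 (snd z) b))"
    "integrable (M \<Otimes>\<^sub>M M) (\<lambda>z. sin (inner01 (fst z) a) * sin (inner01 (snd z) b))"
    "integrable (M \<Otimes>\<^sub>M M) (\<lambda>z. sin (inner01 (fst z) a) * cos (inner01 (snd z) b))"
    "integrable (M \<Otimes>\<^sub>M M) (\<lambda>z. cos (inner01 (fst z) a) * sin (inner01 (snd z) b))"
    by (rule MM.P.integrable_const_bound[of _ 1], simp add: bnd, measurable)+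
  have e: "(LINT z|(M \<Otimes>\<^sub>M M). cos (inner01 (fst z) a) * cos (inner01 (snd z) b)) = exp (- V a / 2) * exp (- V b / 2)"
    "(LINT z|(M \<Otimes>\<^sub>M M). sin (inner01 (fst z) a) * sin (inner01 (snd z) b)) = 0"
    "(LINT z|(M \<Otimes>\<^sub>M M). sin (inner01 (fst z) a) * cos (inner01 (snd z) b)) = 0"
    "(LINT z|(M \<Otimes>\<^sub>M M). cos (inner01 (fst z) a) * sin (inner01 (snd z) b)) = 0"
    by (subst pair_expectation_mult[OF ps ps, where B=1]; simp add: inner_moments a b)+
  have "(LINT z|(M \<Otimes>\<^sub>M M). cos (\<theta> + (inner01 (fst z) a + inner01 (snd z) b))) =
      (LINT z|(M \<Otimes>\<^sub>M M). cos \<theta> * (cos (inner01 (fst z) a) * cos (inner01 (snd z) b) - sin (inner01 (fst z) a) * sin (inner01 (snd z) b))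
        - sin \<theta> * (sin (inner01 (fst z) a) * cos (inner01 (snd z) b) + cos (inner01 (fst z) a) * sin (inner01 (snd z) b)))"
    by (simp only: cos_add sin_add)
  also have "\<dots> = cos \<theta> * (exp (- V a / 2) * exp (- V b / 2))"
    using i e by simp
  also have "exp (- V a / 2) * exp (- V b / 2) = exp (- (V a + V b) / 2)"
    by (simp add: exp_add[symmetric] add_divide_distrib)
  finally show ?thesis .
qed

text \<open>The parallelogram law, valid pointwise because \<open>inner01 f\<close> is linear. No
  other property of the covariance enters the rotation invariance.\<close>

lemma V_rotate:
  assumes K: "finite K"
  shows "V (trig_poly K (\<lambda>k. (t k + u k) / sqrt 2)) + V (trig_poly K (\<lambda>k. (t k - u k) / sqrt 2)) =
    V (trig_poly K t) + V (trig_poly K u)"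
proof -
  have i: "integrable M (\<lambda>f. (inner01 f (trig_poly K s))\<^sup>2)" for s
    by (rule inner_moments) simp
  have "V (trig_poly K (\<lambda>k. (t k + u k) / sqrt 2)) + V (trig_poly K (\<lambda>k. (t k - u k) / sqrt 2)) =
      (LINT f|M. (inner01 f (trig_poly K (\<lambda>k. (t k + u k) / sqrt 2)))\<^sup>2 + (inner01 f (trig_poly K (\<lambda>k. (t k - u k) / sqrt 2)))\<^sup>2)"
    unfolding V_def using i by simp
  also have "\<dots> = (LINT f|M. (inner01 f (trig_poly K t))\<^sup>2 + (inner01 f (trig_poly K u))\<^sup>2)"
  proof (rule Bochner_Integration.integral_cong[OF refl])
    fix f assume "f \<in> space M"
    then have f: "f \<in> L2_01" by (simp add: space_eq)
    define A where "A = (\<Sum>k\<in>K. t k * coef f k)"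
    define B where "B = (\<Sum>k\<in>K. u k * coef f k)"
    have 1: "(\<Sum>k\<in>K. (t k + u k) / sqrt 2 * coef f k) = (A + B) / sqrt 2"
      by (simp add: A_def B_def distrib_right sum.distrib sum_divide_distrib add_divide_distrib)
    have 2: "(\<Sum>k\<in>K. (t k - u k) / sqrt 2 * coef f k) = (A - B) / sqrt 2"
      by (simp add: A_def B_def left_diff_distrib sum_subtractf sum_divide_distrib diff_divide_distrib)
    have "((A + B) / sqrt 2)\<^sup>2 + ((A - B) / sqrt 2)\<^sup>2 = A\<^sup>2 + B\<^sup>2"
      by (simp add: power_divide power2_sum power2_diff field_simps)
    then show "(inner01 f (trig_poly K (\<lambda>k. (t k + u k) / sqrt 2)))\<^sup>2 + (inner01 f (trig_poly K (\<lambda>k. (t k - u k) / sqrt 2)))\<^sup>2 =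
        (inner01 f (trig_poly K t))\<^sup>2 + (inner01 f (trig_poly K u))\<^sup>2"
      unfolding inner01_trig_poly[OF f] 1 2 by (simp add: A_def B_def)
  qed
  also have "\<dots> = V (trig_poly K t) + V (trig_poly K u)"
    unfolding V_def using i by simp
  finally show ?thesis .
qed

definition coef_law :: "(nat \<Rightarrow> real) measure" where
  "coef_law = distr M real_sequences (\<lambda>f k. coef f k)"

lemma coefs_measurable [measurable]: "(\<lambda>f k. coef f k) \<in> M \<rightarrow>\<^sub>M real_sequences"
  using coef_measurable by (intro measurable_PiM_single') (auto cong: measurable_cong_sets)

lemma sets_coef_law [measurable_cong]: "sets coef_law = sets real_sequences"
  by (simp add: coef_law_def)

lemma space_coef_law [simp]: "space coef_law = UNIV"
  by (simp add: coef_law_def)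

lemma coef_law_prob_space: "prob_space coef_law"
  unfolding coef_law_def by (rule prob_space_distr) measurable

text \<open>The index set \<open>bool \<times> nat\<close> packs a pair of sequences into one family
  of real variables, to which uniqueness of the characteristic functional applies. Frequencies
  \<open>t\<close> and \<open>u\<close> against the rotated pair equal the rotated frequencies
  against the original pair, and \<open>V_rotate\<close> makes the two Gaussian exponents
  agree.\<close>

lemma pair_index_law:
  "distr (M \<Otimes>\<^sub>M M) (\<Pi>\<^sub>M i\<in>(UNIV :: (bool \<times> nat) set). borel)
      (\<lambda>z i. if fst i then coef (fst z) (snd i) else coef (snd z) (snd i)) =
    distr (M \<Otimes>\<^sub>M M) (\<Pi>\<^sub>M i\<in>UNIV. borel)
      (\<lambda>z i. if fst i then (coef (fst z) (snd i) + coef (snd z) (snd i)) / sqrt 2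
        else (coef (fst z) (snd i) - coef (snd z) (snd i)) / sqrt 2)"
proof -
  interpret MM: pair_prob_space M M ..
  have [measurable]: "(\<lambda>f. coef f k) \<in> borel_measurable M" for k
    using coef_measurable by (simp cong: measurable_cong_sets add: sets_eq)
  have reindex: "\<exists>K t u. finite K \<and> (\<forall>h. (\<Sum>i\<in>J. s i * h i) = (\<Sum>k\<in>K. t k * h (True, k)) + (\<Sum>k\<in>K. u k * h (False, k)))"
    if J: "finite J" for J :: "(bool \<times> nat) set" and s :: "bool \<times> nat \<Rightarrow> real"
  proof (intro exI conjI allI)
    \<comment> \<open>The finite index set is enlarged to a rectangle, with frequency 0 at the added
      indices, so that both halves use the same \<open>K\<close>.\<close>
    let ?K = "snd ` J" and ?s = "\<lambda>i. if i \<in> J then s i else 0"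
    show "finite ?K" using J by simp
    fix h :: "bool \<times> nat \<Rightarrow> real"
    have "(\<Sum>i\<in>J. s i * h i) = (\<Sum>i\<in>UNIV \<times> ?K. ?s i * h i)"
      by (rule sum.mono_neutral_cong_left) (use J in \<open>auto intro: rev_image_eqI\<close>)
    also have "\<dots> = (\<Sum>b\<in>UNIV. \<Sum>k\<in>?K. ?s (b, k) * h (b, k))"
      by (simp add: sum.cartesian_product)
    also have "\<dots> = (\<Sum>k\<in>?K. ?s (True, k) * h (True, k)) + (\<Sum>k\<in>?K. ?s (False, k) * h (False, k))"
      by (simp only: UNIV_bool) simp
    finally show "(\<Sum>i\<in>J. s i * h i) = (\<Sum>k\<in>?K. ?s (True, k) * h (True, k)) + (\<Sum>k\<in>?K. ?s (False, k) * h (False, k))" .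
  qed
  show ?thesis
  proof (rule distr_eq_of_characteristic_functional)
    show "prob_space (M \<Otimes>\<^sub>M M)" "prob_space (M \<Otimes>\<^sub>M M)" by (rule MM.P.prob_space_axioms)+
    fix J :: "(bool \<times> nat) set" and \<theta> and s :: "bool \<times> nat \<Rightarrow> real"
    assume "finite J"
    from reindex[OF this, of s] obtain K t u where K: "finite K"
      and ex: "\<And>h. (\<Sum>i\<in>J. s i * h i) = (\<Sum>k\<in>K. t k * h (True, k)) + (\<Sum>k\<in>K. u k * h (False, k))" by blast
    have "(LINT z|(M \<Otimes>\<^sub>M M). cos (\<theta> + (\<Sum>i\<in>J. s i * (if fst i then coef (fst z) (snd i) else coef (snd z) (snd i))))) =
        (LINT z|(M \<Otimes>\<^sub>M M). cos (\<theta> + (inner01 (fst z) (trig_poly K t) + inner01 (snd z) (trig_poly K u))))"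
      by (rule Bochner_Integration.integral_cong) (auto simp: ex space_pair_measure space_eq inner01_trig_poly)
    also have "\<dots> = cos \<theta> * exp (- (V (trig_poly K t) + V (trig_poly K u)) / 2)"
      by (rule expectation_cos_pair) simp_all
    also have "\<dots> = (LINT z|(M \<Otimes>\<^sub>M M). cos (\<theta> + (inner01 (fst z) (trig_poly K (\<lambda>k. (t k + u k) / sqrt 2)) +
        inner01 (snd z) (trig_poly K (\<lambda>k. (t k - u k) / sqrt 2)))))"
      by (subst expectation_cos_pair) (simp_all add: V_rotate K)
    also have "\<dots> = (LINT z|(M \<Otimes>\<^sub>M M). cos (\<theta> + (\<Sum>i\<in>J. s i * (if fst i then (coef (fst z) (snd i) + coef (snd z) (snd i)) / sqrt 2
        else (coef (fst z) (snd i) - coef (snd z) (snd i)) / sqrt 2))))"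
    proof (rule Bochner_Integration.integral_cong[OF refl])
      fix z assume "z \<in> space (M \<Otimes>\<^sub>M M)"
      then have z: "fst z \<in> L2_01" "snd z \<in> L2_01" by (auto simp: space_pair_measure space_eq)
      have "(\<Sum>k\<in>K. (t k + u k) / sqrt 2 * coef (fst z) k) + (\<Sum>k\<in>K. (t k - u k) / sqrt 2 * coef (snd z) k) =
          (\<Sum>k\<in>K. t k * ((coef (fst z) k + coef (snd z) k) / sqrt 2)) + (\<Sum>k\<in>K. u k * ((coef (fst z) k - coef (snd z) k) / sqrt 2))"
        unfolding sum.distrib[symmetric]
        by (intro sum.cong refl) (simp add: algebra_simps add_divide_distrib diff_divide_distrib)
      then show "cos (\<theta> + (inner01 (fst z) (trig_poly K (\<lambda>k. (t k + u k) / sqrt 2)) +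
          inner01 (snd z) (trig_poly K (\<lambda>k. (t k - u k) / sqrt 2)))) =
        cos (\<theta> + (\<Sum>i\<in>J. s i * (if fst i then (coef (fst z) (snd i) + coef (snd z) (snd i)) / sqrt 2
        else (coef (fst z) (snd i) - coef (snd z) (snd i)) / sqrt 2)))"
        unfolding ex by (simp add: inner01_trig_poly z)
    qed
    finally show "(LINT z|(M \<Otimes>\<^sub>M M). cos (\<theta> + (\<Sum>i\<in>J. s i * (if fst i then coef (fst z) (snd i) else coef (snd z) (snd i))))) = \<dots>" .
  qed simp_all
qed

theorem nn_integral_coef_law_rotate:
  assumes [measurable]: "F \<in> borel_measurable (real_sequences \<Otimes>\<^sub>M real_sequences)"
  shows "(\<integral>\<^sup>+ z. F z \<partial>(coef_law \<Otimes>\<^sub>M coef_law)) = (\<integral>\<^sup>+ z. F (rotate_pair z) \<partial>(coef_law \<Otimes>\<^sub>M coef_law))"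
proof -
  interpret C: prob_space coef_law by (rule coef_law_prob_space)
  let ?B = "\<Pi>\<^sub>M i\<in>(UNIV :: (bool \<times> nat) set). (borel :: real measure)"
  let ?X = "\<lambda>z i. if fst i then coef (fst z) (snd i) else coef (snd z) (snd i)"
  let ?Y = "\<lambda>z i. if fst i then (coef (fst z) (snd i) + coef (snd z) (snd i)) / sqrt 2
        else (coef (fst z) (snd i) - coef (snd z) (snd i)) / sqrt 2"
  define r :: "(bool \<times> nat \<Rightarrow> real) \<Rightarrow> _" where "r w = ((\<lambda>k. w (True, k)), (\<lambda>k. w (False, k)))" for w
  have [measurable]: "r \<in> ?B \<rightarrow>\<^sub>M real_sequences \<Otimes>\<^sub>M real_sequences"
    unfolding r_def[abs_def] by (intro measurable_Pair measurable_PiM_single') (auto simp: space_PiM)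
  have [measurable]: "(\<lambda>f. coef f k) \<in> borel_measurable M" for k
    using coef_measurable by (simp cong: measurable_cong_sets add: sets_eq)
  have [measurable]: "?X \<in> (M \<Otimes>\<^sub>M M) \<rightarrow>\<^sub>M ?B" "?Y \<in> (M \<Otimes>\<^sub>M M) \<rightarrow>\<^sub>M ?B"
    by (intro measurable_PiM_single'; simp)+
  have pd: "coef_law \<Otimes>\<^sub>M coef_law = distr (M \<Otimes>\<^sub>M M) (real_sequences \<Otimes>\<^sub>M real_sequences) (\<lambda>(f, g). ((\<lambda>k. coef f k), (\<lambda>k. coef g k)))"
    unfolding coef_law_def
    by (rule pair_measure_distr) (use C.sigma_finite_measure_axioms in \<open>auto simp: coef_law_def\<close>)
  have tr: "(\<integral>\<^sup>+ z. G z \<partial>(coef_law \<Otimes>\<^sub>M coef_law)) = (\<integral>\<^sup>+ z. G ((\<lambda>k. coef (fst z) k), (\<lambda>k. coef (snd z) k)) \<partial>(M \<Otimes>\<^sub>M M))"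
    if [measurable]: "G \<in> borel_measurable (real_sequences \<Otimes>\<^sub>M real_sequences)" for G
    unfolding pd by (subst nn_integral_distr) (auto simp: split_beta')
  have "(\<integral>\<^sup>+ z. F z \<partial>(coef_law \<Otimes>\<^sub>M coef_law)) = (\<integral>\<^sup>+ z. F (r (?X z)) \<partial>(M \<Otimes>\<^sub>M M))"
    by (simp add: tr r_def)
  also have "\<dots> = (\<integral>\<^sup>+ w. F (r w) \<partial>distr (M \<Otimes>\<^sub>M M) ?B ?X)"
    by (subst nn_integral_distr) auto
  also have "\<dots> = (\<integral>\<^sup>+ w. F (r w) \<partial>distr (M \<Otimes>\<^sub>M M) ?B ?Y)"
    unfolding pair_index_law ..
  also have "\<dots> = (\<integral>\<^sup>+ z. F (r (?Y z)) \<partial>(M \<Otimes>\<^sub>M M))"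
    by (subst nn_integral_distr) auto
  also have "\<dots> = (\<integral>\<^sup>+ z. F (rotate_pair z) \<partial>(coef_law \<Otimes>\<^sub>M coef_law))"
  proof -
    have "(\<lambda>z. F (rotate_pair z)) \<in> borel_measurable (real_sequences \<Otimes>\<^sub>M real_sequences)"
      by measurable
    from tr[OF this] show ?thesis by (simp add: r_def rotate_pair_def)
  qed
  finally show ?thesis .
qed

end

section \<open>Posteriors in sequence space\<close>

definition seq_inner :: "(nat \<Rightarrow> real) \<Rightarrow> (nat \<Rightarrow> real) \<Rightarrow> real" where
  "seq_inner Y x = (\<Sum>k. Y k * x k)"

definition seq_norm_sq :: "(nat \<Rightarrow> real) \<Rightarrow> real" where
  "seq_norm_sq x = (\<Sum>k. (x k)\<^sup>2)"

definition seq_likelihood :: "real \<Rightarrow> (nat \<Rightarrow> real) \<Rightarrow> (nat \<Rightarrow> real) \<Rightarrow> real" where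
  "seq_likelihood \<epsilon> Y x = exp (seq_inner Y x / \<epsilon>\<^sup>2 - seq_norm_sq x / (2 * \<epsilon>\<^sup>2))"

lemma seq_coordinate_measurable [measurable]: "(\<lambda>x. x k) \<in> borel_measurable real_sequences"
  by (rule measurable_component_singleton) simp

lemma seq_inner_measurable [measurable]:
  assumes [measurable]: "f \<in> M \<rightarrow>\<^sub>M real_sequences" "g \<in> M \<rightarrow>\<^sub>M real_sequences"
  shows "(\<lambda>z. seq_inner (f z) (g z)) \<in> borel_measurable M"
proof -
  have [measurable]: "(\<lambda>z. f z k) \<in> borel_measurable M" "(\<lambda>z. g z k) \<in> borel_measurable M" for k
    by (rule measurable_compose[OF assms(1) seq_coordinate_measurable],
      rule measurable_compose[OF assms(2) seq_coordinate_measurable])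
  show ?thesis unfolding seq_inner_def by measurable
qed

lemma seq_norm_sq_measurable [measurable]:
  assumes [measurable]: "f \<in> M \<rightarrow>\<^sub>M real_sequences"
  shows "(\<lambda>z. seq_norm_sq (f z)) \<in> borel_measurable M"
proof -
  have [measurable]: "(\<lambda>z. f z k) \<in> borel_measurable M" for k
    by (rule measurable_compose[OF assms(1) seq_coordinate_measurable])
  show ?thesis unfolding seq_norm_sq_def by measurable
qed

lemma seq_likelihood_measurable [measurable]:
  assumes [measurable]: "f \<in> M \<rightarrow>\<^sub>M real_sequences" "g \<in> M \<rightarrow>\<^sub>M real_sequences"
  shows "(\<lambda>z. seq_likelihood \<epsilon> (f z) (g z)) \<in> borel_measurable M"
  unfolding seq_likelihood_def by measurable

lemma sets_Collect_seq_summable: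
  "{z \<in> space (real_sequences \<Otimes>\<^sub>M real_sequences). summable (\<lambda>k. fst z k * snd z k)} \<in> sets (real_sequences \<Otimes>\<^sub>M real_sequences)"
proof -
  have "{z \<in> space (real_sequences \<Otimes>\<^sub>M real_sequences). Cauchy (\<lambda>n. \<Sum>k<n. fst z k * snd z k)} \<in> sets (real_sequences \<Otimes>\<^sub>M real_sequences)"
    by measurable
  then show ?thesis by (simp add: summable_iff_convergent Cauchy_convergent_iff)
qed

text \<open>The rotation is symmetric and can be moved from the parameters to the data. Convergence
  of all four series is assumed because \<open>suminf\<close> is additive only on convergent
  series.\<close>

lemma seq_inner_rotate:
  assumes "summable (\<lambda>k. Y k * u k)" "summable (\<lambda>k. Y k * v k)"
    "summable (\<lambda>k. Y' k * u k)" "summable (\<lambda>k. Y' k * v k)"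
  shows "seq_inner Y (\<lambda>k. (u k + v k) / sqrt 2) + seq_inner Y' (\<lambda>k. (u k - v k) / sqrt 2) =
    seq_inner (\<lambda>k. (Y k + Y' k) / sqrt 2) u + seq_inner (\<lambda>k. (Y k - Y' k) / sqrt 2) v"
proof -
  have 1: "(\<lambda>k. Y k * ((u k + v k) / sqrt 2)) sums (((\<Sum>k. Y k * u k) + (\<Sum>k. Y k * v k)) / sqrt 2)"
    using sums_divide[OF sums_add[OF assms(1,2)[THEN summable_sums]], of "sqrt 2"] by (simp add: distrib_left)
  have 2: "(\<lambda>k. Y' k * ((u k - v k) / sqrt 2)) sums (((\<Sum>k. Y' k * u k) - (\<Sum>k. Y' k * v k)) / sqrt 2)"
    using sums_divide[OF sums_diff[OF assms(3,4)[THEN summable_sums]], of "sqrt 2"] by (simp add: right_diff_distrib)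
  have 3: "(\<lambda>k. (Y k + Y' k) / sqrt 2 * u k) sums (((\<Sum>k. Y k * u k) + (\<Sum>k. Y' k * u k)) / sqrt 2)"
    using sums_divide[OF sums_add[OF assms(1,3)[THEN summable_sums]], of "sqrt 2"] by (simp add: distrib_right)
  have 4: "(\<lambda>k. (Y k - Y' k) / sqrt 2 * v k) sums (((\<Sum>k. Y k * v k) - (\<Sum>k. Y' k * v k)) / sqrt 2)"
    using sums_divide[OF sums_diff[OF assms(2,4)[THEN summable_sums]], of "sqrt 2"] by (simp add: left_diff_distrib)
  show ?thesis
    unfolding seq_inner_def 1[THEN sums_unique, symmetric] 2[THEN sums_unique, symmetric]
      3[THEN sums_unique, symmetric] 4[THEN sums_unique, symmetric]
    by (simp add: add_divide_distrib diff_divide_distrib)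
qed

lemma seq_norm_sq_rotate:
  assumes "summable (\<lambda>k. (u k)\<^sup>2)" "summable (\<lambda>k. (v k)\<^sup>2)"
  shows "seq_norm_sq (\<lambda>k. (u k + v k) / sqrt 2) + seq_norm_sq (\<lambda>k. (u k - v k) / sqrt 2) =
    seq_norm_sq u + seq_norm_sq v"
proof -
  have uv: "summable (\<lambda>k. u k * v k)"
  proof (rule summable_comparison_test')
    show "summable (\<lambda>k. (u k)\<^sup>2 + (v k)\<^sup>2)" using assms by (rule summable_add)
    fix k
    have "2 * \<bar>u k * v k\<bar> \<le> (u k)\<^sup>2 + (v k)\<^sup>2"
      using sum_squares_bound[of "\<bar>u k\<bar>" "\<bar>v k\<bar>"] by (simp add: abs_mult)
    then show "norm (u k * v k) \<le> (u k)\<^sup>2 + (v k)\<^sup>2"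
      using abs_ge_zero[of "u k * v k"] unfolding real_norm_def by linarith
  qed
  have 1: "(\<lambda>k. ((u k + v k) / sqrt 2)\<^sup>2) sums ((seq_norm_sq u + seq_norm_sq v + 2 * (\<Sum>k. u k * v k)) / 2)"
    unfolding seq_norm_sq_def power_divide power2_sum
    using sums_divide[OF sums_add[OF sums_add[OF assms[THEN summable_sums]] sums_mult[OF uv[THEN summable_sums], of 2]], of 2]
    by (simp add: mult.assoc)
  have 2: "(\<lambda>k. ((u k - v k) / sqrt 2)\<^sup>2) sums ((seq_norm_sq u + seq_norm_sq v - 2 * (\<Sum>k. u k * v k)) / 2)"
    unfolding seq_norm_sq_def power_divide power2_diff
    using sums_divide[OF sums_diff[OF sums_add[OF assms[THEN summable_sums]] sums_mult[OF uv[THEN summable_sums], of 2]], of 2]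
    by (simp add: mult.assoc)
  show ?thesis
    using 1[THEN sums_unique] 2[THEN sums_unique] by (simp add: seq_norm_sq_def add_divide_distrib diff_divide_distrib)
qed

lemma seq_inner_coef: "f \<in> L2_01 \<Longrightarrow> g \<in> L2_01 \<Longrightarrow> seq_inner (coef f) (coef g) = inner01 f g"
  unfolding seq_inner_def using Parseval[of f g] by (simp add: sums_iff)

lemma seq_norm_sq_coef: "f \<in> L2_01 \<Longrightarrow> seq_norm_sq (coef f) = inner01 f f"
  unfolding seq_norm_sq_def using Parseval_self[of f] by (simp add: sums_iff)

lemma seq_likelihood_coef: "f \<in> L2_01 \<Longrightarrow> seq_likelihood \<epsilon> Y (coef f) = likelihood \<epsilon> Y f"
  unfolding seq_likelihood_def likelihood_def data_inner_def
  by (simp add: seq_norm_sq_coef L2norm01_sq) (simp add: seq_inner_def)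

lemma seq_likelihood_pos [simp]: "0 < seq_likelihood \<epsilon> Y x"
  by (simp add: seq_likelihood_def)

lemma seq_likelihood_nonneg [simp]: "0 \<le> seq_likelihood \<epsilon> Y x"
  by (simp add: seq_likelihood_def)

section \<open>Rotation of posteriors\<close>

locale gaussian_posterior = gaussian_prior M for M +
  fixes \<epsilon> :: real
  assumes eps: "\<epsilon> > 0"
begin

sublocale C: prob_space coef_law by (rule coef_law_prob_space)

sublocale CC: pair_prob_space coef_law coef_law ..

lemma AE_coef_lawI:
  assumes "{x \<in> space real_sequences. P x} \<in> sets real_sequences" "\<And>f. f \<in> L2_01 \<Longrightarrow> P (coef f)"
  shows "AE x in coef_law. P x"
  unfolding coef_law_def using assms
  by (subst AE_distr_iff) (auto simp: space_eq)

lemma AE_square_summable: "AE x in coef_law. summable (\<lambda>k. (x k)\<^sup>2)"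
proof (rule AE_coef_lawI)
  have "{z \<in> space real_sequences. Cauchy (\<lambda>n. \<Sum>k<n. (z k)\<^sup>2)} \<in> sets real_sequences"
    by measurable
  then show "{x \<in> space real_sequences. summable (\<lambda>k. (x k)\<^sup>2)} \<in> sets real_sequences"
    by (simp add: summable_iff_convergent Cauchy_convergent_iff)
  show "summable (\<lambda>k. (coef f k)\<^sup>2)" if "f \<in> L2_01" for f
    using Parseval_self[OF that] by (rule sums_summable)
qed

text \<open>For such data the exponent of the likelihood is a genuine sum, and not the default value
  of \<open>suminf\<close>, for almost every parameter.\<close>

definition regular :: "(nat \<Rightarrow> real) \<Rightarrow> bool" where
  "regular Y \<longleftrightarrow> (AE x in coef_law. summable (\<lambda>k. Y k * x k))"

lemma sets_Collect_summable_left: "{x \<in> space real_sequences. summable (\<lambda>k. Y k * x k)} \<in> sets real_sequences"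
proof -
  have "{z \<in> space real_sequences. Cauchy (\<lambda>n. \<Sum>k<n. Y k * z k)} \<in> sets real_sequences"
    by measurable
  then show ?thesis by (simp add: summable_iff_convergent Cauchy_convergent_iff)
qed

lemma regular_coef: "g \<in> L2_01 \<Longrightarrow> regular (coef g)"
  unfolding regular_def
  by (rule AE_coef_lawI[OF sets_Collect_summable_left]) (use Parseval sums_summable in blast)

lemma regular_linear:
  assumes "regular Y" "regular Y'"
  shows "regular (\<lambda>k. a * Y k + b * Y' k)"
  using assms unfolding regular_def
proof eventually_elim
  case (elim x)
  from summable_add[OF summable_mult[OF elim(1), of a] summable_mult[OF elim(2), of b]]
  show ?case by (simp add: distrib_right mult.assoc)
qed

lemma AE_pair_both:
  assumes "AE x in coef_law. P x"
  shows "AE z in coef_law \<Otimes>\<^sub>M coef_law. P (fst z) \<and> P (snd z)"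
proof -
  have 1: "AE z in coef_law \<Otimes>\<^sub>M coef_law. P (fst z)"
  proof (rule AE_distrD[of fst _ coef_law])
    show "AE x in distr (coef_law \<Otimes>\<^sub>M coef_law) coef_law fst. P x"
      unfolding C.distr_pair_fst by (rule assms)
  qed simp
  have "AE z in coef_law \<Otimes>\<^sub>M coef_law. P (snd z)"
  proof -
    have "AE z in distr (coef_law \<Otimes>\<^sub>M coef_law) (coef_law \<Otimes>\<^sub>M coef_law) (\<lambda>(x, y). (y, x)). P (fst z)"
      unfolding CC.distr_pair_swap[symmetric] by (rule 1)
    from AE_distrD[OF _ this] show ?thesis by (simp add: split_beta')
  qed
  with 1 show ?thesis by eventually_elim simp
qed

text \<open>The normalising constant is an extended real, so that its finiteness is a statement that
  can fail and has to be proved.\<close>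

definition evidence :: "(nat \<Rightarrow> real) \<Rightarrow> ennreal" where
  "evidence Y = (\<integral>\<^sup>+ x. ennreal (seq_likelihood \<epsilon> Y x) \<partial>coef_law)"

lemma evidence_pos: "evidence Y > 0"
proof -
  have "evidence Y \<noteq> 0"
  proof
    assume "evidence Y = 0"
    then have "AE x in coef_law. ennreal (seq_likelihood \<epsilon> Y x) = 0"
      unfolding evidence_def by (subst (asm) nn_integral_0_iff_AE) auto
    then have "AE x in coef_law. False"
    proof eventually_elim
      case (elim x)
      then show ?case using seq_likelihood_pos[of \<epsilon> Y x] by (simp add: ennreal_eq_0_iff)
    qed
    then show False by simp
  qed
  then show ?thesis by (simp add: zero_less_iff_neq_zero)
qed

text \<open>After the rotation the exponent of the product likelihood splits into one term in
  \<open>u\<close> with data \<open>(Y + Y') / sqrt 2\<close> and one in \<open>v\<close> with data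
  \<open>(Y - Y') / sqrt 2\<close>. The difference tested by \<open>h\<close> is a function of
  \<open>v\<close> alone, so the integral factorises, and the part in \<open>u\<close> is an
  evidence.\<close>

lemma evidence_rotation:
  assumes Y: "regular Y" "regular Y'" and g: "g \<in> L2_01" and [measurable]: "h \<in> borel_measurable borel"
  shows "(\<integral>\<^sup>+ z. h (seq_inner (coef g) (fst z) - seq_inner (coef g) (snd z)) *
      (ennreal (seq_likelihood \<epsilon> Y (fst z)) * ennreal (seq_likelihood \<epsilon> Y' (snd z))) \<partial>(coef_law \<Otimes>\<^sub>M coef_law)) =
    evidence (\<lambda>k. (Y k + Y' k) / sqrt 2) *
    (\<integral>\<^sup>+ v. h (sqrt 2 * seq_inner (coef g) v) * ennreal (seq_likelihood \<epsilon> (\<lambda>k. (Y k - Y' k) / sqrt 2) v) \<partial>coef_law)"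
    (is "?L = _ * ?R")
proof -
  let ?b = "coef g" and ?Yp = "\<lambda>k. (Y k + Y' k) / sqrt 2" and ?Ym = "\<lambda>k. (Y k - Y' k) / sqrt 2"
  have meas: "(\<lambda>z. h (seq_inner ?b (fst z) - seq_inner ?b (snd z)) *
      (ennreal (seq_likelihood \<epsilon> Y (fst z)) * ennreal (seq_likelihood \<epsilon> Y' (snd z)))) \<in> borel_measurable (real_sequences \<Otimes>\<^sub>M real_sequences)"
    by measurable
  have "?L = (\<integral>\<^sup>+ z. ennreal (seq_likelihood \<epsilon> ?Yp (fst z)) *
      (h (sqrt 2 * seq_inner ?b (snd z)) * ennreal (seq_likelihood \<epsilon> ?Ym (snd z))) \<partial>(coef_law \<Otimes>\<^sub>M coef_law))"
    unfolding nn_integral_coef_law_rotate[OF meas]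
  proof (rule nn_integral_cong_AE)
    have "AE x in coef_law. summable (\<lambda>k. Y k * x k) \<and> summable (\<lambda>k. Y' k * x k) \<and>
        summable (\<lambda>k. ?b k * x k) \<and> summable (\<lambda>k. (x k)\<^sup>2)"
      using Y regular_coef[OF g] AE_square_summable unfolding regular_def by eventually_elim simp
    from AE_pair_both[OF this]
    show "AE z in coef_law \<Otimes>\<^sub>M coef_law.
        h (seq_inner ?b (fst (rotate_pair z)) - seq_inner ?b (snd (rotate_pair z))) *
        (ennreal (seq_likelihood \<epsilon> Y (fst (rotate_pair z))) * ennreal (seq_likelihood \<epsilon> Y' (snd (rotate_pair z)))) =
        ennreal (seq_likelihood \<epsilon> ?Yp (fst z)) *
        (h (sqrt 2 * seq_inner ?b (snd z)) * ennreal (seq_likelihood \<epsilon> ?Ym (snd z)))"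
    proof eventually_elim
      case (elim z)
      define u where "u = fst z"
      define v where "v = snd z"
      have s: "summable (\<lambda>k. Y k * u k)" "summable (\<lambda>k. Y k * v k)" "summable (\<lambda>k. Y' k * u k)" "summable (\<lambda>k. Y' k * v k)"
        "summable (\<lambda>k. ?b k * u k)" "summable (\<lambda>k. ?b k * v k)" "summable (\<lambda>k. (u k)\<^sup>2)" "summable (\<lambda>k. (v k)\<^sup>2)"
        using elim by (auto simp: u_def v_def)
      have r: "fst (rotate_pair z) = (\<lambda>k. (u k + v k) / sqrt 2)" "snd (rotate_pair z) = (\<lambda>k. (u k - v k) / sqrt 2)"
        by (simp_all add: rotate_pair_def u_def v_def)
      \<comment> \<open>The formula for the tested difference is the case of
        \<open>seq_inner_rotate\<close> with the data \<open>?b\<close> and \<open>- ?b\<close>: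
        their sum vanishes and their difference gives the factor \<open>sqrt 2\<close>.\<close>
      have n: "summable (\<lambda>k. - ?b k * u k)" "summable (\<lambda>k. - ?b k * v k)"
        using s(5,6) by (simp_all add: summable_minus_iff)
      have neg: "seq_inner (\<lambda>k. - ?b k) x = - seq_inner ?b x" if "summable (\<lambda>k. ?b k * x k)" for x
        unfolding seq_inner_def using suminf_minus[OF that] by simp
      have sd: "summable (\<lambda>k. ?b k * ((u k - v k) / sqrt 2))"
        using summable_divide[OF summable_diff[OF s(5,6)], of "sqrt 2"] by (simp add: right_diff_distrib)
      have lin: "seq_inner (\<lambda>k. 0) u = 0" by (simp add: seq_inner_def)
      have scale: "seq_inner (\<lambda>k. (?b k - - ?b k) / sqrt 2) v = sqrt 2 * seq_inner ?b v"
      proof -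
        have "(?b k - - ?b k) / sqrt 2 * v k = sqrt 2 * (?b k * v k)" for k
          by (simp add: real_divide_square_eq field_simps)
        then show ?thesis unfolding seq_inner_def using suminf_mult[OF s(6), of "sqrt 2"] by simp
      qed
      have inner: "seq_inner ?b (\<lambda>k. (u k + v k) / sqrt 2) - seq_inner ?b (\<lambda>k. (u k - v k) / sqrt 2) = sqrt 2 * seq_inner ?b v"
        using seq_inner_rotate[OF s(5,6) n] neg[OF sd] scale lin by simp
      have "ennreal (seq_likelihood \<epsilon> Y (\<lambda>k. (u k + v k) / sqrt 2)) * ennreal (seq_likelihood \<epsilon> Y' (\<lambda>k. (u k - v k) / sqrt 2)) =
          ennreal (exp ((seq_inner Y (\<lambda>k. (u k + v k) / sqrt 2) + seq_inner Y' (\<lambda>k. (u k - v k) / sqrt 2)) / \<epsilon>\<^sup>2 -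
            (seq_norm_sq (\<lambda>k. (u k + v k) / sqrt 2) + seq_norm_sq (\<lambda>k. (u k - v k) / sqrt 2)) / (2 * \<epsilon>\<^sup>2)))"
        unfolding seq_likelihood_def
        by (simp add: ennreal_mult[symmetric] add_divide_distrib algebra_simps flip: exp_add)
      also have "\<dots> = ennreal (exp ((seq_inner ?Yp u + seq_inner ?Ym v) / \<epsilon>\<^sup>2 - (seq_norm_sq u + seq_norm_sq v) / (2 * \<epsilon>\<^sup>2)))"
        by (simp only: seq_inner_rotate[OF s(1-4)] seq_norm_sq_rotate[OF s(7,8)])
      also have "\<dots> = ennreal (seq_likelihood \<epsilon> ?Yp u) * ennreal (seq_likelihood \<epsilon> ?Ym v)"
        unfolding seq_likelihood_def
        by (simp add: ennreal_mult[symmetric] add_divide_distrib algebra_simps flip: exp_add)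
      finally show ?case
        unfolding r inner by (simp add: u_def[symmetric] v_def[symmetric] mult_ac)
    qed
  qed
  also have "\<dots> = (\<integral>\<^sup>+ u. \<integral>\<^sup>+ v. ennreal (seq_likelihood \<epsilon> ?Yp u) *
      (h (sqrt 2 * seq_inner ?b v) * ennreal (seq_likelihood \<epsilon> ?Ym v)) \<partial>coef_law \<partial>coef_law)"
    by (subst C.nn_integral_fst[symmetric]) auto
  also have "\<dots> = evidence ?Yp * ?R"
    unfolding evidence_def by (subst nn_integral_cmult, measurable, rule nn_integral_multc, measurable)
  finally show ?thesis .
qed

definition good :: "(nat \<Rightarrow> real) \<Rightarrow> bool" where
  "good Y \<longleftrightarrow> regular Y \<and> evidence Y < \<infinity>"

definition post :: "(nat \<Rightarrow> real) \<Rightarrow> (nat \<Rightarrow> real) measure" where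
  "post Y = density coef_law (\<lambda>x. ennreal (seq_likelihood \<epsilon> Y x) / evidence Y)"

lemma sets_post [measurable_cong]: "sets (post Y) = sets real_sequences"
  by (simp add: post_def sets_coef_law)

lemma space_post [simp]: "space (post Y) = UNIV"
  by (simp add: post_def)

lemma nn_integral_post:
  assumes [measurable]: "F \<in> borel_measurable real_sequences"
  shows "(\<integral>\<^sup>+ x. F x \<partial>post Y) = (\<integral>\<^sup>+ x. F x * ennreal (seq_likelihood \<epsilon> Y x) \<partial>coef_law) / evidence Y"
proof -
  have "(\<integral>\<^sup>+ x. F x \<partial>post Y) = (\<integral>\<^sup>+ x. F x * ennreal (seq_likelihood \<epsilon> Y x) / evidence Y \<partial>coef_law)"
    unfolding post_def by (subst nn_integral_density) (auto simp: ennreal_times_divide mult.commute)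
  also have "\<dots> = (\<integral>\<^sup>+ x. F x * ennreal (seq_likelihood \<epsilon> Y x) \<partial>coef_law) / evidence Y"
    by (rule nn_integral_divide) measurable
  finally show ?thesis .
qed

lemma ennreal_divide_self_good: "good Y \<Longrightarrow> evidence Y / evidence Y = 1"
  using evidence_pos[of Y] by (intro ennreal_divide_self) (auto simp: good_def)

lemma post_prob_space:
  assumes "good Y" shows "prob_space (post Y)"
proof (rule prob_spaceI)
  have "emeasure (post Y) (space (post Y)) = (\<integral>\<^sup>+ x. 1 \<partial>post Y)" by simp
  also have "\<dots> = 1"
    by (subst nn_integral_post) (simp_all add: evidence_def[symmetric] ennreal_divide_self_good[OF assms])
  finally show "emeasure (post Y) (space (post Y)) = 1" .
qed

lemma AE_post:
  assumes "AE x in coef_law. P x" shows "AE x in post Y. P x"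
  unfolding post_def by (subst AE_density) (use assms in auto)

text \<open>The joint law of two posterior draws is a weighted rotation-invariant law, so the
  difference is again governed by a posterior. The statement concerns one direction \<open>g\<close>
  at a time, which keeps all laws on the real line.\<close>

theorem post_difference_law:
  assumes Y: "good Y" "good Y'" and g: "g \<in> L2_01" and [measurable]: "h \<in> borel_measurable borel"
  shows "good (\<lambda>k. (Y k - Y' k) / sqrt 2)"
    and "(\<integral>\<^sup>+ z. h (seq_inner (coef g) (fst z) - seq_inner (coef g) (snd z)) \<partial>(post Y \<Otimes>\<^sub>M post Y')) =
      (\<integral>\<^sup>+ v. h (sqrt 2 * seq_inner (coef g) v) \<partial>post (\<lambda>k. (Y k - Y' k) / sqrt 2))"
proof -
  let ?Yp = "\<lambda>k. (Y k + Y' k) / sqrt 2" and ?Ym = "\<lambda>k. (Y k - Y' k) / sqrt 2"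
  let ?D = "\<lambda>x y. h (seq_inner (coef g) x - seq_inner (coef g) y)"
  let ?W = "\<lambda>x. ennreal (seq_likelihood \<epsilon> Y x)" and ?W' = "\<lambda>y. ennreal (seq_likelihood \<epsilon> Y' y)"
  have r: "regular Y" "regular Y'" and fin: "evidence Y < \<infinity>" "evidence Y' < \<infinity>" using Y by (auto simp: good_def)
  interpret Q: prob_space "post Y'" using Y(2) by (rule post_prob_space)
  have "(\<integral>\<^sup>+ z. ennreal (seq_likelihood \<epsilon> Y (fst z)) * ennreal (seq_likelihood \<epsilon> Y' (snd z)) \<partial>(coef_law \<Otimes>\<^sub>M coef_law)) = evidence Y * evidence Y'"
    unfolding evidence_def
    by (subst C.nn_integral_fst[symmetric], measurable, simp, subst nn_integral_cmult, measurable, rule nn_integral_multc, measurable)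
  \<comment> \<open>The rotation with \<open>h = 1\<close>. It does double duty: positivity of both
    factors makes the new evidences finite, and the identity cancels all the normalising constants
    below.\<close>
  then have ZZ: "evidence Y * evidence Y' = evidence ?Yp * evidence ?Ym"
    using evidence_rotation[OF r g, of "\<lambda>_. 1"] by (simp add: evidence_def[of ?Ym])
  have "evidence ?Yp * evidence ?Ym < \<infinity>"
    unfolding ZZ[symmetric] using fin by (simp add: ennreal_mult_less_top)
  then have fm: "evidence ?Yp < \<infinity>" "evidence ?Ym < \<infinity>"
    using evidence_pos[of ?Yp] evidence_pos[of ?Ym] by (auto simp: ennreal_mult_less_top)
  have "regular ?Ym" using regular_linear[OF r, of "1 / sqrt 2" "- 1 / sqrt 2"] by (simp add: diff_divide_distrib)
  then show "good ?Ym" using fm by (simp add: good_def)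
  have "(\<integral>\<^sup>+ z. h (seq_inner (coef g) (fst z) - seq_inner (coef g) (snd z)) \<partial>(post Y \<Otimes>\<^sub>M post Y')) =
      (\<integral>\<^sup>+ x. \<integral>\<^sup>+ y. h (seq_inner (coef g) x - seq_inner (coef g) y) \<partial>post Y' \<partial>post Y)"
    by (subst Q.nn_integral_fst[symmetric]) auto
  also have "\<dots> = (\<integral>\<^sup>+ x. (\<integral>\<^sup>+ y. ?D x y \<partial>post Y') * ?W x \<partial>coef_law) / evidence Y"
    by (rule nn_integral_post) measurable
  also have "(\<integral>\<^sup>+ x. (\<integral>\<^sup>+ y. ?D x y \<partial>post Y') * ?W x \<partial>coef_law) =
      (\<integral>\<^sup>+ x. (\<integral>\<^sup>+ y. ?D x y * (?W x * ?W' y) \<partial>coef_law) / evidence Y' \<partial>coef_law)"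
  proof (rule nn_integral_cong)
    fix x
    have "(\<integral>\<^sup>+ y. ?D x y \<partial>post Y') = (\<integral>\<^sup>+ y. ?D x y * ?W' y \<partial>coef_law) / evidence Y'"
      by (rule nn_integral_post) measurable
    then have "(\<integral>\<^sup>+ y. ?D x y \<partial>post Y') * ?W x = (\<integral>\<^sup>+ y. ?D x y * ?W' y \<partial>coef_law) * ?W x / evidence Y'"
      by (simp only: ennreal_divide_times ennreal_times_divide)
    also have "(\<integral>\<^sup>+ y. ?D x y * ?W' y \<partial>coef_law) * ?W x = (\<integral>\<^sup>+ y. ?D x y * ?W' y * ?W x \<partial>coef_law)"
      by (rule nn_integral_multc[symmetric]) measurable
    also have "\<dots> = (\<integral>\<^sup>+ y. ?D x y * (?W x * ?W' y) \<partial>coef_law)"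
      by (simp only: mult_ac)
    finally show "(\<integral>\<^sup>+ y. ?D x y \<partial>post Y') * ?W x = (\<integral>\<^sup>+ y. ?D x y * (?W x * ?W' y) \<partial>coef_law) / evidence Y'" .
  qed
  also have "\<dots> = (\<integral>\<^sup>+ x. (\<integral>\<^sup>+ y. ?D x y * (?W x * ?W' y) \<partial>coef_law) \<partial>coef_law) / evidence Y'"
    by (rule nn_integral_divide) measurable
  also have "(\<integral>\<^sup>+ x. (\<integral>\<^sup>+ y. ?D x y * (?W x * ?W' y) \<partial>coef_law) \<partial>coef_law) =
      (\<integral>\<^sup>+ z. ?D (fst z) (snd z) * (?W (fst z) * ?W' (snd z)) \<partial>(coef_law \<Otimes>\<^sub>M coef_law))"
    by (subst C.nn_integral_fst[symmetric]) simp_all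
  also have "\<dots> = evidence ?Yp * (\<integral>\<^sup>+ v. h (sqrt 2 * seq_inner (coef g) v) * ennreal (seq_likelihood \<epsilon> ?Ym v) \<partial>coef_law)"
    by (rule evidence_rotation[OF r g]) measurable
  also have "evidence ?Yp * (\<integral>\<^sup>+ v. h (sqrt 2 * seq_inner (coef g) v) * ennreal (seq_likelihood \<epsilon> ?Ym v) \<partial>coef_law) / evidence Y' / evidence Y =
      evidence ?Yp * (\<integral>\<^sup>+ v. h (sqrt 2 * seq_inner (coef g) v) * ennreal (seq_likelihood \<epsilon> ?Ym v) \<partial>coef_law) / (evidence ?Yp * evidence ?Ym)"
    unfolding ZZ[symmetric] divide_ennreal_def
    using fin evidence_pos[of Y] evidence_pos[of Y'] by (simp add: ennreal_inverse_mult mult_ac)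
  also have "\<dots> = (\<integral>\<^sup>+ v. h (sqrt 2 * seq_inner (coef g) v) * ennreal (seq_likelihood \<epsilon> ?Ym v) \<partial>coef_law) / evidence ?Ym"
    unfolding mult.commute[of "evidence ?Yp"] using fm evidence_pos[of ?Yp] by (intro divide_mult_eq) auto
  also have "\<dots> = (\<integral>\<^sup>+ v. h (sqrt 2 * seq_inner (coef g) v) \<partial>post ?Ym)"
    by (subst nn_integral_post) auto
  finally show "(\<integral>\<^sup>+ z. h (seq_inner (coef g) (fst z) - seq_inner (coef g) (snd z)) \<partial>(post Y \<Otimes>\<^sub>M post Y')) =
      (\<integral>\<^sup>+ v. h (sqrt 2 * seq_inner (coef g) v) \<partial>post ?Ym)" .
qed

end

section \<open>Spread of the posterior in one direction\<close>

lemma ennreal_one_divide_numeral: "(1 / numeral n :: ennreal) = ennreal (1 / numeral n)"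
  by (subst divide_ennreal[symmetric]) simp_all

lemma ennreal_mult_divide_cancel:
  fixes e x :: ennreal
  shows "e \<noteq> 0 \<Longrightarrow> e \<noteq> top \<Longrightarrow> e * (x / e) = x"
  unfolding ennreal_times_divide mult.commute[of e x] by (rule mult_divide_eq_ennreal)

text \<open>Reflection in the mean preserves the law and exchanges the two open half-lines, whose
  masses add up to at most 1.\<close>

lemma normal_upper_half:
  assumes "\<sigma> > 0"
  shows "emeasure (density lborel (normal_density m \<sigma>)) {m<..} \<le> 1 / 2"
proof -
  let ?D = "density lborel (normal_density m \<sigma>)"
  interpret prob_space ?D using assms by (rule prob_space_normal_density)
  have "distributed ?D lborel (\<lambda>y. y) (normal_density m \<sigma>)"
    unfolding distributed_def by (auto simp: distr_id2 sets_eq_imp_space_eq)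
  from normal_density_affine[OF this assms, of "-1" "2 * m"]
  have "distr ?D lborel (\<lambda>y. 2 * m + - 1 * y) = ?D"
    using assms by (simp add: distributed_def)
  then have "emeasure ?D {m<..} = emeasure (distr ?D lborel (\<lambda>y. 2 * m + - 1 * y)) {m<..}" by simp
  also have "\<dots> = emeasure ?D ((\<lambda>y. 2 * m + - 1 * y) -` {m<..} \<inter> space ?D)"
    by (rule emeasure_distr) auto
  also have "(\<lambda>y. 2 * m + - 1 * y) -` {m<..} \<inter> space ?D = {..<m}" by auto
  finally have eq: "prob {m<..} = prob {..<m}" by (simp add: emeasure_eq_measure)
  have "prob {m<..} + prob {..<m} = prob ({m<..} \<union> {..<m})"
    by (rule finite_measure_Union[symmetric]) auto
  also have "\<dots> \<le> 1" by (rule prob_le_1)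
  finally have "prob {m<..} \<le> 1 / 2" using eq by simp
  then have "ennreal (prob {m<..}) \<le> ennreal (1 / 2)" by (rule ennreal_leI)
  then show ?thesis unfolding ennreal_one_divide_numeral emeasure_eq_measure .
qed

text \<open>The maximum of the density is at most \<open>1 / e\<close>, since
  \<open>2 * pi * \<sigma>\<^sup>2\<close> exceeds \<open>2 * \<sigma>\<^sup>2\<close>, and the
  interval has length \<open>2 * r * e\<close>.\<close>

lemma normal_small_ball:
  assumes \<sigma>: "\<sigma> > 0" and r: "r \<ge> 0" and e: "e > 0" "e\<^sup>2 \<le> 2 * \<sigma>\<^sup>2"
  shows "emeasure (gauss \<sigma>) {s. \<bar>s\<bar> < r * e} \<le> ennreal (2 * r)"
proof -
  have eq: "{s. \<bar>s\<bar> < r * e} = {- (r * e)<..<r * e}" by auto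
  have "sqrt (2 * pi * \<sigma>\<^sup>2) \<ge> e"
  proof (rule real_le_rsqrt)
    have "2 * \<sigma>\<^sup>2 * 1 \<le> 2 * \<sigma>\<^sup>2 * pi" using pi_gt3 by (intro mult_left_mono) auto
    then show "e\<^sup>2 \<le> 2 * pi * \<sigma>\<^sup>2" using e by (simp add: mult_ac)
  qed
  then have "1 / sqrt (2 * pi * \<sigma>\<^sup>2) \<le> 1 / e" using e by (intro frac_le) auto
  then have bd: "normal_density 0 \<sigma> s \<le> 1 / e" for s
  proof -
    have "normal_density 0 \<sigma> s \<le> 1 / sqrt (2 * pi * \<sigma>\<^sup>2) * 1"
      unfolding normal_density_def by (intro mult_left_mono) auto
    then show ?thesis using \<open>1 / sqrt (2 * pi * \<sigma>\<^sup>2) \<le> 1 / e\<close> by simp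
  qed
  have "emeasure (gauss \<sigma>) {s. \<bar>s\<bar> < r * e} = (\<integral>\<^sup>+ s. ennreal (normal_density 0 \<sigma> s) * indicator {- (r * e)<..<r * e} s \<partial>lborel)"
    unfolding eq by (rule emeasure_density) auto
  also have "\<dots> \<le> (\<integral>\<^sup>+ s. ennreal (1 / e) * indicator {- (r * e)<..<r * e} s \<partial>lborel)"
    using bd by (intro nn_integral_mono mult_right_mono ennreal_leI) auto
  also have "\<dots> = ennreal (1 / e) * emeasure lborel {- (r * e)<..<r * e}"
    by (rule nn_integral_cmult_indicator) auto
  also have "\<dots> = ennreal (1 / e) * ennreal (r * e - - (r * e))"
    using r e by (subst emeasure_lborel_Ioo) (simp_all add: order_trans[of _ 0])
  also have "\<dots> = ennreal (2 * r)"
    using r e by (simp add: ennreal_mult[symmetric])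
  finally show ?thesis .
qed

context gaussian_posterior
begin

lemma AE_seq_likelihood_zero_le:
  "AE x in coef_law. seq_likelihood \<epsilon> (\<lambda>k. 0) x \<le> 1"
  using AE_square_summable
proof eventually_elim
  case (elim x)
  then have "0 \<le> seq_norm_sq x" unfolding seq_norm_sq_def by (intro suminf_nonneg) auto
  then show ?case by (simp add: seq_likelihood_def seq_inner_def)
qed

lemma good_zero: "good (\<lambda>k. 0)"
proof -
  have "evidence (\<lambda>k. 0) \<le> (\<integral>\<^sup>+ x. 1 \<partial>coef_law)"
    unfolding evidence_def using AE_seq_likelihood_zero_le
    by (intro nn_integral_mono_AE) (auto elim: eventually_mono simp: ennreal_le_1)
  also have "\<dots> < \<infinity>" by (simp add: C.emeasure_space_1[simplified])
  finally show ?thesis by (simp add: good_def regular_def)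
qed

text \<open>A shift of the data along \<open>g\<close> multiplies the likelihood by an exponential
  of the single functional \<open>seq_inner (coef g)\<close>; on the law of that functional it acts
  as an exponential tilt.\<close>

lemma seq_likelihood_shift:
  assumes "regular Y" "g \<in> L2_01"
  shows "AE x in coef_law. seq_likelihood \<epsilon> (\<lambda>k. Y k + c * coef g k) x =
    exp (c / \<epsilon>\<^sup>2 * seq_inner (coef g) x) * seq_likelihood \<epsilon> Y x"
proof -
  have "AE x in coef_law. summable (\<lambda>k. Y k * x k) \<and> summable (\<lambda>k. coef g k * x k)"
    using assms(1) regular_coef[OF assms(2)] unfolding regular_def by eventually_elim simp
  then show ?thesis
  proof eventually_elim
    case (elim x)
    then have "(\<lambda>k. Y k * x k + c * (coef g k * x k)) sums (seq_inner Y x + c * seq_inner (coef g) x)"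
      unfolding seq_inner_def by (intro sums_add sums_mult summable_sums) auto
    then have "seq_inner (\<lambda>k. Y k + c * coef g k) x = seq_inner Y x + c * seq_inner (coef g) x"
      unfolding seq_inner_def[of "\<lambda>k. Y k + c * coef g k"] by (simp add: distrib_right mult.assoc sums_iff)
    then show ?case
      unfolding seq_likelihood_def by (simp add: add_divide_distrib flip: exp_add)
  qed
qed

text \<open>The data \<open>0\<close> are a fixed point of
  \<open>(Y, Y') \<mapsto> (Y - Y') / sqrt 2\<close>, which makes the law stable. Its second moment
  is finite because the prior has one and the likelihood at data \<open>0\<close> is at most
  1.\<close>

lemma base_law_gauss:
  assumes g: "g \<in> L2_01"
  shows "\<exists>\<sigma>\<ge>0. distr (post (\<lambda>k. 0)) borel (seq_inner (coef g)) = (if \<sigma> = 0 then return borel 0 else gauss \<sigma>)"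
proof (rule stable_imp_gauss)
  let ?P = "post (\<lambda>k. 0)" and ?S = "seq_inner (coef g)"
  let ?\<nu> = "distr ?P borel ?S"
  have c [measurable]: "(\<lambda>x. coef g) \<in> real_sequences \<rightarrow>\<^sub>M real_sequences" by (rule measurable_const) simp
  have S [measurable]: "?S \<in> borel_measurable real_sequences"
    using seq_inner_measurable[OF c measurable_ident] by simp
  interpret P: prob_space ?P by (rule post_prob_space[OF good_zero])
  interpret \<nu>: real_distribution ?\<nu> by (rule P.real_distribution_distr) measurable
  show "real_distribution ?\<nu>" by (rule \<nu>.real_distribution_axioms)
  have "(\<integral>\<^sup>+ x. ennreal ((?S x)\<^sup>2) \<partial>coef_law) = (\<integral>\<^sup>+ f. ennreal ((?S (coef f))\<^sup>2) \<partial>M)"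
    unfolding coef_law_def by (rule nn_integral_distr) measurable
  also have "\<dots> = (\<integral>\<^sup>+ f. ennreal ((inner01 f g)\<^sup>2) \<partial>M)"
    by (rule nn_integral_cong) (simp add: space_eq seq_inner_coef g inner01_commute)
  also have "\<dots> < \<infinity>"
    using inner_moments(1)[OF g] by (simp add: integrable_iff_bounded)
  finally have fin: "(\<integral>\<^sup>+ x. ennreal ((?S x)\<^sup>2) \<partial>coef_law) < \<infinity>" .
  have "(\<integral>\<^sup>+ x. ennreal ((?S x)\<^sup>2) \<partial>?P) = (\<integral>\<^sup>+ x. ennreal ((?S x)\<^sup>2) * ennreal (seq_likelihood \<epsilon> (\<lambda>k. 0) x) \<partial>coef_law) / evidence (\<lambda>k. 0)"
    by (rule nn_integral_post) measurable
  also have "\<dots> < \<infinity>"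
  proof -
    have "(\<integral>\<^sup>+ x. ennreal ((?S x)\<^sup>2) * ennreal (seq_likelihood \<epsilon> (\<lambda>k. 0) x) \<partial>coef_law) \<le> (\<integral>\<^sup>+ x. ennreal ((?S x)\<^sup>2) \<partial>coef_law)"
    proof (rule nn_integral_mono_AE)
      show "AE x in coef_law. ennreal ((?S x)\<^sup>2) * ennreal (seq_likelihood \<epsilon> (\<lambda>k. 0) x) \<le> ennreal ((?S x)\<^sup>2)"
        using AE_seq_likelihood_zero_le
      proof eventually_elim
        case (elim x)
        then show ?case
          using mult_left_mono[of "ennreal (seq_likelihood \<epsilon> (\<lambda>k. 0) x)" 1 "ennreal ((?S x)\<^sup>2)"] by (simp add: ennreal_le_1)
      qed
    qed
    with fin show ?thesis using evidence_pos[of "\<lambda>k. 0"]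
      by (auto simp: ennreal_divide_eq_top_iff less_top[symmetric] top_unique)
  qed
  finally have "(\<integral>\<^sup>+ x. ennreal ((?S x)\<^sup>2) \<partial>?P) < \<infinity>" .
  then have "integrable ?P (\<lambda>x. (?S x)\<^sup>2)"
    by (intro integrableI_bounded) auto
  then show "integrable ?\<nu> (\<lambda>x. x\<^sup>2)"
    by (subst integrable_distr_eq) auto
  have pd: "?\<nu> \<Otimes>\<^sub>M ?\<nu> = distr (?P \<Otimes>\<^sub>M ?P) (borel \<Otimes>\<^sub>M borel) (\<lambda>(x, y). (?S x, ?S y))"
    by (rule pair_measure_distr) (auto intro: \<nu>.sigma_finite_measure_axioms)
  show "distr (?\<nu> \<Otimes>\<^sub>M ?\<nu>) borel (\<lambda>z. (fst z - snd z) / sqrt 2) = ?\<nu>"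
  proof (rule measure_eqI)
    fix A assume "A \<in> sets (distr (?\<nu> \<Otimes>\<^sub>M ?\<nu>) borel (\<lambda>z. (fst z - snd z) / sqrt 2))"
    then have A [measurable]: "A \<in> sets borel" by simp
    have "emeasure (distr (?\<nu> \<Otimes>\<^sub>M ?\<nu>) borel (\<lambda>z. (fst z - snd z) / sqrt 2)) A =
        (\<integral>\<^sup>+ t. indicator A t \<partial>distr (?\<nu> \<Otimes>\<^sub>M ?\<nu>) borel (\<lambda>z. (fst z - snd z) / sqrt 2))"
      by simp
    also have "\<dots> = (\<integral>\<^sup>+ z. indicator A ((fst z - snd z) / sqrt 2) \<partial>(?\<nu> \<Otimes>\<^sub>M ?\<nu>))"
      by (subst nn_integral_distr) auto
    also have "\<dots> = (\<integral>\<^sup>+ z. indicator A ((?S (fst z) - ?S (snd z)) / sqrt 2) \<partial>(?P \<Otimes>\<^sub>M ?P))"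
      unfolding pd by (subst nn_integral_distr) (auto simp: split_beta')
    also have "\<dots> = (\<integral>\<^sup>+ v. indicator A (sqrt 2 * ?S v / sqrt 2) \<partial>post (\<lambda>k. (0 - 0) / sqrt 2))"
      by (rule post_difference_law(2)[OF good_zero good_zero g, of "\<lambda>t. indicator A (t / sqrt 2)"]) measurable
    also have "\<dots> = (\<integral>\<^sup>+ v. indicator A (?S v) \<partial>?P)" by simp
    also have "\<dots> = (\<integral>\<^sup>+ t. indicator A t \<partial>?\<nu>)"
      by (subst nn_integral_distr) auto
    finally show "emeasure (distr (?\<nu> \<Otimes>\<^sub>M ?\<nu>) borel (\<lambda>z. (fst z - snd z) / sqrt 2)) A = emeasure ?\<nu> A"
      by simp
  qed simp
qed

text \<open>One \<sigma>, that of the data \<open>0\<close>, serves for all shifts \<open>c\<close>: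
  the tilt only moves the mean, to \<open>c / \<epsilon>\<^sup>2 * \<sigma>\<^sup>2\<close>. A
  degenerate law is not moved at all, hence the separate value at
  \<open>\<sigma> = 0\<close>.\<close>

lemma tilted_law:
  assumes g: "g \<in> L2_01"
  obtains \<sigma> where "\<sigma> \<ge> 0" "\<And>c F. good (\<lambda>k. c * coef g k) \<Longrightarrow> F \<in> borel_measurable borel \<Longrightarrow>
    (\<integral>\<^sup>+ x. F (seq_inner (coef g) x) \<partial>post (\<lambda>k. c * coef g k)) =
      (if \<sigma> = 0 then F 0 else (\<integral>\<^sup>+ s. F s \<partial>density lborel (normal_density (c / \<epsilon>\<^sup>2 * \<sigma>\<^sup>2) \<sigma>)))"
proof -
  let ?P = "post (\<lambda>k. 0)" and ?S = "seq_inner (coef g)"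
  have c [measurable]: "(\<lambda>x. coef g) \<in> real_sequences \<rightarrow>\<^sub>M real_sequences" by (rule measurable_const) simp
  have S [measurable]: "?S \<in> borel_measurable real_sequences"
    using seq_inner_measurable[OF c measurable_ident] by simp
  obtain \<sigma> where \<sigma>: "\<sigma> \<ge> 0" and law: "distr ?P borel ?S = (if \<sigma> = 0 then return borel 0 else gauss \<sigma>)"
    using base_law_gauss[OF g] by blast
  show ?thesis
  proof (rule that[OF \<sigma>])
    fix c and F :: "real \<Rightarrow> ennreal"
    assume gd: "good (\<lambda>k. c * coef g k)" and F [measurable]: "F \<in> borel_measurable borel"
    let ?Yc = "\<lambda>k. c * coef g k"
    have key: "\<exists>K. \<forall>G\<in>borel_measurable borel. (\<integral>\<^sup>+ x. G (?S x) \<partial>post ?Yc) =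
        K * (if \<sigma> = 0 then G 0 else (\<integral>\<^sup>+ s. G s \<partial>density lborel (normal_density (c / \<epsilon>\<^sup>2 * \<sigma>\<^sup>2) \<sigma>)))"
    proof (intro exI ballI)
      fix G :: "real \<Rightarrow> ennreal" assume G [measurable]: "G \<in> borel_measurable borel"
      have e0: "(\<integral>\<^sup>+ x. G (?S x) \<partial>post ?Yc) = (\<integral>\<^sup>+ x. G (?S x) * ennreal (seq_likelihood \<epsilon> ?Yc x) \<partial>coef_law) / evidence ?Yc"
        by (rule nn_integral_post) measurable
      have e1: "(\<integral>\<^sup>+ x. G (?S x) * ennreal (seq_likelihood \<epsilon> ?Yc x) \<partial>coef_law) =
          (\<integral>\<^sup>+ x. (G (?S x) * ennreal (exp (c / \<epsilon>\<^sup>2 * ?S x))) * ennreal (seq_likelihood \<epsilon> (\<lambda>k. 0) x) \<partial>coef_law)"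
      proof (rule nn_integral_cong_AE)
        have "regular (\<lambda>k. 0)" using good_zero by (simp add: good_def)
        from seq_likelihood_shift[OF this g, of c]
        show "AE x in coef_law. G (?S x) * ennreal (seq_likelihood \<epsilon> ?Yc x) =
            (G (?S x) * ennreal (exp (c / \<epsilon>\<^sup>2 * ?S x))) * ennreal (seq_likelihood \<epsilon> (\<lambda>k. 0) x)"
          by eventually_elim (simp add: ennreal_mult mult.assoc)
      qed
      have e2: "(\<integral>\<^sup>+ x. (G (?S x) * ennreal (exp (c / \<epsilon>\<^sup>2 * ?S x))) * ennreal (seq_likelihood \<epsilon> (\<lambda>k. 0) x) \<partial>coef_law) = evidence (\<lambda>k. 0) * (\<integral>\<^sup>+ x. G (?S x) * ennreal (exp (c / \<epsilon>\<^sup>2 * ?S x)) \<partial>?P)"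
      proof -
        have "(\<integral>\<^sup>+ x. G (?S x) * ennreal (exp (c / \<epsilon>\<^sup>2 * ?S x)) \<partial>?P) =
          (\<integral>\<^sup>+ x. (G (?S x) * ennreal (exp (c / \<epsilon>\<^sup>2 * ?S x))) * ennreal (seq_likelihood \<epsilon> (\<lambda>k. 0) x) \<partial>coef_law) / evidence (\<lambda>k. 0)"
          by (rule nn_integral_post) measurable
        moreover have "evidence (\<lambda>k. 0) \<noteq> 0" "evidence (\<lambda>k. 0) \<noteq> top"
          using good_zero evidence_pos[of "\<lambda>k. 0"] by (auto simp: good_def)
        ultimately show ?thesis
          by (simp add: ennreal_mult_divide_cancel)
      qed
      have e3: "(\<integral>\<^sup>+ x. G (?S x) * ennreal (exp (c / \<epsilon>\<^sup>2 * ?S x)) \<partial>?P) = (\<integral>\<^sup>+ s. G s * ennreal (exp (c / \<epsilon>\<^sup>2 * s)) \<partial>distr ?P borel ?S)"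
      proof -
        have "?S \<in> ?P \<rightarrow>\<^sub>M borel" using S measurable_cong_sets[OF sets_post refl] by blast
        moreover have "(\<lambda>s. G s * ennreal (exp (c / \<epsilon>\<^sup>2 * s))) \<in> borel_measurable (distr ?P borel ?S)"
          unfolding measurable_distr_eq1 by measurable
        ultimately show ?thesis by (rule nn_integral_distr[symmetric])
      qed
      have e4: "(\<integral>\<^sup>+ s. G s * ennreal (exp (c / \<epsilon>\<^sup>2 * s)) \<partial>distr ?P borel ?S) = ennreal (exp ((c / \<epsilon>\<^sup>2)\<^sup>2 * \<sigma>\<^sup>2 / 2)) *
          (if \<sigma> = 0 then G 0 else (\<integral>\<^sup>+ s. G s \<partial>density lborel (normal_density (c / \<epsilon>\<^sup>2 * \<sigma>\<^sup>2) \<sigma>)))"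
        unfolding law using \<sigma> nn_integral_gauss_tilt[of \<sigma> G "c / \<epsilon>\<^sup>2"]
        by (auto simp: nn_integral_return)
      show "(\<integral>\<^sup>+ x. G (?S x) \<partial>post ?Yc) = (evidence (\<lambda>k. 0) * ennreal (exp ((c / \<epsilon>\<^sup>2)\<^sup>2 * \<sigma>\<^sup>2 / 2)) / evidence ?Yc) *
          (if \<sigma> = 0 then G 0 else (\<integral>\<^sup>+ s. G s \<partial>density lborel (normal_density (c / \<epsilon>\<^sup>2 * \<sigma>\<^sup>2) \<sigma>)))"
        unfolding e0 e1 e2 e3 e4 divide_ennreal_def by (simp only: mult_ac)
    qed
    then obtain K where K: "\<And>G. G \<in> borel_measurable borel \<Longrightarrow> (\<integral>\<^sup>+ x. G (?S x) \<partial>post ?Yc) =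
        K * (if \<sigma> = 0 then G 0 else (\<integral>\<^sup>+ s. G s \<partial>density lborel (normal_density (c / \<epsilon>\<^sup>2 * \<sigma>\<^sup>2) \<sigma>)))" by blast
    \<comment> \<open>The normalising factors do not depend on the test function, so the constant
      function 1 determines their product and they need not be computed.\<close>
    have "K = 1"
    proof -
      have "(\<integral>\<^sup>+ x. 1 \<partial>post ?Yc) = 1"
        using prob_space.emeasure_space_1[OF post_prob_space[OF gd]] by simp
      moreover have "(\<integral>\<^sup>+ s. 1 \<partial>density lborel (normal_density (c / \<epsilon>\<^sup>2 * \<sigma>\<^sup>2) \<sigma>)) = 1" if "\<sigma> \<noteq> 0"
        using prob_space.emeasure_space_1[OF prob_space_normal_density[of \<sigma> "c / \<epsilon>\<^sup>2 * \<sigma>\<^sup>2"]] that \<sigma> by simp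
      ultimately show ?thesis using K[of "\<lambda>_. 1"] by (cases "\<sigma> = 0") simp_all
    qed
    then show "(\<integral>\<^sup>+ x. F (?S x) \<partial>post ?Yc) =
        (if \<sigma> = 0 then F 0 else (\<integral>\<^sup>+ s. F s \<partial>density lborel (normal_density (c / \<epsilon>\<^sup>2 * \<sigma>\<^sup>2) \<sigma>)))"
      using K[OF F] by simp
  qed
qed

text \<open>If the posteriors for data shifted by \<open>a g\<close> concentrate at \<open>a g\<close> and at \<open>0\<close>, the difference of
  two independent posterior draws has median at least \<open>a / 2\<close>; as its mean is proportional to the
  variance \<open>\<sigma>\<^sup>2\<close> in direction \<open>g\<close>, that variance is at least of order \<open>\<epsilon>\<^sup>2\<close>. The spread does not depend
  on the data, which gives the conclusion for every good \<open>Y\<^sub>0\<close>.\<close>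

theorem posterior_small_ball:
  assumes g: "g \<in> L2_01" and a: "a > 0" "d \<le> a / 4"
    and Y: "good Y" "good (\<lambda>k. Y k + a * coef g k)"
    and c1: "emeasure (post (\<lambda>k. Y k + a * coef g k)) {x. d \<le> \<bar>seq_inner (coef g) x - a\<bar>} \<le> 1 / 8"
    and c0: "emeasure (post Y) {x. d \<le> \<bar>seq_inner (coef g) x\<bar>} \<le> 1 / 8"
    and Y0: "good Y\<^sub>0"
  shows "emeasure (post Y\<^sub>0) {x. \<bar>seq_inner (coef g) x\<bar> < \<epsilon> / 64} \<le> 1 / 4"
proof -
  let ?Y1 = "\<lambda>k. Y k + a * coef g k" and ?S = "seq_inner (coef g)"
  have c [measurable]: "(\<lambda>x. coef g) \<in> real_sequences \<rightarrow>\<^sub>M real_sequences" by (rule measurable_const) simp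
  have S [measurable]: "?S \<in> borel_measurable real_sequences"
    using seq_inner_measurable[OF c measurable_ident] by simp
  interpret P1: prob_space "post ?Y1" by (rule post_prob_space[OF Y(2)])
  interpret P0: prob_space "post Y" by (rule post_prob_space[OF Y(1)])
  interpret Q: prob_space "post Y\<^sub>0" by (rule post_prob_space[OF Y0])
  interpret PP: pair_prob_space "post ?Y1" "post Y" ..
  obtain \<sigma> where \<sigma>: "\<sigma> \<ge> 0" and law: "\<And>c F. good (\<lambda>k. c * coef g k) \<Longrightarrow> F \<in> borel_measurable borel \<Longrightarrow>
    (\<integral>\<^sup>+ x. F (?S x) \<partial>post (\<lambda>k. c * coef g k)) =
      (if \<sigma> = 0 then F 0 else (\<integral>\<^sup>+ s. F s \<partial>density lborel (normal_density (c / \<epsilon>\<^sup>2 * \<sigma>\<^sup>2) \<sigma>)))"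
    using tilted_law[OF g] by metis
  let ?h = "\<lambda>t. indicator {a / 2<..} t :: ennreal"
  have dif: "(\<lambda>k. (?Y1 k - Y k) / sqrt 2) = (\<lambda>k. a / sqrt 2 * coef g k)" by (rule ext) simp
  have gd: "good (\<lambda>k. a / sqrt 2 * coef g k)"
    using post_difference_law(1)[OF Y(2,1) g, of "\<lambda>_. 0"] unfolding dif by simp
  have dl: "(\<integral>\<^sup>+ z. ?h (?S (fst z) - ?S (snd z)) \<partial>(post ?Y1 \<Otimes>\<^sub>M post Y)) =
      (if \<sigma> = 0 then ?h 0 else (\<integral>\<^sup>+ s. ?h (sqrt 2 * s) \<partial>density lborel (normal_density (a / sqrt 2 / \<epsilon>\<^sup>2 * \<sigma>\<^sup>2) \<sigma>)))"
    using post_difference_law(2)[OF Y(2,1) g, of ?h] law[OF gd, of "\<lambda>s. ?h (sqrt 2 * s)"] unfolding dif by simp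
  have A1: "{x. d \<le> \<bar>?S x - a\<bar>} \<in> sets (post ?Y1)" and A0: "{x. d \<le> \<bar>?S x\<bar>} \<in> sets (post Y)"
  proof -
    have "{x \<in> space real_sequences. d \<le> \<bar>?S x - a\<bar>} \<in> sets real_sequences" "{x \<in> space real_sequences. d \<le> \<bar>?S x\<bar>} \<in> sets real_sequences"
      by measurable
    then show "{x. d \<le> \<bar>?S x - a\<bar>} \<in> sets (post ?Y1)" "{x. d \<le> \<bar>?S x\<bar>} \<in> sets (post Y)" by (simp_all add: sets_post)
  qed
  \<comment> \<open>A union bound: unless one of the two draws is off by \<open>d\<close> or more,
    the difference exceeds \<open>a - 2 * d\<close>, which is at least \<open>a / 2\<close>.\<close>
  have low: "1 \<le> (\<integral>\<^sup>+ z. ?h (?S (fst z) - ?S (snd z)) \<partial>(post ?Y1 \<Otimes>\<^sub>M post Y)) + (1 / 8 + 1 / 8)"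
  proof -
    have "1 = (\<integral>\<^sup>+ z. 1 \<partial>(post ?Y1 \<Otimes>\<^sub>M post Y))" by (simp add: PP.P.emeasure_space_1)
    also have "\<dots> \<le> (\<integral>\<^sup>+ z. ?h (?S (fst z) - ?S (snd z)) +
        (indicator ({x. d \<le> \<bar>?S x - a\<bar>} \<times> UNIV) z + indicator (UNIV \<times> {x. d \<le> \<bar>?S x\<bar>}) z) \<partial>(post ?Y1 \<Otimes>\<^sub>M post Y))"
    proof (rule nn_integral_mono)
      fix z
      show "1 \<le> ?h (?S (fst z) - ?S (snd z)) +
        (indicator ({x. d \<le> \<bar>?S x - a\<bar>} \<times> UNIV) z + indicator (UNIV \<times> {x. d \<le> \<bar>?S x\<bar>}) z)"
      proof (cases "d \<le> \<bar>?S (fst z) - a\<bar> \<or> d \<le> \<bar>?S (snd z)\<bar>")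
        case True
        then show ?thesis by (cases z) (auto simp: indicator_def)
      next
        case False
        then have "a / 2 < ?S (fst z) - ?S (snd z)" using a by linarith
        then show ?thesis by simp
      qed
    qed
    also have "\<dots> = (\<integral>\<^sup>+ z. ?h (?S (fst z) - ?S (snd z)) \<partial>(post ?Y1 \<Otimes>\<^sub>M post Y)) +
        (emeasure (post ?Y1 \<Otimes>\<^sub>M post Y) ({x. d \<le> \<bar>?S x - a\<bar>} \<times> UNIV) + emeasure (post ?Y1 \<Otimes>\<^sub>M post Y) (UNIV \<times> {x. d \<le> \<bar>?S x\<bar>}))"
    proof -
      have U: "UNIV \<in> sets (post ?Y1)" "UNIV \<in> sets (post Y)"
        using sets.top[of "post ?Y1"] sets.top[of "post Y"] by simp_all
      have "{x. d \<le> \<bar>?S x - a\<bar>} \<times> UNIV \<in> sets (post ?Y1 \<Otimes>\<^sub>M post Y)" "UNIV \<times> {x. d \<le> \<bar>?S x\<bar>} \<in> sets (post ?Y1 \<Otimes>\<^sub>M post Y)"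
        using pair_measureI[OF A1 U(2)] pair_measureI[OF U(1) A0] by auto
      then show ?thesis
        by (subst nn_integral_add; (subst nn_integral_add)?; simp)
    qed
    also have "emeasure (post ?Y1 \<Otimes>\<^sub>M post Y) ({x. d \<le> \<bar>?S x - a\<bar>} \<times> UNIV) = emeasure (post ?Y1) {x. d \<le> \<bar>?S x - a\<bar>}"
      using P0.emeasure_pair_measure_Times[OF A1 sets.top[of "post Y"]] P0.emeasure_space_1 by simp
    also have "emeasure (post ?Y1 \<Otimes>\<^sub>M post Y) (UNIV \<times> {x. d \<le> \<bar>?S x\<bar>}) = emeasure (post Y) {x. d \<le> \<bar>?S x\<bar>}"
      using P0.emeasure_pair_measure_Times[OF sets.top[of "post ?Y1"] A0] P1.emeasure_space_1 by simp
    finally show ?thesis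
      using c1 c0 by (meson add_left_mono add_mono order_trans)
  qed
  have quarter: "(1 / 8 + 1 / 8 :: ennreal) = ennreal (1 / 4)" "(1 / 2 :: ennreal) = ennreal (1 / 2)"
    unfolding ennreal_one_divide_numeral by (simp_all flip: ennreal_plus)
  \<comment> \<open>Otherwise \<open>sqrt 2\<close> times the tilted variable has mean at most
    \<open>a / 2\<close>, or is identically 0. It then exceeds \<open>a / 2\<close> with probability
    at most 1/2, and 1/2 + 1/8 + 1/8 falls short of 1.\<close>
  have big: "\<sigma> > 0 \<and> \<epsilon>\<^sup>2 \<le> 2 * \<sigma>\<^sup>2"
  proof (rule ccontr)
    assume neg: "\<not> (\<sigma> > 0 \<and> \<epsilon>\<^sup>2 \<le> 2 * \<sigma>\<^sup>2)"
    have "(\<integral>\<^sup>+ z. ?h (?S (fst z) - ?S (snd z)) \<partial>(post ?Y1 \<Otimes>\<^sub>M post Y)) \<le> 1 / 2"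
    proof (cases "\<sigma> = 0")
      case True
      then show ?thesis unfolding dl using a by simp
    next
      case False
      then have pos: "\<sigma> > 0" using \<sigma> by simp
      let ?m = "a / sqrt 2 / \<epsilon>\<^sup>2 * \<sigma>\<^sup>2"
      have "2 * \<sigma>\<^sup>2 < \<epsilon>\<^sup>2" using neg pos by simp
      then have "\<sigma>\<^sup>2 / \<epsilon>\<^sup>2 \<le> 1 / 2" using eps by (simp add: field_simps)
      then have "a / sqrt 2 * (\<sigma>\<^sup>2 / \<epsilon>\<^sup>2) \<le> a / sqrt 2 * (1 / 2)" using a by (intro mult_left_mono) auto
      then have m: "?m \<le> a / (2 * sqrt 2)" by (simp add: field_simps)
      have "(\<integral>\<^sup>+ s. ?h (sqrt 2 * s) \<partial>density lborel (normal_density ?m \<sigma>)) \<le>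
          (\<integral>\<^sup>+ s. indicator {?m<..} s \<partial>density lborel (normal_density ?m \<sigma>))"
      proof (rule nn_integral_mono)
        fix s
        have "?m < s" if "a / 2 < sqrt 2 * s"
        proof -
          have "a / (2 * sqrt 2) < s" using that by (simp add: field_simps)
          then show ?thesis using m by linarith
        qed
        then show "?h (sqrt 2 * s) \<le> indicator {?m<..} s" by (auto simp: indicator_def)
      qed
      also have "\<dots> \<le> 1 / 2" using normal_upper_half[OF pos] by simp
      finally show ?thesis unfolding dl using False by simp
    qed
    with low have "1 \<le> (1 / 2 :: ennreal) + (1 / 8 + 1 / 8)" by (meson add_right_mono order_trans)
    moreover have "ennreal (1 / 2) + ennreal (1 / 4) = ennreal (3 / 4)"
      by (subst ennreal_plus[symmetric]) (simp, simp, rule arg_cong[where f=ennreal], simp)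
    ultimately have "ennreal 1 \<le> ennreal (3 / 4)"
      unfolding quarter ennreal_1 by (simp only:)
    then show False by (subst (asm) ennreal_le_iff) simp_all
  qed
  let ?k = "\<lambda>t. indicator {t. \<bar>t\<bar> < \<epsilon> / 32} t :: ennreal"
  have dif0: "(\<lambda>k. (Y\<^sub>0 k - Y\<^sub>0 k) / sqrt 2) = (\<lambda>k. 0 * coef g k)" by simp
  have A: "{x. \<bar>?S x\<bar> < \<epsilon> / 64} \<in> sets (post Y\<^sub>0)"
  proof -
    have "{x \<in> space real_sequences. \<bar>?S x\<bar> < \<epsilon> / 64} \<in> sets real_sequences" by measurable
    then show ?thesis by (simp add: sets_post)
  qed
  have [measurable]: "{t::real. \<bar>t\<bar> < \<epsilon> / 32} \<in> sets borel" by measurable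
  \<comment> \<open>Two independent draws for the same data have a difference governed by the
    posterior at \<open>0\<close>, whatever \<open>Y\<^sub>0\<close> is. If both draws are within
    \<open>\<epsilon> / 64\<close> of 0, they differ by less than \<open>\<epsilon> / 32\<close>, an
    event of probability at most 2/32; the bound 1/4 is the square root.\<close>
  have "emeasure (post Y\<^sub>0) {x. \<bar>?S x\<bar> < \<epsilon> / 64} * emeasure (post Y\<^sub>0) {x. \<bar>?S x\<bar> < \<epsilon> / 64} =
      emeasure (post Y\<^sub>0 \<Otimes>\<^sub>M post Y\<^sub>0) ({x. \<bar>?S x\<bar> < \<epsilon> / 64} \<times> {x. \<bar>?S x\<bar> < \<epsilon> / 64})"
    by (rule Q.emeasure_pair_measure_Times[OF A A, symmetric])
  also have "\<dots> = (\<integral>\<^sup>+ z. indicator ({x. \<bar>?S x\<bar> < \<epsilon> / 64} \<times> {x. \<bar>?S x\<bar> < \<epsilon> / 64}) z \<partial>(post Y\<^sub>0 \<Otimes>\<^sub>M post Y\<^sub>0))"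
    using A by simp
  also have "\<dots> \<le> (\<integral>\<^sup>+ z. ?k (?S (fst z) - ?S (snd z)) \<partial>(post Y\<^sub>0 \<Otimes>\<^sub>M post Y\<^sub>0))"
  proof (rule nn_integral_mono)
    fix z
    have "\<bar>?S (fst z) - ?S (snd z)\<bar> < \<epsilon> / 32"
      if "\<bar>?S (fst z)\<bar> < \<epsilon> / 64" "\<bar>?S (snd z)\<bar> < \<epsilon> / 64"
      using that by linarith
    then show "indicator ({x. \<bar>?S x\<bar> < \<epsilon> / 64} \<times> {x. \<bar>?S x\<bar> < \<epsilon> / 64}) z \<le> ?k (?S (fst z) - ?S (snd z))"
      unfolding indicator_def by (simp add: mem_Times_iff)
  qed
  also have "\<dots> = (\<integral>\<^sup>+ v. ?k (sqrt 2 * ?S v) \<partial>post (\<lambda>k. 0 * coef g k))"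
    using post_difference_law(2)[OF Y0 Y0 g, of ?k] unfolding dif0 by simp
  also have "\<dots> = (\<integral>\<^sup>+ s. ?k (sqrt 2 * s) \<partial>gauss \<sigma>)"
    using law[of 0 "\<lambda>s. ?k (sqrt 2 * s)"] good_zero big by simp
  also have "\<dots> \<le> (\<integral>\<^sup>+ s. indicator {s. \<bar>s\<bar> < 1 / 32 * \<epsilon>} s \<partial>gauss \<sigma>)"
  proof (rule nn_integral_mono)
    fix s :: real
    have "1 * \<bar>s\<bar> \<le> sqrt 2 * \<bar>s\<bar>" by (intro mult_right_mono) auto
    then show "?k (sqrt 2 * s) \<le> indicator {s. \<bar>s\<bar> < 1 / 32 * \<epsilon>} s"
      by (auto simp: indicator_def abs_mult)
  qed
  also have "\<dots> = emeasure (gauss \<sigma>) {s. \<bar>s\<bar> < 1 / 32 * \<epsilon>}" by (rule nn_integral_indicator) simp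
  also have "\<dots> \<le> ennreal (2 * (1 / 32))" using big eps by (intro normal_small_ball) auto
  finally have sq: "emeasure (post Y\<^sub>0) {x. \<bar>?S x\<bar> < \<epsilon> / 64} * emeasure (post Y\<^sub>0) {x. \<bar>?S x\<bar> < \<epsilon> / 64} \<le> ennreal (1 / 16)" by simp
  define p where "p = measure (post Y\<^sub>0) {x. \<bar>?S x\<bar> < \<epsilon> / 64}"
  have p: "p \<ge> 0" "emeasure (post Y\<^sub>0) {x. \<bar>?S x\<bar> < \<epsilon> / 64} = ennreal p"
    by (simp_all add: p_def Q.emeasure_eq_measure)
  have "p * p \<le> 1 / 16" using sq p by (simp add: ennreal_mult[symmetric])
  then have "p\<^sup>2 \<le> (1 / 4)\<^sup>2" by (simp add: power2_eq_square)
  then have "p \<le> 1 / 4" by (rule power2_le_imp_le) simp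
  then have "ennreal p \<le> ennreal (1 / 4)" by (rule ennreal_leI)
  then show ?thesis unfolding p ennreal_one_divide_numeral .
qed

end

section \<open>From data probabilities to individual good samples\<close>

lemma measure_data_law:
  assumes eps: "\<epsilon> > 0" and P: "{Y. P Y} \<in> sets real_sequences"
  shows "measure (data_law \<epsilon> f) {Y. P Y} = measure (noise \<epsilon>) {Y. P (\<lambda>k. Y k + coef f k)}"
    and "{Y. P (\<lambda>k. Y k + coef f k)} \<in> sets (noise \<epsilon>)"
proof -
  have T: "(\<lambda>Y k. Y k + coef f k) \<in> noise \<epsilon> \<rightarrow>\<^sub>M real_sequences"
    by (rule measurable_PiM_single') (auto simp: sets_noise cong: measurable_cong_sets)
  have eq: "(\<lambda>Y k. Y k + coef f k) -` {Y. P Y} \<inter> space (noise \<epsilon>) = {Y. P (\<lambda>k. Y k + coef f k)}" by auto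
  show "measure (data_law \<epsilon> f) {Y. P Y} = measure (noise \<epsilon>) {Y. P (\<lambda>k. Y k + coef f k)}"
    unfolding data_law_eq_distr_noise[OF eps] by (subst measure_distr[OF T P]) (simp only: eq)
  show "{Y. P (\<lambda>k. Y k + coef f k)} \<in> sets (noise \<epsilon>)"
    using measurable_sets[OF T P] unfolding eq .
qed

context gaussian_posterior
begin

lemma seq_inner_left_measurable: "seq_inner b \<in> borel_measurable real_sequences"
proof -
  have c: "(\<lambda>x. b) \<in> real_sequences \<rightarrow>\<^sub>M real_sequences" by (rule measurable_const) simp
  show ?thesis using seq_inner_measurable[OF c measurable_ident] by simp
qed

text \<open>For each square summable parameter the series converges for almost every noise sequence.
  Fubini exchanges the two quantifiers, given joint measurability of the set of convergence.\<close>

lemma AE_noise_regular: "AE Y in noise \<epsilon>. regular Y"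
proof -
  interpret N: prob_space "noise \<epsilon>" using eps by (rule noise_prob_space)
  interpret NC: pair_prob_space "noise \<epsilon>" coef_law ..
  have s: "{z \<in> space (noise \<epsilon> \<Otimes>\<^sub>M coef_law). summable (\<lambda>k. fst z k * snd z k)} \<in> sets (noise \<epsilon> \<Otimes>\<^sub>M coef_law)"
    using sets_Collect_seq_summable
    unfolding sets_pair_measure_cong[OF sets_noise sets_coef_law]
      sets_eq_imp_space_eq[OF sets_pair_measure_cong[OF sets_noise sets_coef_law]] .
  have "AE x in coef_law. AE Y in noise \<epsilon>. summable (\<lambda>k. Y k * x k)"
    using AE_square_summable by (rule eventually_mono) (rule noise_AE_summable[OF eps])
  then show ?thesis
    unfolding regular_def using NC.AE_commute[OF s] by simp
qed

text \<open>Under pure noise the exponential moment of the linear term is cancelled exactly by the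
  quadratic term of the likelihood.\<close>

lemma nn_integral_noise_likelihood_le:
  assumes "summable (\<lambda>k. (x k)\<^sup>2)"
  shows "(\<integral>\<^sup>+ Y. ennreal (seq_likelihood \<epsilon> Y x) \<partial>noise \<epsilon>) \<le> 1"
proof -
  have sq: "(\<lambda>k. (x k / \<epsilon>\<^sup>2)\<^sup>2) sums (seq_norm_sq x / \<epsilon> ^ 4)"
    using sums_divide[OF summable_sums[OF assms], of "\<epsilon> ^ 4"]
    by (simp add: seq_norm_sq_def power_divide power_mult[symmetric])
  let ?c = "exp (- seq_norm_sq x / (2 * \<epsilon>\<^sup>2))"
  have [measurable]: "(\<lambda>Y. seq_inner Y (\<lambda>k. x k / \<epsilon>\<^sup>2)) \<in> borel_measurable (noise \<epsilon>)"
    unfolding seq_inner_def by (measurable; simp add: sets_noise cong: measurable_cong_sets)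
  have "(\<integral>\<^sup>+ Y. ennreal (seq_likelihood \<epsilon> Y x) \<partial>noise \<epsilon>) =
      (\<integral>\<^sup>+ Y. ennreal ?c * ennreal (exp (seq_inner Y (\<lambda>k. x k / \<epsilon>\<^sup>2))) \<partial>noise \<epsilon>)"
  proof (rule nn_integral_cong_AE)
    show "AE Y in noise \<epsilon>. ennreal (seq_likelihood \<epsilon> Y x) = ennreal ?c * ennreal (exp (seq_inner Y (\<lambda>k. x k / \<epsilon>\<^sup>2)))"
      using noise_AE_summable[OF eps assms]
    proof eventually_elim
      case (elim Y)
      have "seq_inner Y (\<lambda>k. x k / \<epsilon>\<^sup>2) = seq_inner Y x / \<epsilon>\<^sup>2"
        unfolding seq_inner_def using suminf_divide[OF elim, of "\<epsilon>\<^sup>2"] by simp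
      then show ?case
        unfolding seq_likelihood_def by (simp add: ennreal_mult[symmetric] flip: exp_add)
    qed
  qed
  also have "\<dots> = ennreal ?c * (\<integral>\<^sup>+ Y. ennreal (exp (seq_inner Y (\<lambda>k. x k / \<epsilon>\<^sup>2))) \<partial>noise \<epsilon>)"
    by (rule nn_integral_cmult) measurable
  also have "\<dots> \<le> ennreal ?c * ennreal (exp (\<epsilon>\<^sup>2 * (seq_norm_sq x / \<epsilon> ^ 4) / 2))"
    using nn_integral_noise_exp_le[OF eps sums_summable[OF sq]] sums_unique[OF sq]
    unfolding seq_inner_def by (intro mult_left_mono) auto
  also have "\<dots> = 1"
  proof -
    have "- seq_norm_sq x / (2 * \<epsilon>\<^sup>2) + \<epsilon>\<^sup>2 * (seq_norm_sq x / \<epsilon> ^ 4) / 2 = 0"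
      using eps by (simp add: field_simps power_def numeral_eq_Suc)
    then show ?thesis
      by (simp add: ennreal_mult[symmetric] flip: exp_add)
  qed
  finally show ?thesis .
qed

text \<open>By Fubini the evidence for the shifted data has finite expectation over the noise: the
  noise average of the likelihood is at most 1, and an exponential moment of the prior in the
  direction \<open>g\<close> remains.\<close>

lemma AE_good_shift:
  assumes g: "g \<in> L2_01"
  shows "AE Y in noise \<epsilon>. good (\<lambda>k. Y k + a * coef g k)"
proof -
  interpret N: prob_space "noise \<epsilon>" using eps by (rule noise_prob_space)
  interpret NC: pair_prob_space "noise \<epsilon>" coef_law ..
  let ?S = "seq_inner (coef g)"
  note S [measurable] = seq_inner_left_measurable[of "coef g"]
  let ?F = "\<lambda>z. ennreal (exp (a / \<epsilon>\<^sup>2 * ?S (snd z))) * ennreal (seq_likelihood \<epsilon> (fst z) (snd z))"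
  let ?W = "\<lambda>Y. (\<integral>\<^sup>+ x. ?F (Y, x) \<partial>coef_law)"
  have F: "?F \<in> borel_measurable (real_sequences \<Otimes>\<^sub>M real_sequences)" by measurable
  then have F' [measurable]: "?F \<in> borel_measurable (noise \<epsilon> \<Otimes>\<^sub>M coef_law)"
    using measurable_cong_sets[OF sets_pair_measure_cong[OF sets_noise sets_coef_law] refl] by blast
  have "(\<integral>\<^sup>+ Y. ?W Y \<partial>noise \<epsilon>) = (\<integral>\<^sup>+ x. \<integral>\<^sup>+ Y. ?F (Y, x) \<partial>noise \<epsilon> \<partial>coef_law)"
    by (rule NC.Fubini[OF F', symmetric])
  also have "\<dots> \<le> (\<integral>\<^sup>+ x. ennreal (exp (a / \<epsilon>\<^sup>2 * ?S x)) \<partial>coef_law)"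
  proof (rule nn_integral_mono_AE)
    show "AE x in coef_law. (\<integral>\<^sup>+ Y. ?F (Y, x) \<partial>noise \<epsilon>) \<le> ennreal (exp (a / \<epsilon>\<^sup>2 * ?S x))"
      using AE_square_summable
    proof eventually_elim
      case (elim x)
      have [measurable]: "(\<lambda>Y. seq_likelihood \<epsilon> Y x) \<in> borel_measurable (noise \<epsilon>)"
      proof -
        have "(\<lambda>Y. x) \<in> noise \<epsilon> \<rightarrow>\<^sub>M real_sequences" by (rule measurable_const) simp
        moreover have "(\<lambda>Y. Y) \<in> noise \<epsilon> \<rightarrow>\<^sub>M real_sequences" by (simp add: sets_noise cong: measurable_cong_sets)
        ultimately show ?thesis by (intro seq_likelihood_measurable)
      qed
      have "(\<integral>\<^sup>+ Y. ?F (Y, x) \<partial>noise \<epsilon>) = ennreal (exp (a / \<epsilon>\<^sup>2 * ?S x)) * (\<integral>\<^sup>+ Y. ennreal (seq_likelihood \<epsilon> Y x) \<partial>noise \<epsilon>)"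
        by (simp only: fst_conv snd_conv) (rule nn_integral_cmult, measurable)
      also have "\<dots> \<le> ennreal (exp (a / \<epsilon>\<^sup>2 * ?S x)) * 1"
        using nn_integral_noise_likelihood_le[OF elim] by (rule mult_left_mono) simp
      finally show ?case by simp
    qed
  qed
  also have "\<dots> = (\<integral>\<^sup>+ f. ennreal (exp (a / \<epsilon>\<^sup>2 * ?S (coef f))) \<partial>M)"
    unfolding coef_law_def by (rule nn_integral_distr) measurable
  also have "\<dots> = (\<integral>\<^sup>+ f. ennreal (exp (a / \<epsilon>\<^sup>2 * inner01 f g)) \<partial>M)"
    by (rule nn_integral_cong) (simp add: space_eq seq_inner_coef g inner01_commute)
  also have "\<dots> < \<infinity>" by (rule inner_moments(4)[OF g])
  finally have "(\<integral>\<^sup>+ Y. ?W Y \<partial>noise \<epsilon>) \<noteq> \<infinity>" by simp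
  moreover have "?W \<in> borel_measurable (noise \<epsilon>)" by (rule C.borel_measurable_nn_integral_fst[OF F'])
  ultimately have "AE Y in noise \<epsilon>. ?W Y \<noteq> \<infinity>" by (rule nn_integral_PInf_AE[rotated])
  then show ?thesis
    using AE_noise_regular
  proof eventually_elim
    case (elim Y)
    have "evidence (\<lambda>k. Y k + a * coef g k) = ?W Y"
      unfolding evidence_def
    proof (rule nn_integral_cong_AE)
      show "AE x in coef_law. ennreal (seq_likelihood \<epsilon> (\<lambda>k. Y k + a * coef g k) x) = ?F (Y, x)"
        using seq_likelihood_shift[OF elim(2) g, of a] by eventually_elim (simp add: ennreal_mult)
    qed
    moreover have "regular (\<lambda>k. Y k + a * coef g k)"
      using regular_linear[OF elim(2) regular_coef[OF g], of 1 a] by simp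
    ultimately show ?case using elim(1) by (simp add: good_def less_top)
  qed
qed

lemma posterior_numerator:
  assumes B: "B \<in> sets real_sequences" and AB: "\<And>f. f \<in> L2_01 \<Longrightarrow> f \<in> A \<longleftrightarrow> coef f \<in> B"
  shows "(LINT f|M. indicator A f * likelihood \<epsilon> Y f) = (LINT x|coef_law. indicator B x * seq_likelihood \<epsilon> Y x)"
proof -
  have Y: "(\<lambda>x. Y) \<in> real_sequences \<rightarrow>\<^sub>M real_sequences" by (rule measurable_const) simp
  have [measurable]: "seq_likelihood \<epsilon> Y \<in> borel_measurable real_sequences"
    using seq_likelihood_measurable[OF Y measurable_ident] by simp
  have "(LINT x|coef_law. indicator B x * seq_likelihood \<epsilon> Y x) =
      (LINT f|M. indicator B (coef f) * seq_likelihood \<epsilon> Y (coef f))"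
    unfolding coef_law_def using B by (subst integral_distr) auto
  also have "\<dots> = (LINT f|M. indicator A f * likelihood \<epsilon> Y f)"
    by (rule Bochner_Integration.integral_cong) (auto simp: space_eq indicator_def AB seq_likelihood_coef)
  finally show ?thesis ..
qed

text \<open>A Bochner integral defaults to 0 when its integrand is not integrable. Finite evidence
  excludes this for the numerator and the denominator of \<open>posterior\<close>.\<close>

lemma posterior_eq_measure_post:
  assumes gd: "good Y" and B: "B \<in> sets real_sequences" and AB: "\<And>f. f \<in> L2_01 \<Longrightarrow> f \<in> A \<longleftrightarrow> coef f \<in> B"
  shows "posterior \<epsilon> M Y A = measure (post Y) B"
proof -
  have Y: "(\<lambda>x. Y) \<in> real_sequences \<rightarrow>\<^sub>M real_sequences" by (rule measurable_const) simp
  have [measurable]: "seq_likelihood \<epsilon> Y \<in> borel_measurable real_sequences"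
    using seq_likelihood_measurable[OF Y measurable_ident] by simp
  have num0: "(LINT f|M. indicator A f * likelihood \<epsilon> Y f) = (LINT x|coef_law. indicator B x * seq_likelihood \<epsilon> Y x)"
    by (rule posterior_numerator[OF B]) (rule AB)
  have num: "(LINT f|M. indicator A f * likelihood \<epsilon> Y f) = enn2real (\<integral>\<^sup>+ x. indicator B x * ennreal (seq_likelihood \<epsilon> Y x) \<partial>coef_law)"
    unfolding num0 using B
    by (subst integral_eq_nn_integral) (auto simp: ennreal_mult' ennreal_indicator intro!: arg_cong[where f=enn2real] nn_integral_cong split: split_indicator)
  have den: "(LINT f|M. likelihood \<epsilon> Y f) = enn2real (evidence Y)"
    using posterior_numerator[of UNIV UNIV Y]
    by (simp add: integral_eq_nn_integral evidence_def sets.top[of real_sequences, simplified])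
  have em: "emeasure (post Y) B = (\<integral>\<^sup>+ x. indicator B x * ennreal (seq_likelihood \<epsilon> Y x) \<partial>coef_law) / evidence Y"
    using nn_integral_post[of "indicator B" Y] B by (simp add: sets_post)
  have "(\<integral>\<^sup>+ x. indicator B x * ennreal (seq_likelihood \<epsilon> Y x) \<partial>coef_law) \<le> evidence Y"
    unfolding evidence_def by (rule nn_integral_mono) (auto simp: indicator_def)
  also have "\<dots> < top" using gd by (simp add: good_def)
  finally obtain r where r: "(\<integral>\<^sup>+ x. indicator B x * ennreal (seq_likelihood \<epsilon> Y x) \<partial>coef_law) = ennreal r" "0 \<le> r"
    using less_top_ennreal by blast
  obtain z where z: "evidence Y = ennreal z" "0 \<le> z"
    using gd less_top_ennreal unfolding good_def by auto
  then have "z > 0" using evidence_pos[of Y] by (simp add: ennreal_less_zero_iff)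
  then show ?thesis
    unfolding posterior_def num den measure_def em r(1) z(1) using r(2) z(2) by (simp add: divide_ennreal)
qed

text \<open>\<open>measure\<close> assigns 0 to a non-measurable set, so a small value in the
  contraction hypothesis is informative only once the event is known to be measurable.\<close>

lemma posterior_measurable:
  assumes B: "B \<in> sets real_sequences" and AB: "\<And>f. f \<in> L2_01 \<Longrightarrow> f \<in> A \<longleftrightarrow> coef f \<in> B"
  shows "(\<lambda>Y. posterior \<epsilon> M Y A) \<in> borel_measurable real_sequences"
proof -
  have [measurable]: "B \<in> sets real_sequences" by fact
  have num: "(LINT f|M. indicator A f * likelihood \<epsilon> Y f) = (LINT x|coef_law. indicator B x * seq_likelihood \<epsilon> Y x)" for Y
    by (rule posterior_numerator[OF B]) (rule AB)
  have 1: "(\<lambda>Y. LINT x|coef_law. indicator B x * seq_likelihood \<epsilon> Y x) \<in> borel_measurable real_sequences"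
    by measurable
  have 2: "(\<lambda>Y. LINT x|coef_law. seq_likelihood \<epsilon> Y x) \<in> borel_measurable real_sequences"
    by measurable
  have den: "(LINT f|M. likelihood \<epsilon> Y f) = (LINT x|coef_law. seq_likelihood \<epsilon> Y x)" for Y
    using posterior_numerator[of UNIV UNIV Y] by (simp add: sets.top[of real_sequences, simplified])
  show ?thesis
    unfolding posterior_def num den using 1 2 by (rule borel_measurable_divide)
qed

text \<open>Sequences that are not square summable enter through the default value of
  \<open>suminf\<close>; they form a null set under \<open>coef_law\<close>.\<close>

definition far_set :: "real \<Rightarrow> (real \<Rightarrow> real) \<Rightarrow> (nat \<Rightarrow> real) set" where
  "far_set d f0 = {x. d \<le> sqrt (seq_norm_sq (\<lambda>k. x k - coef f0 k))}"

lemma far_set_sets: "far_set d f0 \<in> sets real_sequences"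
proof -
  have T: "(\<lambda>x k. x k - coef f0 k) \<in> real_sequences \<rightarrow>\<^sub>M real_sequences"
    by (rule measurable_PiM_single') auto
  note [measurable] = seq_norm_sq_measurable[OF T]
  have "{x \<in> space real_sequences. d \<le> sqrt (seq_norm_sq (\<lambda>k. x k - coef f0 k))} \<in> sets real_sequences"
    by measurable
  then show ?thesis by (simp add: far_set_def)
qed

lemma far_set_coef:
  assumes "f0 \<in> L2_01" "f \<in> L2_01"
  shows "f \<in> {f. d \<le> L2norm01 (\<lambda>x. f x - f0 x)} \<longleftrightarrow> coef f \<in> far_set d f0"
proof -
  have "(\<lambda>k. coef f k - coef f0 k) = coef (\<lambda>x. f x - f0 x)"
    using assms by (simp add: coef_diff fun_eq_iff)
  then show ?thesis
    using assms by (simp add: far_set_def seq_norm_sq_coef L2_01_diff L2norm01_eq)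
qed

text \<open>By Cauchy-Schwarz, testing against a unit vector does not increase distances, and the
  centre \<open>a * g\<close> is tested to \<open>a\<close>.\<close>

lemma post_inner_far:
  assumes gd: "good Y" and g: "g \<in> L2_01" "inner01 g g = 1" and B: "measure (post Y) (far_set d (\<lambda>x. a * g x)) < 1 / 8"
  shows "emeasure (post Y) {x. d \<le> \<bar>seq_inner (coef g) x - a\<bar>} \<le> 1 / 8"
proof -
  interpret P: prob_space "post Y" by (rule post_prob_space[OF gd])
  note S [measurable] = seq_inner_left_measurable[of "coef g"]
  have ag: "(\<lambda>x. a * g x) \<in> L2_01" using g(1) by (rule L2_01_scale)
  have T: "(\<lambda>x k. x k - coef (\<lambda>x. a * g x) k) \<in> real_sequences \<rightarrow>\<^sub>M real_sequences"
    by (rule measurable_PiM_single') auto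
  note [measurable] = seq_norm_sq_measurable[OF T]
  have "AE x in coef_law. d \<le> \<bar>seq_inner (coef g) x - a\<bar> \<longrightarrow> d \<le> sqrt (seq_norm_sq (\<lambda>k. x k - coef (\<lambda>x. a * g x) k))"
  proof (rule AE_coef_lawI)
    show "{x \<in> space real_sequences. d \<le> \<bar>seq_inner (coef g) x - a\<bar> \<longrightarrow> d \<le> sqrt (seq_norm_sq (\<lambda>k. x k - coef (\<lambda>x. a * g x) k))} \<in> sets real_sequences"
      by measurable
    fix f assume f: "f \<in> L2_01"
    have "inner01 (\<lambda>x. f x - a * g x) g = inner01 f g - a"
      using f g ag by (simp add: inner01_diff_left inner01_scale_left)
    then have "\<bar>inner01 f g - a\<bar> \<le> L2norm01 (\<lambda>x. f x - a * g x) * L2norm01 g"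
      using inner01_Cauchy_Schwarz[OF L2_01_diff[OF f ag] g(1)] by simp
    then have "\<bar>seq_inner (coef g) (coef f) - a\<bar> \<le> L2norm01 (\<lambda>x. f x - a * g x)"
      using f g by (simp add: seq_inner_coef inner01_commute[of g f] L2norm01_eq[of g])
    then show "d \<le> \<bar>seq_inner (coef g) (coef f) - a\<bar> \<longrightarrow> d \<le> sqrt (seq_norm_sq (\<lambda>k. coef f k - coef (\<lambda>x. a * g x) k))"
      using far_set_coef[OF ag f, of d] by (auto simp: far_set_def)
  qed
  from AE_post[OF this] have "AE x in post Y. x \<in> {x. d \<le> \<bar>seq_inner (coef g) x - a\<bar>} \<longrightarrow> x \<in> far_set d (\<lambda>x. a * g x)"
    by eventually_elim (simp add: far_set_def)
  then have "emeasure (post Y) {x. d \<le> \<bar>seq_inner (coef g) x - a\<bar>} \<le> emeasure (post Y) (far_set d (\<lambda>x. a * g x))"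
    by (rule emeasure_mono_AE) (simp add: sets_post far_set_sets)
  also have "\<dots> \<le> ennreal (1 / 8)"
    unfolding P.emeasure_eq_measure using B by (intro ennreal_leI) simp
  finally show ?thesis unfolding ennreal_one_divide_numeral .
qed

text \<open>A union bound under the common noise: both data sequences are almost surely good, and
  the two events of poor contraction have probability below 1/8 each. So some noise sequence avoids
  all of them, and its two data sequences differ exactly by \<open>a\<close> times the coefficients
  of \<open>g\<close>.\<close>

lemma exists_good_sample:
  assumes g: "g \<in> L2_01"
    and H1: "measure (data_law \<epsilon> (\<lambda>x. a * g x)) {Y. 1 / 8 \<le> posterior \<epsilon> M Y {f. d \<le> L2norm01 (\<lambda>x. f x - a * g x)}} < 1 / 8"
    and H0: "measure (data_law \<epsilon> (\<lambda>x. 0)) {Y. 1 / 8 \<le> posterior \<epsilon> M Y {f. d \<le> L2norm01 (\<lambda>x. f x - 0)}} < 1 / 8"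
  shows "\<exists>Y. good Y \<and> good (\<lambda>k. Y k + a * coef g k) \<and>
    measure (post (\<lambda>k. Y k + a * coef g k)) (far_set d (\<lambda>x. a * g x)) < 1 / 8 \<and>
    measure (post Y) (far_set d (\<lambda>x. 0)) < 1 / 8"
proof (rule ccontr)
  assume neg: "\<not> ?thesis"
  interpret N: prob_space "noise \<epsilon>" using eps by (rule noise_prob_space)
  have ag: "(\<lambda>x. a * g x) \<in> L2_01" using g(1) by (rule L2_01_scale)
  let ?P = "\<lambda>f0 Y. 1 / 8 \<le> posterior \<epsilon> M Y {f. d \<le> L2norm01 (\<lambda>x. f x - f0 x)}"
  have P: "{Y. ?P f0 Y} \<in> sets real_sequences" if "f0 \<in> L2_01" for f0
  proof -
    note [measurable] = posterior_measurable[OF far_set_sets far_set_coef[OF that], of d]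
    have "{Y \<in> space real_sequences. ?P f0 Y} \<in> sets real_sequences" by measurable
    then show ?thesis by simp
  qed
  let ?B1 = "{Y. ?P (\<lambda>x. a * g x) (\<lambda>k. Y k + coef (\<lambda>x. a * g x) k)}" and ?B0 = "{Y. ?P (\<lambda>x. 0) (\<lambda>k. Y k + coef (\<lambda>x. 0) k)}"
  note m1 = measure_data_law[OF eps P[OF ag], of "\<lambda>x. a * g x"]
  note m0 = measure_data_law[OF eps P[OF L2_01_zero], of "\<lambda>x. 0"]
  have zero: "coef (\<lambda>x. 0) k = 0" for k by (simp add: coef_def)
  have "AE Y in noise \<epsilon>. Y \<in> ?B1 \<union> ?B0"
    using AE_good_shift[OF g, of a] AE_good_shift[OF g, of 0]
  proof eventually_elim
    case (elim Y)
    then have gd: "good Y" "good (\<lambda>k. Y k + a * coef g k)" by simp_all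
    show ?case
      using neg gd posterior_eq_measure_post[OF gd(1) far_set_sets far_set_coef[OF L2_01_zero], of d]
        posterior_eq_measure_post[OF gd(2) far_set_sets far_set_coef[OF ag], of d]
      by (auto simp: zero coef_scale not_less)
  qed
  then have "N.prob (?B1 \<union> ?B0) = 1"
    using m1(2) m0(2) by (subst N.prob_eq_1) auto
  moreover have "N.prob (?B1 \<union> ?B0) \<le> N.prob ?B1 + N.prob ?B0"
    using m1(2) m0(2) by (intro measure_Un_le) auto
  ultimately show False using H1 H0 unfolding m1(1) m0(1) by linarith
qed

text \<open>Every direction has its own witness \<open>Y'\<close>, but the resulting small-ball
  bound holds for all good data. All directions can therefore be tested on one posterior, that of a
  fixed \<open>Y\<close> contracting at 0, where Bessel's inequality adds them up.\<close>

theorem contraction_rate_dichotomy: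
  assumes \<psi>: "\<And>j. j < N \<Longrightarrow> \<psi> j \<in> L2_01"
    and orth: "\<And>i j. i < N \<Longrightarrow> j < N \<Longrightarrow> inner01 (\<psi> i) (\<psi> j) = (if i = j then 1 else 0)"
    and N: "N > 0" and a: "a > 0" and d: "d > 0"
    and H1: "\<And>j. j < N \<Longrightarrow> measure (data_law \<epsilon> (\<lambda>x. a * \<psi> j x)) {Y. 1 / 8 \<le> posterior \<epsilon> M Y {f. d \<le> L2norm01 (\<lambda>x. f x - a * \<psi> j x)}} < 1 / 8"
    and H0: "measure (data_law \<epsilon> (\<lambda>x. 0)) {Y. 1 / 8 \<le> posterior \<epsilon> M Y {f. d \<le> L2norm01 (\<lambda>x. f x - 0)}} < 1 / 8"
  shows "a < 4 * d \<or> real N * \<epsilon>\<^sup>2 \<le> 8192 * d\<^sup>2"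
proof (rule disjCI)
  assume "\<not> real N * \<epsilon>\<^sup>2 \<le> 8192 * d\<^sup>2"
  show "a < 4 * d"
  proof (rule ccontr)
    assume "\<not> a < 4 * d"
    then have da: "d \<le> a / 4" by simp
    obtain Y where Y: "good Y" "measure (post Y) (far_set d (\<lambda>x. 0)) < 1 / 8"
      using exists_good_sample[OF \<psi>[OF N] H1[OF N] H0] by blast
    interpret P: prob_space "post Y" by (rule post_prob_space[OF Y(1)])
    let ?E = "\<lambda>j. {x. \<bar>seq_inner (coef (\<psi> j)) x\<bar> < \<epsilon> / 64}" and ?B = "far_set d (\<lambda>x. 0)"
    have E: "?E j \<in> sets (post Y)" for j
    proof -
      note [measurable] = seq_inner_left_measurable[of "coef (\<psi> j)"]
      have "{x \<in> space real_sequences. \<bar>seq_inner (coef (\<psi> j)) x\<bar> < \<epsilon> / 64} \<in> sets real_sequences" by measurable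
      then show ?thesis by (simp add: sets_post)
    qed
    have small: "P.prob (?E j) \<le> 1 / 4" if j: "j < N" for j
    proof -
      obtain Y' where Y': "good Y'" "good (\<lambda>k. Y' k + a * coef (\<psi> j) k)"
        "measure (post (\<lambda>k. Y' k + a * coef (\<psi> j) k)) (far_set d (\<lambda>x. a * \<psi> j x)) < 1 / 8"
        "measure (post Y') (far_set d (\<lambda>x. 0)) < 1 / 8"
        using exists_good_sample[OF \<psi>[OF j] H1[OF j] H0] by blast
      have n: "inner01 (\<psi> j) (\<psi> j) = 1" using orth[OF j j] by simp
      have "emeasure (post Y) (?E j) \<le> 1 / 4"
      proof (rule posterior_small_ball[OF \<psi>[OF j] a da Y'(1,2) _ _ Y(1)])
        show "emeasure (post (\<lambda>k. Y' k + a * coef (\<psi> j) k)) {x. d \<le> \<bar>seq_inner (coef (\<psi> j)) x - a\<bar>} \<le> 1 / 8"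
          by (rule post_inner_far[OF Y'(2) \<psi>[OF j] n Y'(3)])
        show "emeasure (post Y') {x. d \<le> \<bar>seq_inner (coef (\<psi> j)) x\<bar>} \<le> 1 / 8"
          using post_inner_far[OF Y'(1) \<psi>[OF j] n, of d 0] Y'(4) by simp
      qed
      then show ?thesis
        unfolding ennreal_one_divide_numeral P.emeasure_eq_measure by (subst (asm) ennreal_le_iff) simp_all
    qed
    define \<kappa> where "\<kappa> = (\<epsilon> / 64)\<^sup>2"
    have \<kappa>: "\<kappa> \<ge> 0" by (simp add: \<kappa>_def)
    have meas_S [measurable]: "seq_inner (coef (\<psi> j)) \<in> borel_measurable real_sequences" for j
      by (rule seq_inner_left_measurable)
    have Bs [measurable]: "?B \<in> sets real_sequences" by (rule far_set_sets)
    have Es [measurable]: "?E j \<in> sets real_sequences" for j using E[of j] by (simp add: sets_post)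
    \<comment> \<open>A truncated form of Bessel's inequality: each direction counts at most
      \<kappa>, so the far set costs only \<open>N * \<kappa>\<close> and no posterior second moment
      is required.\<close>
    have "AE x in coef_law. (\<Sum>j<N. \<kappa> * (1 - indicat_real (?E j) x)) \<le> d\<^sup>2 + real N * \<kappa> * indicat_real ?B x"
    proof (rule AE_coef_lawI)
      show "{x \<in> space real_sequences. (\<Sum>j<N. \<kappa> * (1 - indicat_real (?E j) x)) \<le> d\<^sup>2 + real N * \<kappa> * indicat_real ?B x} \<in> sets real_sequences"
        by measurable
      fix f assume f: "f \<in> L2_01"
      show "(\<Sum>j<N. \<kappa> * (1 - indicat_real (?E j) (coef f))) \<le> d\<^sup>2 + real N * \<kappa> * indicat_real ?B (coef f)"
      proof (cases "coef f \<in> ?B")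
        case True
        have "(\<Sum>j<N. \<kappa> * (1 - indicat_real (?E j) (coef f))) \<le> (\<Sum>j<N. \<kappa>)"
          using \<kappa> by (intro sum_mono) (auto simp: indicator_def)
        also have "\<dots> \<le> d\<^sup>2 + real N * \<kappa>" by simp
        finally show ?thesis using True by simp
      next
        case False
        then have "L2norm01 f < d"
          using far_set_coef[OF L2_01_zero f, of d] by auto
        then have "(L2norm01 f)\<^sup>2 \<le> d\<^sup>2" by (intro power_mono) auto
        then have nf: "inner01 f f \<le> d\<^sup>2" by (simp add: L2norm01_sq)
        have "(\<Sum>j<N. \<kappa> * (1 - indicat_real (?E j) (coef f))) \<le> (\<Sum>j<N. (inner01 f (\<psi> j))\<^sup>2)"
        proof (rule sum_mono)
          fix j assume "j \<in> {..<N}"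
          then have S: "seq_inner (coef (\<psi> j)) (coef f) = inner01 f (\<psi> j)"
            using \<psi> f by (simp add: seq_inner_coef inner01_commute)
          show "\<kappa> * (1 - indicat_real (?E j) (coef f)) \<le> (inner01 f (\<psi> j))\<^sup>2"
          proof (cases "\<bar>inner01 f (\<psi> j)\<bar> < \<epsilon> / 64")
            case True
            then show ?thesis by (simp add: S)
          next
            case False
            then have "(\<epsilon> / 64)\<^sup>2 \<le> \<bar>inner01 f (\<psi> j)\<bar>\<^sup>2" using eps by (intro power_mono) auto
            then show ?thesis using False by (simp add: S \<kappa>_def)
          qed
        qed
        also have "\<dots> \<le> inner01 f f"
          using \<psi> f orth by (intro Bessel_inequality) auto
        finally show ?thesis using nf False by simp
      qed
    qed
    from AE_post[OF this] have ae: "AE x in post Y. (\<Sum>j<N. \<kappa> * (1 - indicat_real (?E j) x)) \<le> d\<^sup>2 + real N * \<kappa> * indicat_real ?B x" .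
    have B: "?B \<in> sets (post Y)" by (simp add: sets_post)
    have iE: "integrable (post Y) (indicat_real (?E j))" for j
      using E by (intro integrable_real_indicator) (simp_all add: P.emeasure_eq_measure)
    have iB: "integrable (post Y) (indicat_real ?B)"
      using B by (intro integrable_real_indicator) (simp_all add: P.emeasure_eq_measure)
    have "(LINT x|post Y. (\<Sum>j<N. \<kappa> * (1 - indicat_real (?E j) x))) \<le> (LINT x|post Y. d\<^sup>2 + real N * \<kappa> * indicat_real ?B x)"
      using iE iB by (intro integral_mono_AE ae) auto
    also have "(LINT x|post Y. (\<Sum>j<N. \<kappa> * (1 - indicat_real (?E j) x))) = (\<Sum>j<N. \<kappa> * (1 - P.prob (?E j)))"
      using iE E P.prob_space by simp
    also have "(LINT x|post Y. d\<^sup>2 + real N * \<kappa> * indicat_real ?B x) = d\<^sup>2 + real N * \<kappa> * P.prob ?B"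
      using iB B P.prob_space by simp
    finally have "(\<Sum>j<N. \<kappa> * (1 - P.prob (?E j))) \<le> d\<^sup>2 + real N * \<kappa> * P.prob ?B" .
    moreover have "(\<Sum>j<N. \<kappa> * (1 - P.prob (?E j))) \<ge> (\<Sum>j<N. \<kappa> * (3 / 4))"
    proof (intro sum_mono mult_left_mono \<kappa>)
      fix j assume "j \<in> {..<N}"
      then show "3 / 4 \<le> 1 - P.prob (?E j)" using small[of j] by simp
    qed
    moreover have "real N * \<kappa> * P.prob ?B \<le> real N * \<kappa> * (1 / 8)"
      using Y(2) \<kappa> by (intro mult_left_mono) auto
    \<comment> \<open>5/8 is 3/4 - 1/8. Since \<kappa> is \<open>\<epsilon>\<^sup>2 / 4096\<close>,
      the factor obtained is 32768 / 5, which is rounded up to 8192.\<close>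
    ultimately have "real N * \<kappa> * (5 / 8) \<le> d\<^sup>2" by simp
    then have "real N * \<epsilon>\<^sup>2 * 5 \<le> 32768 * d\<^sup>2" by (simp add: \<kappa>_def power_divide field_simps)
    then show False using \<open>\<not> real N * \<epsilon>\<^sup>2 \<le> 8192 * d\<^sup>2\<close> zero_le_power2[of d] by linarith
  qed
qed

end

section \<open>Bumps in Besov balls\<close>

lemma fdiff_0 [simp]: "fdiff 0 h f x = f x"
  by (simp add: fdiff_def)

text \<open>Pascal's rule for the binomial weights.\<close>

lemma fdiff_Suc: "fdiff (Suc r) h f x = fdiff r h f (x + h) - fdiff r h f x"
proof -
  let ?g = "\<lambda>j. f (x + real j * h)"
  have up: "fdiff r h f (x + h) = (\<Sum>j\<le>r. (-1) ^ (r - j) * real (r choose j) * ?g (Suc j))"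
    unfolding fdiff_def by (intro sum.cong refl) (simp add: algebra_simps)
  have "fdiff r h f x = (\<Sum>j\<le>Suc r. (-1) ^ (r - j) * real (r choose j) * ?g j)"
    by (simp add: fdiff_def)
  also have "\<dots> = (-1) ^ r * ?g 0 + (\<Sum>j\<le>r. (-1) ^ (r - Suc j) * real (r choose Suc j) * ?g (Suc j))"
    by (subst sum.atMost_Suc_shift) simp
  also have "(\<Sum>j\<le>r. (-1) ^ (r - Suc j) * real (r choose Suc j) * ?g (Suc j)) =
      - (\<Sum>j\<le>r. (-1) ^ (r - j) * real (r choose Suc j) * ?g (Suc j))"
    unfolding sum_negf[symmetric]
  proof (intro sum.cong refl)
    fix j assume "j \<in> {..r}"
    show "(-1) ^ (r - Suc j) * real (r choose Suc j) * ?g (Suc j) = - ((-1) ^ (r - j) * real (r choose Suc j) * ?g (Suc j))"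
    \<comment> \<open>At \<open>j = r\<close> truncated subtraction spoils the sign, but the
      binomial coefficient is 0 there.\<close>
    proof (cases "j < r")
      case True
      then have "r - j = Suc (r - Suc j)" by simp
      then show ?thesis by simp
    next
      case False
      then show ?thesis by (simp add: binomial_eq_0)
    qed
  qed
  finally have low: "fdiff r h f x = (-1) ^ r * ?g 0 - (\<Sum>j\<le>r. (-1) ^ (r - j) * real (r choose Suc j) * ?g (Suc j))"
    by simp
  have "fdiff (Suc r) h f x = (-1) ^ Suc r * ?g 0 + (\<Sum>j\<le>r. (-1) ^ (r - j) * real (Suc r choose Suc j) * ?g (Suc j))"
    unfolding fdiff_def by (subst sum.atMost_Suc_shift) simp
  also have "(\<Sum>j\<le>r. (-1) ^ (r - j) * real (Suc r choose Suc j) * ?g (Suc j)) =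
      fdiff r h f (x + h) + (\<Sum>j\<le>r. (-1) ^ (r - j) * real (r choose Suc j) * ?g (Suc j))"
    unfolding up sum.distrib[symmetric] by (intro sum.cong refl) (simp add: algebra_simps)
  finally show ?thesis using low by simp
qed

lemma fdiff_linear: "fdiff r h (\<lambda>x. a * f x + b * g x) x = a * fdiff r h f x + b * fdiff r h g x"
  unfolding fdiff_def sum_distrib_left sum.distrib[symmetric]
  by (intro sum.cong refl) (simp add: algebra_simps)

lemma fdiff_has_derivative:
  assumes "\<And>x. (f has_real_derivative f' x) (at x)"
  shows "(fdiff r h f has_real_derivative fdiff r h f' x) (at x)"
proof -
  have "((\<lambda>x. f (x + c)) has_real_derivative f' (x + c)) (at x)" for c
    using assms[of "x + c"] by (simp add: DERIV_shift)
  then show ?thesis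
    unfolding fdiff_def[abs_def] by (intro DERIV_sum DERIV_cmult)
qed

lemma fdiff_abs_le:
  assumes "\<And>x. \<bar>f x\<bar> \<le> B"
  shows "\<bar>fdiff r h f x\<bar> \<le> 2 ^ r * B"
proof -
  have "\<bar>fdiff r h f x\<bar> \<le> (\<Sum>j\<le>r. \<bar>(-1) ^ (r - j) * real (r choose j) * f (x + real j * h)\<bar>)"
    unfolding fdiff_def by (rule sum_abs)
  also have "\<dots> \<le> (\<Sum>j\<le>r. real (r choose j) * B)"
    using assms by (intro sum_mono) (simp add: abs_mult power_abs mult_left_mono)
  also have "\<dots> = 2 ^ r * B"
    unfolding sum_distrib_right[symmetric] using choose_row_sum[of r] by (metis of_nat_sum of_nat_power of_nat_numeral)
  finally show ?thesis .
qed

text \<open>A spline rather than a smooth bump: its derivative is a combination of two bumps with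
  one exponent lowered, so inductions on the order of a difference stay within the family.\<close>

definition bump :: "nat \<Rightarrow> nat \<Rightarrow> real \<Rightarrow> real" where
  "bump a b x = max 0 x ^ a * max 0 (1 - x) ^ b"

lemma bump_zero: "a \<ge> 1 \<Longrightarrow> b \<ge> 1 \<Longrightarrow> x \<le> 0 \<or> 1 \<le> x \<Longrightarrow> bump a b x = 0"
  by (auto simp: bump_def)

lemma bump_le_1:
  assumes "a \<ge> 1" "b \<ge> 1" shows "\<bar>bump a b x\<bar> \<le> 1"
proof (cases "0 < x \<and> x < 1")
  case True
  then have "x ^ a \<le> 1" "(1 - x) ^ b \<le> 1" by (auto intro!: power_le_one)
  then have "x ^ a * (1 - x) ^ b \<le> 1 * 1" using True by (intro mult_mono) auto
  then show ?thesis using True by (simp add: bump_def abs_mult)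
next
  case False
  then show ?thesis using bump_zero[OF assms, of x] by auto
qed

lemma continuous_on_bump: "continuous_on S (bump a b)"
  unfolding bump_def[abs_def] by (intro continuous_intros)

lemma bump_measurable [measurable]: "bump a b \<in> borel_measurable borel"
  by (rule borel_measurable_continuous_onI[OF continuous_on_bump])

lemma pos_power_has_derivative:
  assumes "a \<ge> 2"
  shows "((\<lambda>x::real. max 0 x ^ a) has_real_derivative real a * max 0 x ^ (a - 1)) (at x)"
proof -
  obtain n where a: "a = Suc (Suc n)"
    using assms by (intro that[of "a - 2"]) simp
  consider "x > 0" | "x < 0" | "x = 0" by linarith
  then show ?thesis
  proof cases
    case 1
    have "((\<lambda>x. x ^ a) has_real_derivative real a * x ^ (a - 1)) (at x)"
      by (auto intro!: derivative_eq_intros)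
    moreover have "\<forall>\<^sub>F y in nhds x. max 0 y ^ a = y ^ a"
      using eventually_nhds_in_open[of "{0<..}" x] 1 by (auto elim!: eventually_mono)
    ultimately show ?thesis using 1 by (subst DERIV_cong_ev[OF refl _ refl]) auto
  next
    case 2
    have ev: "\<forall>\<^sub>F y in nhds x. max 0 y ^ a = 0"
      using eventually_nhds_in_open[of "{..<0}" x] 2 by (auto elim!: eventually_mono simp: a)
    have eq: "real a * max 0 x ^ (a - 1) = 0" using 2 by (simp add: a)
    show ?thesis unfolding eq by (subst DERIV_cong_ev[OF refl ev refl]) simp
  next
    case 3
    have "((\<lambda>h::real. (max 0 (0 + h) ^ a - max 0 0 ^ a) / h) \<longlongrightarrow> 0) (at 0)"
    proof (rule Lim_null_comparison)
      show "\<forall>\<^sub>F h in at 0. norm ((max 0 (0 + h) ^ a - max 0 0 ^ a) / h) \<le> \<bar>h\<bar> ^ Suc n"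
      proof (intro always_eventually allI)
        fix h :: real
        show "norm ((max 0 (0 + h) ^ a - max 0 0 ^ a) / h) \<le> \<bar>h\<bar> ^ Suc n"
        proof (cases "h > 0")
          case True
          then show ?thesis by (simp add: a abs_mult)
        next
          case False
          then have "(max 0 (0 + h) ^ a - max 0 0 ^ a) / h = 0" by (simp add: a)
          then show ?thesis by (simp only: norm_zero zero_le_power abs_ge_zero)
        qed
      qed
      have "((\<lambda>h::real. \<bar>h\<bar> ^ Suc n) \<longlongrightarrow> \<bar>0\<bar> ^ Suc n) (at 0)"
        by (intro tendsto_intros)
      then show "((\<lambda>h::real. \<bar>h\<bar> ^ Suc n) \<longlongrightarrow> 0) (at 0)" by simp
    qed
    then show ?thesis using 3 by (simp add: DERIV_def a)
  qed
qed

lemma bump_has_derivative: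
  assumes "a \<ge> 2" "b \<ge> 2"
  shows "(bump a b has_real_derivative real a * bump (a - 1) b x + (- real b) * bump a (b - 1) x) (at x)"
proof -
  have "((\<lambda>x::real. max 0 (1 - x) ^ b) has_real_derivative real b * max 0 (1 - x) ^ (b - 1) * (- 1)) (at x)"
    by (rule DERIV_chain2[OF pos_power_has_derivative[OF assms(2)]]) (auto intro!: derivative_eq_intros)
  from DERIV_mult[OF pos_power_has_derivative[OF assms(1), of x] this]
  show ?thesis unfolding bump_def[abs_def] by (simp add: algebra_simps)
qed

text \<open>The mean value theorem trades one difference for a factor \<open>h\<close> and one
  derivative, which costs one exponent. Starting from exponents of at least \<open>r + 1\<close>
  leaves a bounded, continuous bump after \<open>r\<close> steps.\<close>

lemma fdiff_bump_le_power:
  assumes "r + 1 \<le> a" "r + 1 \<le> b"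
  shows "\<exists>C\<ge>0. \<forall>h>0. \<forall>x. \<bar>fdiff r h (bump a b) x\<bar> \<le> C * h ^ r"
  using assms
proof (induction r arbitrary: a b)
  case 0
  then show ?case using bump_le_1[of a b] by (intro exI[of _ 1]) auto
next
  case (Suc r)
  have ab: "r + 1 \<le> a - 1" "r + 1 \<le> b" "r + 1 \<le> a" "r + 1 \<le> b - 1" using Suc.prems by auto
  obtain C1 where C1: "C1 \<ge> 0" "\<And>h x. h > 0 \<Longrightarrow> \<bar>fdiff r h (bump (a - 1) b) x\<bar> \<le> C1 * h ^ r"
    using Suc.IH[OF ab(1,2)] by blast
  obtain C2 where C2: "C2 \<ge> 0" "\<And>h x. h > 0 \<Longrightarrow> \<bar>fdiff r h (bump a (b - 1)) x\<bar> \<le> C2 * h ^ r"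
    using Suc.IH[OF ab(3,4)] by blast
  let ?C = "real a * C1 + real b * C2"
  let ?f' = "\<lambda>x. real a * bump (a - 1) b x + (- real b) * bump a (b - 1) x"
  show ?case
  proof (intro exI[of _ ?C] conjI allI impI)
    show "0 \<le> ?C" using C1 C2 by simp
    fix h x :: real assume h: "h > 0"
    have der: "(fdiff r h (bump a b) has_real_derivative fdiff r h ?f' y) (at y)" for y
      using Suc.prems by (intro fdiff_has_derivative bump_has_derivative) auto
    have bd: "\<bar>fdiff r h ?f' y\<bar> \<le> ?C * h ^ r" for y
    proof -
      have "\<bar>fdiff r h ?f' y\<bar> \<le> real a * \<bar>fdiff r h (bump (a - 1) b) y\<bar> + real b * \<bar>fdiff r h (bump a (b - 1)) y\<bar>"
        unfolding fdiff_linear by (rule order_trans[OF abs_triangle_ineq]) (simp add: abs_mult)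
      also have "\<dots> \<le> real a * (C1 * h ^ r) + real b * (C2 * h ^ r)"
        using C1(2)[OF h] C2(2)[OF h] by (intro add_mono mult_left_mono) auto
      finally show ?thesis by (simp add: algebra_simps)
    qed
    obtain z where "fdiff r h (bump a b) (x + h) - fdiff r h (bump a b) x = (x + h - x) * fdiff r h ?f' z"
      using MVT2[of x "x + h" "fdiff r h (bump a b)" "fdiff r h ?f'"] h der by auto
    then have "\<bar>fdiff (Suc r) h (bump a b) x\<bar> = h * \<bar>fdiff r h ?f' z\<bar>"
      using h by (simp add: fdiff_Suc abs_mult)
    also have "\<dots> \<le> h * (?C * h ^ r)" using h by (intro mult_left_mono bd) auto
    finally show "\<bar>fdiff (Suc r) h (bump a b) x\<bar> \<le> ?C * h ^ Suc r" by (simp add: mult_ac)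
  qed
qed

definition scaled_bump :: "nat \<Rightarrow> nat \<Rightarrow> nat \<Rightarrow> real \<Rightarrow> real" where
  "scaled_bump r N j x = bump (r + 1) (r + 1) (real N * x - real j)"

lemma continuous_on_scaled_bump: "continuous_on S (scaled_bump r N j)"
  unfolding scaled_bump_def[abs_def]
  by (rule continuous_on_compose2[OF continuous_on_bump[of UNIV]]) (auto intro!: continuous_intros)

lemma scaled_bump_measurable [measurable]: "scaled_bump r N j \<in> borel_measurable borel"
  by (rule borel_measurable_continuous_onI[OF continuous_on_scaled_bump])

lemma fdiff_scaled_bump: "fdiff r h (scaled_bump s N j) x = fdiff r (real N * h) (bump (s + 1) (s + 1)) (real N * x - real j)"
  unfolding fdiff_def scaled_bump_def by (intro sum.cong refl) (simp add: algebra_simps)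

text \<open>The points \<open>x\<close> for which the node \<open>x + i * h\<close> of a difference
  lies in the closed support of the \<open>j\<close>-th bump.\<close>

definition scaled_supp :: "nat \<Rightarrow> nat \<Rightarrow> real \<Rightarrow> nat \<Rightarrow> real set" where
  "scaled_supp N j h i = {real j / real N - real i * h .. (real j + 1) / real N - real i * h}"

lemma measure_scaled_supp: "N > 0 \<Longrightarrow> measure lborel (scaled_supp N j h i) = 1 / real N"
  unfolding scaled_supp_def by (simp add: field_simps)

text \<open>Smoothness controls the differences for steps below the bump width \<open>1 / N\<close>;
  for larger steps the sum of the binomial weights does.\<close>

lemma fdiff_scaled_bump_bound:
  "\<exists>C\<ge>1. \<forall>N>0. \<forall>j. \<forall>h>0. \<forall>x. \<bar>fdiff r h (scaled_bump r N j) x\<bar> \<le> C * min 1 ((real N * h) ^ r)"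
proof -
  obtain C where C: "C \<ge> 0" "\<And>h x. h > 0 \<Longrightarrow> \<bar>fdiff r h (bump (r + 1) (r + 1)) x\<bar> \<le> C * h ^ r"
    using fdiff_bump_le_power[of r "r + 1" "r + 1"] by auto
  show ?thesis
  proof (intro exI[of _ "max C (2 ^ r)"] conjI allI impI)
    show "1 \<le> max C (2 ^ r)" by (simp add: le_max_iff_disj)
    fix N j :: nat and h x :: real assume N: "0 < N" "0 < h"
    then have "0 < real N * h" by simp
    from C(2)[OF this] have "\<bar>fdiff r h (scaled_bump r N j) x\<bar> \<le> C * (real N * h) ^ r"
      unfolding fdiff_scaled_bump .
    also have "\<dots> \<le> max C (2 ^ r) * (real N * h) ^ r" using N by (intro mult_right_mono) auto
    finally have 1: "\<bar>fdiff r h (scaled_bump r N j) x\<bar> \<le> max C (2 ^ r) * (real N * h) ^ r" .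
    have "\<bar>fdiff r h (scaled_bump r N j) x\<bar> \<le> 2 ^ r * 1"
      by (rule fdiff_abs_le) (simp only: scaled_bump_def, rule bump_le_1, auto)
    then have 2: "\<bar>fdiff r h (scaled_bump r N j) x\<bar> \<le> max C (2 ^ r) * 1" by simp
    show "\<bar>fdiff r h (scaled_bump r N j) x\<bar> \<le> max C (2 ^ r) * min 1 ((real N * h) ^ r)"
      using 1 2 by (simp add: min_def)
  qed
qed

lemma fdiff_scaled_bump_eq_0:
  assumes "N > 0" "\<And>i. i \<le> r \<Longrightarrow> x \<notin> scaled_supp N j h i"
  shows "fdiff r h (scaled_bump s N j) x = 0"
  unfolding fdiff_def
proof (rule sum.neutral, rule ballI)
  fix i assume "i \<in> {..r}"
  then have "x \<notin> scaled_supp N j h i" using assms by auto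
  then have "x + real i * h < real j / real N \<or> (real j + 1) / real N < x + real i * h"
    by (auto simp: scaled_supp_def)
  then have "real N * (x + real i * h) - real j \<le> 0 \<or> 1 \<le> real N * (x + real i * h) - real j"
    using assms(1) by (auto simp: field_simps)
  then show "(- 1) ^ (r - i) * real (r choose i) * scaled_bump s N j (x + real i * h) = 0"
    by (simp add: scaled_bump_def bump_zero)
qed

section \<open>Besov norms of rescaled bumps\<close>

lemma Lp_norm_on_nonneg [simp]: "0 \<le> Lp_norm_on p a b g"
  by (simp add: Lp_norm_on_def)

text \<open>The difference lives on \<open>r + 1\<close> translates of an interval of length
  \<open>1 / N\<close>, which accounts for the power of \<open>N\<close>. For \<open>r = 0\<close>
  the same bound covers the norm of the function itself.\<close>

lemma Lp_norm_fdiff_le: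
  assumes N: "N > 0" and p: "p \<ge> 1" and B: "B \<ge> 0" and b: "\<And>x. \<bar>fdiff r h f x\<bar> \<le> B"
    and z: "\<And>x. (\<And>i. i \<le> r \<Longrightarrow> x \<notin> scaled_supp N j h i) \<Longrightarrow> fdiff r h f x = 0"
  shows "Lp_norm_on p u v (fdiff r h f) \<le> B * (real r + 1) * real N powr (- 1 / p)"
proof -
  let ?g = "\<lambda>x. B powr p * (\<Sum>i\<le>r. indicat_real (scaled_supp N j h i) x)"
  have mS [measurable]: "scaled_supp N j h i \<in> sets borel" for i by (simp add: scaled_supp_def)
  have fin: "emeasure lborel (scaled_supp N j h i) < \<infinity>" for i
    unfolding scaled_supp_def by (simp add: emeasure_lborel_Icc_eq)
  have int: "integrable lborel (indicat_real (scaled_supp N j h i))" for i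
    using fin by (intro integrable_real_indicator) auto
  have "(LINT x:{u..v}|lborel. \<bar>fdiff r h f x\<bar> powr p) \<le> (LINT x|lborel. ?g x)"
    unfolding set_lebesgue_integral_def
  proof (rule integral_mono')
    show "integrable lborel ?g" using int by (intro integrable_mult_right Bochner_Integration.integrable_sum)
    fix x :: real
    have s0: "0 \<le> (\<Sum>i\<le>r. indicat_real (scaled_supp N j h i) x)" by (intro sum_nonneg) auto
    then show "0 \<le> ?g x" by simp
    show "indicat_real {u..v} x *\<^sub>R \<bar>fdiff r h f x\<bar> powr p \<le> ?g x"
    proof (cases "\<exists>i\<le>r. x \<in> scaled_supp N j h i")
      case True
      then obtain i where i: "i \<le> r" "x \<in> scaled_supp N j h i" by blast
      have "(1::real) = indicat_real (scaled_supp N j h i) x" using i by simp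
      also have "\<dots> \<le> (\<Sum>i\<le>r. indicat_real (scaled_supp N j h i) x)"
        using i by (intro member_le_sum) auto
      finally have "B powr p * 1 \<le> ?g x" by (intro mult_left_mono) auto
      moreover have "\<bar>fdiff r h f x\<bar> powr p \<le> B powr p"
        using b p by (intro powr_mono2) auto
      ultimately show ?thesis by (auto simp: indicator_def)
    next
      case False
      then have "fdiff r h f x = 0" by (intro z) auto
      then show ?thesis using s0 by simp
    qed
  qed
  also have "\<dots> = B powr p * ((real r + 1) / real N)"
    using int N by (simp add: measure_scaled_supp Bochner_Integration.integral_sum add.commute)
  finally have le: "(LINT x:{u..v}|lborel. \<bar>fdiff r h f x\<bar> powr p) \<le> B powr p * ((real r + 1) / real N)" .
  have nn: "0 \<le> (LINT x:{u..v}|lborel. \<bar>fdiff r h f x\<bar> powr p)"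
    unfolding set_lebesgue_integral_def by (intro integral_nonneg_AE) auto
  have "Lp_norm_on p u v (fdiff r h f) \<le> (B powr p * ((real r + 1) / real N)) powr (1 / p)"
    unfolding Lp_norm_on_def using le nn p by (intro powr_mono2) auto
  also have "\<dots> = B * ((real r + 1) powr (1 / p) * real N powr (- 1 / p))"
    using B p N by (simp add: powr_mult powr_divide powr_powr powr_minus_divide)
  also have "\<dots> \<le> B * ((real r + 1) powr 1 * real N powr (- 1 / p))"
    using B p by (intro mult_left_mono mult_right_mono powr_mono) auto
  finally show ?thesis by (simp add: mult_ac)
qed

text \<open>The integral is split at the bump width \<open>1 / N\<close>. Below it, integrability at
  0 comes from \<open>\<alpha> < r\<close>; above it, the range is extended to infinity and
  converges because \<alpha> is positive. Both parts scale as \<open>N\<close> to the power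
  \<open>\<alpha> * q\<close>.\<close>

lemma nn_integral_power_min:
  fixes \<alpha> q :: real
  assumes q: "q > 0" and \<alpha>: "0 < \<alpha>" "\<alpha> < real r" and N: "N > 0"
  shows "(\<integral>\<^sup>+ t. indicator {0<..1} t * ennreal ((t powr (- \<alpha>) * min 1 ((real N * t) ^ r)) powr q / t) \<partial>lborel) \<le>
    ennreal (real N powr (\<alpha> * q) * (1 / ((real r - \<alpha>) * q) + 1 / (\<alpha> * q)))"
proof -
  let ?s = "(real r - \<alpha>) * q - 1" and ?u = "- \<alpha> * q - 1" and ?c = "1 / real N"
  have s: "?s > - 1" and u: "?u < - 1" using assms by simp_all
  have Nr: "real N > 0" using N by simp
  have A: "(\<integral>\<^sup>+ t. ennreal (t powr ?s) * indicator {0..?c} t \<partial>lborel) = ennreal (?c powr (?s + 1) / (?s + 1))"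
    by (rule nn_integral_has_integral_lebesgue'[OF _ has_integral_powr_from_0[OF s]]) auto
  have B: "(\<integral>\<^sup>+ t. ennreal (t powr ?u) * indicator {?c..} t \<partial>lborel) = ennreal (- (?c powr (?u + 1)) / (?u + 1))"
    by (rule nn_integral_has_integral_lebesgue'[OF _ has_integral_powr_to_inf[OF u]]) (use Nr in auto)
  have "(\<integral>\<^sup>+ t. indicator {0<..1} t * ennreal ((t powr (- \<alpha>) * min 1 ((real N * t) ^ r)) powr q / t) \<partial>lborel) \<le>
      (\<integral>\<^sup>+ t. ennreal (real N powr (real r * q)) * (ennreal (t powr ?s) * indicator {0..?c} t) + ennreal (t powr ?u) * indicator {?c..} t \<partial>lborel)"
  proof (rule nn_integral_mono)
    fix t :: real
    show "indicator {0<..1} t * ennreal ((t powr (- \<alpha>) * min 1 ((real N * t) ^ r)) powr q / t) \<le>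
      ennreal (real N powr (real r * q)) * (ennreal (t powr ?s) * indicator {0..?c} t) + ennreal (t powr ?u) * indicator {?c..} t"
    proof (cases "0 < t")
      case False
      then show ?thesis by (simp add: indicator_def)
    next
      case t: True
      have base: "0 \<le> t powr (- \<alpha>) * min 1 ((real N * t) ^ r)" using t Nr by simp
      show ?thesis
      proof (cases "t \<le> ?c")
        case True
        have "(t powr (- \<alpha>) * min 1 ((real N * t) ^ r)) powr q / t \<le> (t powr (- \<alpha>) * (real N * t) ^ r) powr q / t"
          using t base q by (intro divide_right_mono powr_mono2 mult_left_mono) auto
        also have "(t powr (- \<alpha>) * (real N * t) ^ r) powr q / t = real N powr (real r * q) * t powr ?s"
        proof -
          have "(real N * t) ^ r = real N powr real r * t powr real r"
            using t Nr by (simp add: powr_realpow power_mult_distrib)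
          then have "t powr (- \<alpha>) * (real N * t) ^ r = real N powr real r * t powr (real r - \<alpha>)"
            using t by (simp add: powr_diff powr_minus field_simps)
          then have "(t powr (- \<alpha>) * (real N * t) ^ r) powr q = real N powr (real r * q) * t powr ((real r - \<alpha>) * q)"
            using t Nr by (simp add: powr_mult powr_powr)
          then show ?thesis using t by (simp add: powr_diff)
        qed
        finally have "ennreal ((t powr (- \<alpha>) * min 1 ((real N * t) ^ r)) powr q / t) \<le> ennreal (real N powr (real r * q)) * ennreal (t powr ?s)"
          by (simp add: ennreal_mult[symmetric])
        then show ?thesis using True t by (auto simp: indicator_def intro: add_increasing2)
      next
        case False
        have "(t powr (- \<alpha>) * min 1 ((real N * t) ^ r)) powr q / t \<le> (t powr (- \<alpha>) * 1) powr q / t"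
          using t base q by (intro divide_right_mono powr_mono2 mult_left_mono) auto
        also have "\<dots> = t powr ?u" using t by (simp add: powr_powr powr_diff)
        finally have "ennreal ((t powr (- \<alpha>) * min 1 ((real N * t) ^ r)) powr q / t) \<le> ennreal (t powr ?u)"
          by (rule ennreal_leI)
        then show ?thesis using False t by (auto simp: indicator_def)
      qed
    qed
  qed
  also have "\<dots> = ennreal (real N powr (real r * q)) * ennreal (?c powr (?s + 1) / (?s + 1)) + ennreal (- (?c powr (?u + 1)) / (?u + 1))"
    by (subst nn_integral_add, simp, simp, subst nn_integral_cmult, simp, unfold A B, rule refl)
  also have "\<dots> = ennreal (real N powr (\<alpha> * q) * (1 / ((real r - \<alpha>) * q) + 1 / (\<alpha> * q)))"
  proof -
    have c: "?c powr y = real N powr (- y)" for y using Nr by (simp add: powr_divide powr_minus_divide)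
    have 1: "real N powr (real r * q) * (?c powr (?s + 1) / (?s + 1)) = real N powr (\<alpha> * q) * (1 / ((real r - \<alpha>) * q))"
      unfolding c by (simp add: powr_add[symmetric] algebra_simps)
    have 2: "- (?c powr (?u + 1)) / (?u + 1) = real N powr (\<alpha> * q) * (1 / (\<alpha> * q))"
      unfolding c by (simp add: field_simps)
    show ?thesis
      unfolding 2 using 1 assms
      by (simp add: ennreal_mult[symmetric] ennreal_plus[symmetric] distrib_left del: ennreal_plus)
  qed
  finally show ?thesis .
qed

lemma besov_unit_ball_scaled_bump:
  assumes \<alpha>: "\<alpha> > 0" and p: "p \<ge> 1" and q: "q \<ge> 1" and r: "r = besov_r \<alpha>"
  shows "\<exists>C>0. \<forall>N>0. \<forall>j A. 0 \<le> A \<longrightarrow> A * C * real N powr (\<alpha> - 1 / p) \<le> 1 \<longrightarrow>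
    (\<lambda>x. A * scaled_bump r N j x) \<in> besov_unit_ball \<alpha> p q"
proof -
  have r\<alpha>: "\<alpha> < real r"
    unfolding r besov_r_def using \<alpha> by linarith
  define K where "K = 1 / ((real r - \<alpha>) * q) + 1 / (\<alpha> * q)"
  have K: "K > 0" unfolding K_def using \<alpha> q r\<alpha> by (intro add_pos_pos) auto
  from fdiff_scaled_bump_bound[of r] obtain C0 where C0_ge: "C0 \<ge> 1" and
    C0_bound: "\<forall>N>0. \<forall>j. \<forall>h>0. \<forall>x. \<bar>fdiff r h (scaled_bump r N j) x\<bar> \<le> C0 * min 1 ((real N * h) ^ r)"
    by (elim exE conjE)
  have C0: "C0 \<ge> 1"
    "\<And>N j h x. 0 < N \<Longrightarrow> 0 < h \<Longrightarrow> \<bar>fdiff r h (scaled_bump r N j) x\<bar> \<le> C0 * min 1 ((real N * h) ^ r)"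
    using C0_ge C0_bound by simp_all
  \<comment> \<open>The summand 1 pays for the Lp norm, the other one for the seminorm.\<close>
  define C where "C = 1 + C0 * (real r + 1) * K powr (1 / q)"
  have C: "C > 0" unfolding C_def using C0 by (intro add_pos_nonneg) auto
  show ?thesis
  proof (intro exI[of _ C] conjI C allI impI)
    fix N j :: nat and A :: real
    assume N: "0 < N" and A: "0 \<le> A" and small: "A * C * real N powr (\<alpha> - 1 / p) \<le> 1"
    have Nr: "real N \<ge> 1" using N by simp
    define f where "f = (\<lambda>x. A * scaled_bump r N j x)"
    have fd: "fdiff s h f x = A * fdiff s h (scaled_bump r N j) x" for s h x
      unfolding f_def using fdiff_linear[of s h A "scaled_bump r N j" 0 "\<lambda>x. 0" x] by simp
    have fz: "fdiff s h f x = 0" if "\<And>i. i \<le> s \<Longrightarrow> x \<notin> scaled_supp N j h i" for s h x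
      unfolding fd using fdiff_scaled_bump_eq_0[OF N that, of s] by simp
    have f1: "\<bar>f x\<bar> \<le> A" for x
      unfolding f_def scaled_bump_def using bump_le_1[of "r + 1" "r + 1"] A
        mult_left_mono[of "\<bar>bump (r + 1) (r + 1) (real N * x - real j)\<bar>" 1 A] by (simp add: abs_mult)
    define D where "D = A * C0 * (real r + 1) * real N powr (- 1 / p)"
    have D: "D \<ge> 0" unfolding D_def using A C0 by auto
    have Lp: "Lp_norm_on p u v (fdiff r h f) \<le> D * min 1 ((real N * h) ^ r)" if h: "h > 0" for h u v
    proof -
      have m: "0 \<le> min 1 ((real N * h) ^ r)" using h by simp
      have "Lp_norm_on p u v (fdiff r h f) \<le> (A * C0 * min 1 ((real N * h) ^ r)) * (real r + 1) * real N powr (- 1 / p)"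
      proof (rule Lp_norm_fdiff_le[OF N p _ _ fz])
        show "0 \<le> A * C0 * min 1 ((real N * h) ^ r)" using A C0 m by auto
        show "\<bar>fdiff r h f x\<bar> \<le> A * C0 * min 1 ((real N * h) ^ r)" for x
          using mult_left_mono[OF C0(2)[OF N h, of j x] A] A by (simp add: fd abs_mult mult.assoc)
      qed
      then show ?thesis by (simp add: D_def mult_ac)
    qed
    have mono: "D * min 1 ((real N * h) ^ r) \<le> D * min 1 ((real N * t) ^ r)" if "h > 0" "h \<le> t" for h t
      using that D by (intro mult_left_mono min.mono power_mono) auto
    have mod: "0 \<le> modsmooth r p f t" "modsmooth r p f t \<le> D * min 1 ((real N * t) ^ r)" if t: "t > 0" for t
    proof -
      have le: "Lp_norm_on p 0 (1 - real r * h) (fdiff r h f) \<le> D * min 1 ((real N * t) ^ r)" if "h \<in> {0<..t}" for h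
        using Lp[of h 0 "1 - real r * h"] mono[of h t] that by auto
      show "modsmooth r p f t \<le> D * min 1 ((real N * t) ^ r)"
        unfolding modsmooth_def using t le by (intro cSUP_least) auto
      \<comment> \<open>A supremum of reals dominates its terms only for a bounded set. The lower
        bound 0 obtained this way is what monotonicity of \<open>powr\<close> requires.\<close>
      have "bdd_above ((\<lambda>h. Lp_norm_on p 0 (1 - real r * h) (fdiff r h f)) ` {0<..t})"
        using le by (rule bdd_aboveI2)
      then have "Lp_norm_on p 0 (1 - real r * t) (fdiff r t f) \<le> modsmooth r p f t"
        unfolding modsmooth_def using t by (intro cSUP_upper) auto
      then show "0 \<le> modsmooth r p f t" using Lp_norm_on_nonneg order_trans by blast
    qed
    have "besov_seminorm_enn \<alpha> p q f \<le>
        (\<integral>\<^sup>+ t. ennreal (D powr q) * (indicator {0<..1} t * ennreal ((t powr (- \<alpha>) * min 1 ((real N * t) ^ r)) powr q / t)) \<partial>lborel)"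
      unfolding besov_seminorm_enn_def r[symmetric]
    proof (rule nn_integral_mono)
      fix t :: real
      show "indicator {0<..1} t * ennreal ((t powr (- \<alpha>) * modsmooth r p f t) powr q / t) \<le>
        ennreal (D powr q) * (indicator {0<..1} t * ennreal ((t powr (- \<alpha>) * min 1 ((real N * t) ^ r)) powr q / t))"
      proof (cases "t \<in> {0<..1}")
        case True
        then have t: "t > 0" by simp
        have "(t powr (- \<alpha>) * modsmooth r p f t) powr q \<le> (t powr (- \<alpha>) * (D * min 1 ((real N * t) ^ r))) powr q"
          using mod[OF t] q by (intro powr_mono2 mult_left_mono mult_nonneg_nonneg) auto
        also have "\<dots> = D powr q * (t powr (- \<alpha>) * min 1 ((real N * t) ^ r)) powr q"
          using D t by (subst powr_mult[symmetric]) (auto simp: mult_ac)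
        finally have "(t powr (- \<alpha>) * modsmooth r p f t) powr q / t \<le> D powr q * ((t powr (- \<alpha>) * min 1 ((real N * t) ^ r)) powr q / t)"
          using t by (simp add: divide_right_mono)
        then show ?thesis using True t by (simp add: ennreal_mult[symmetric] ennreal_leI)
      qed simp
    qed
    also have "\<dots> = ennreal (D powr q) * (\<integral>\<^sup>+ t. indicator {0<..1} t * ennreal ((t powr (- \<alpha>) * min 1 ((real N * t) ^ r)) powr q / t) \<partial>lborel)"
    proof (rule nn_integral_cmult)
      have "(\<lambda>t. (t powr (- \<alpha>) * min 1 ((real N * t) ^ r)) powr q / t) \<in> borel_measurable borel"
        by (intro borel_measurable_divide powr_real_measurable borel_measurable_times borel_measurable_min
          borel_measurable_power borel_measurable_const measurable_ident_sets refl)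
      then show "(\<lambda>t. indicator {0<..1} t * ennreal ((t powr (- \<alpha>) * min 1 ((real N * t) ^ r)) powr q / t)) \<in> borel_measurable lborel"
        by (intro borel_measurable_times_ennreal borel_measurable_indicator measurable_compose[OF _ measurable_ennreal]) simp_all
    qed
    also have "\<dots> \<le> ennreal (D powr q) * ennreal (real N powr (\<alpha> * q) * K)"
      unfolding K_def using q \<alpha> r\<alpha> N by (intro mult_left_mono nn_integral_power_min) auto
    also have "\<dots> = ennreal (D powr q * (real N powr (\<alpha> * q) * K))"
      using K by (simp add: ennreal_mult[symmetric])
    finally have semi: "besov_seminorm_enn \<alpha> p q f \<le> ennreal (D powr q * (real N powr (\<alpha> * q) * K))" .
    have "enn2real (besov_seminorm_enn \<alpha> p q f) \<le> D powr q * (real N powr (\<alpha> * q) * K)"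
      using enn2real_mono[OF semi] K by simp
    then have "enn2real (besov_seminorm_enn \<alpha> p q f) powr (1 / q) \<le> (D powr q * (real N powr (\<alpha> * q) * K)) powr (1 / q)"
      using q by (intro powr_mono2) auto
    also have "\<dots> = D * (real N powr \<alpha> * K powr (1 / q))"
      using D K q by (simp add: powr_mult powr_powr)
    finally have s: "enn2real (besov_seminorm_enn \<alpha> p q f) powr (1 / q) \<le> D * (real N powr \<alpha> * K powr (1 / q))" .
    have f0: "fdiff 0 1 f = f" by (rule ext) simp
    have "Lp_norm_on p 0 1 (fdiff 0 1 f) \<le> A * (real 0 + 1) * real N powr (- 1 / p)"
      using f1 by (intro Lp_norm_fdiff_le[OF N p A _ fz]) auto
    then have "Lp_norm_on p 0 1 f \<le> A * real N powr (- 1 / p) * 1" unfolding f0 by simp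
    also have "\<dots> \<le> A * real N powr (- 1 / p) * real N powr \<alpha>"
      using A Nr \<alpha> by (intro mult_left_mono ge_one_powr_ge_zero) auto
    finally have l: "Lp_norm_on p 0 1 f \<le> A * real N powr (- 1 / p) * real N powr \<alpha>" .
    have "besov_norm \<alpha> p q f \<le> A * real N powr (- 1 / p) * real N powr \<alpha> + D * (real N powr \<alpha> * K powr (1 / q))"
      unfolding besov_norm_def using l s by (rule add_mono)
    also have "\<dots> = A * C * (real N powr \<alpha> * real N powr (- 1 / p))"
      by (simp add: D_def C_def algebra_simps)
    also have "\<dots> \<le> 1" using small by (simp add: powr_add[symmetric])
    finally have norm: "besov_norm \<alpha> p q f \<le> 1" .
    have fm [measurable]: "f \<in> borel_measurable borel" unfolding f_def by measurable
    have "set_integrable lborel {0..1} (\<lambda>x. \<bar>f x\<bar> powr p)"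
    proof (rule borel_integrable_atLeastAtMost')
      have "continuous_on {0..1} f" unfolding f_def by (intro continuous_intros continuous_on_scaled_bump)
      then show "continuous_on {0..1} (\<lambda>x. \<bar>f x\<bar> powr p)"
        using p by (intro continuous_on_powr' continuous_intros) auto
    qed
    then have "in_besov \<alpha> p q f"
      unfolding in_besov_def using semi by (auto simp: set_borel_measurable_def intro: le_less_trans)
    with norm show "(\<lambda>x. A * scaled_bump r N j x) \<in> besov_unit_ball \<alpha> p q"
      by (simp add: besov_unit_ball_def f_def)
  qed
qed

section \<open>The orthonormal family of bumps\<close>

definition bump_mass :: "nat \<Rightarrow> real" where
  "bump_mass r = (LINT x|lborel. (bump (r + 1) (r + 1) x)\<^sup>2)"

lemma bump_mass_pos: "bump_mass r > 0"
proof -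
  let ?f = "\<lambda>x. (bump (r + 1) (r + 1) x)\<^sup>2"
  have supp: "integrable lborel (\<lambda>x. indicator {0..1} x *\<^sub>R ?f x)"
    by (rule borel_integrable_compact) (auto intro!: continuous_intros continuous_on_bump)
  have ind: "indicator {0..1} x *\<^sub>R ?f x = ?f x" for x :: real
  proof (cases "x \<le> 0 \<or> 1 \<le> x")
    case True
    then have "bump (r + 1) (r + 1) x = 0" by (intro bump_zero) auto
    then show ?thesis by simp
  next
    case False
    then show ?thesis by simp
  qed
  have int: "integrable lborel ?f" using supp unfolding ind .
  have "bump_mass r \<noteq> 0"
  proof
    assume "bump_mass r = 0"
    then have "AE x in lborel. ?f x = 0"
      unfolding bump_mass_def using int by (subst (asm) integral_nonneg_eq_0_iff_AE) auto
    then have "AE x in lborel. x \<notin> {0<..<1::real}"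
      by eventually_elim (auto simp: bump_def)
    then have "emeasure lborel {0<..<1::real} = 0"
      by (subst (asm) AE_iff_measurable[OF _ refl]) (auto simp: greaterThanLessThan_def greaterThan_def lessThan_def Int_def)
    then show False by simp
  qed
  moreover have "bump_mass r \<ge> 0" unfolding bump_mass_def by simp
  ultimately show ?thesis by simp
qed

lemma scaled_bump_L2: "scaled_bump r N j \<in> L2_01"
  by (rule L2_01_continuous[OF continuous_on_scaled_bump])

lemma inner01_scaled_bump:
  assumes "i < N" "j < N"
  shows "inner01 (scaled_bump r N i) (scaled_bump r N j) = (if i = j then bump_mass r / real N else 0)"
proof (cases "i = j")
  case False
  have z: "scaled_bump r N i x * scaled_bump r N j x = 0" for x
  proof (rule ccontr)
    assume "scaled_bump r N i x * scaled_bump r N j x \<noteq> 0"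
    then have "0 < real N * x - real i" "real N * x - real i < 1" "0 < real N * x - real j" "real N * x - real j < 1"
      using bump_zero[of "r + 1" "r + 1" "real N * x - real i"] bump_zero[of "r + 1" "r + 1" "real N * x - real j"]
      by (auto simp: scaled_bump_def not_le[symmetric])
    then have "real i < real j + 1" "real j < real i + 1" by linarith+
    then show False using False by linarith
  qed
  show ?thesis
    using False unfolding inner01_def z by (simp add: set_lebesgue_integral_def)
next
  case True
  have N: "real N > 0" using assms by simp
  have "inner01 (scaled_bump r N j) (scaled_bump r N j) = (LINT x|lborel. (bump (r + 1) (r + 1) (- real j + real N * x))\<^sup>2)"
    unfolding inner01_def set_lebesgue_integral_def
  proof (rule Bochner_Integration.integral_cong[OF refl])
    fix x :: real
    show "indicat_real {0..1} x *\<^sub>R (scaled_bump r N j x * scaled_bump r N j x) = (bump (r + 1) (r + 1) (- real j + real N * x))\<^sup>2"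
    proof (cases "x \<in> {0..1}")
      case True
      then show ?thesis by (simp add: scaled_bump_def power2_eq_square algebra_simps)
    next
      case False
      have "- real j + real N * x \<le> 0 \<or> 1 \<le> - real j + real N * x"
      proof (cases "x < 0")
        case True
        then have "real N * x \<le> 0" using N by (simp add: mult_nonneg_nonpos)
        then show ?thesis by simp
      next
        case False
        with \<open>x \<notin> {0..1}\<close> have "1 < x" by simp
        then have "real N * 1 \<le> real N * x" using N by (intro mult_left_mono) auto
        moreover have "real j + 1 \<le> real N" using assms by linarith
        ultimately show ?thesis by linarith
      qed
      then have "bump (r + 1) (r + 1) (- real j + real N * x) = 0" by (intro bump_zero) auto
      then show ?thesis using False by simp
    qed
  qed
  moreover have "bump_mass r = real N * (LINT x|lborel. (bump (r + 1) (r + 1) (- real j + real N * x))\<^sup>2)"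
    unfolding bump_mass_def using N lborel_integral_real_affine[of "real N" "\<lambda>x. (bump (r + 1) (r + 1) x)\<^sup>2" "- real j"] by simp
  ultimately show ?thesis using N True by simp
qed

definition bump_basis :: "nat \<Rightarrow> nat \<Rightarrow> nat \<Rightarrow> real \<Rightarrow> real" where
  "bump_basis r N j x = sqrt (real N / bump_mass r) * scaled_bump r N j x"

lemma bump_basis_L2: "bump_basis r N j \<in> L2_01"
  unfolding bump_basis_def[abs_def] by (intro L2_01_scale scaled_bump_L2)

lemma bump_basis_orthonormal:
  assumes "i < N" "j < N"
  shows "inner01 (bump_basis r N i) (bump_basis r N j) = (if i = j then 1 else 0)"
proof -
  have "inner01 (bump_basis r N i) (bump_basis r N j) = real N / bump_mass r * inner01 (scaled_bump r N i) (scaled_bump r N j)"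
    unfolding bump_basis_def[abs_def] inner01_scale_left inner01_scale_right
    using bump_mass_pos[of r] by (simp add: mult.assoc[symmetric])
  then show ?thesis
    using assms bump_mass_pos[of r] by (simp add: inner01_scaled_bump)
qed

text \<open>The Besov norm of a bump of height 1 grows like \<open>N\<close> to the power
  \<open>\<alpha> - 1 / p\<close>, and normalisation in L^2 contributes another factor
  \<open>sqrt N\<close>; the amplitude compensates exactly for both.\<close>

lemma besov_unit_ball_bump_basis:
  assumes \<alpha>: "\<alpha> > 0" and p: "p \<ge> 1" and q: "q \<ge> 1"
  shows "\<exists>c>0. \<forall>N>0. \<forall>j. (\<lambda>x. (c * real N powr - (\<alpha> - 1 / p + 1 / 2)) * bump_basis (besov_r \<alpha>) N j x) \<in> besov_unit_ball \<alpha> p q"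
proof -
  let ?r = "besov_r \<alpha>"
  from besov_unit_ball_scaled_bump[OF \<alpha> p q refl] obtain C where C_pos: "C > 0" and
    C_ball: "\<forall>N>0. \<forall>j A. 0 \<le> A \<longrightarrow> A * C * real N powr (\<alpha> - 1 / p) \<le> 1 \<longrightarrow>
      (\<lambda>x. A * scaled_bump ?r N j x) \<in> besov_unit_ball \<alpha> p q"
    by (elim exE conjE)
  have C: "C > 0" "\<And>N j A. N > 0 \<Longrightarrow> 0 \<le> A \<Longrightarrow> A * C * real N powr (\<alpha> - 1 / p) \<le> 1 \<Longrightarrow>
    (\<lambda>x. A * scaled_bump ?r N j x) \<in> besov_unit_ball \<alpha> p q"
    using C_pos C_ball by simp_all
  define m where "m = sqrt (bump_mass ?r)"
  have m: "m > 0" using bump_mass_pos[of ?r] by (simp add: m_def)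
  show ?thesis
  proof (intro exI[of _ "m / C"] conjI allI impI)
    show "0 < m / C" using m C by simp
    fix N j :: nat assume N: "0 < N"
    let ?A = "m / C * real N powr - (\<alpha> - 1 / p + 1 / 2) * sqrt (real N / bump_mass ?r)"
    have "sqrt (real N / bump_mass ?r) = real N powr (1 / 2) / m"
      by (simp add: real_sqrt_divide m_def powr_half_sqrt)
    then have "?A * C * real N powr (\<alpha> - 1 / p) = real N powr - (\<alpha> - 1 / p + 1 / 2) * real N powr (1 / 2) * real N powr (\<alpha> - 1 / p)"
      using m C by simp
    also have "\<dots> = 1" using N by (simp add: powr_add[symmetric])
    finally have eq: "?A * C * real N powr (\<alpha> - 1 / p) = 1" .
    have "0 \<le> ?A" using m C(1) bump_mass_pos[of ?r]
      by (intro mult_nonneg_nonneg divide_nonneg_pos powr_ge_zero real_sqrt_ge_zero) auto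
    then have "(\<lambda>x. ?A * scaled_bump ?r N j x) \<in> besov_unit_ball \<alpha> p q"
      by (rule C(2)[OF N]) (simp only: eq order_refl)
    then show "(\<lambda>x. (m / C * real N powr - (\<alpha> - 1 / p + 1 / 2)) * bump_basis ?r N j x) \<in> besov_unit_ball \<alpha> p q"
      by (simp add: bump_basis_def mult_ac)
  qed
qed

lemma zero_in_besov_unit_ball:
  assumes "\<alpha> > 0" "p \<ge> 1" "q \<ge> 1"
  shows "(\<lambda>x. 0) \<in> besov_unit_ball \<alpha> p q"
proof -
  from besov_unit_ball_scaled_bump[OF assms refl] obtain C where
    C: "\<forall>N>0. \<forall>j A. 0 \<le> A \<longrightarrow> A * C * real N powr (\<alpha> - 1 / p) \<le> 1 \<longrightarrow>
      (\<lambda>x. A * scaled_bump (besov_r \<alpha>) N j x) \<in> besov_unit_ball \<alpha> p q"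
    by (elim exE conjE)
  from C[rule_format, of 1 0 0] show ?thesis by simp
qed

lemma data_law_prob_le_1: "\<epsilon> > 0 \<Longrightarrow> measure (data_law \<epsilon> f) A \<le> 1"
proof -
  assume "\<epsilon> > 0"
  then have "prob_space (data_law \<epsilon> f)"
    unfolding data_law_def by (intro prob_space_PiM prob_space_normal_density) auto
  then show ?thesis by (rule prob_space.prob_le_1)
qed

section \<open>The lower bound\<close>

text \<open>Here \<open>N\<close> balances the amplitude \<open>N powr - s\<close> against
  \<open>\<epsilon> * sqrt N\<close>: at \<open>N = \<epsilon> powr (- 2 / (2 * s + 1))\<close> both
  equal \<open>\<epsilon> powr (2 * s / (2 * s + 1))\<close>.\<close>

lemma rate_from_dichotomy:
  fixes s c d \<epsilon> :: real
  assumes s: "s > 0" and c: "c > 0" and d: "d > 0" and \<epsilon>: "0 < \<epsilon>" "\<epsilon> < 1"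
    and N: "N = nat \<lceil>\<epsilon> powr (- 2 / (2 * s + 1))\<rceil>"
    and dich: "c * real N powr - s < 4 * d \<or> real N * \<epsilon>\<^sup>2 \<le> 8192 * d\<^sup>2"
  shows "min (c * 2 powr - s / 4) (1 / 100) * \<epsilon> powr (2 * s / (2 * s + 1)) \<le> d"
proof -
  let ?x = "\<epsilon> powr (- 2 / (2 * s + 1))" and ?l = "\<epsilon> powr (2 * s / (2 * s + 1))"
  have s1: "2 * s + 1 > 0" using s by simp
  have "\<epsilon> powr 0 \<le> ?x" using \<epsilon> s1 by (intro powr_mono') (auto simp: divide_nonpos_pos)
  then have x1: "1 \<le> ?x" using \<epsilon> by simp
  \<comment> \<open>Rounding up at most doubles a number that is at least 1; this is the origin of
    the factor \<open>2 powr - s\<close>.\<close>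
  have Nx: "?x \<le> real N" "real N \<le> 2 * ?x"
    unfolding N using x1 by linarith+
  have l: "?l > 0" using \<epsilon> by simp
  from dich show ?thesis
  proof
    assume a: "c * real N powr - s < 4 * d"
    have "(2 * ?x) powr - s \<le> real N powr - s"
      using Nx x1 s by (intro powr_mono2') auto
    moreover have "(2 * ?x) powr - s = 2 powr - s * ?l"
      by (simp add: powr_mult powr_powr)
    ultimately have "c * (2 powr - s * ?l) \<le> c * real N powr - s"
      using c by (intro mult_left_mono) auto
    then have "c * 2 powr - s / 4 * ?l \<le> d" using a by (simp add: field_simps)
    moreover have "min (c * 2 powr - s / 4) (1 / 100) * ?l \<le> c * 2 powr - s / 4 * ?l"
      using l by (intro mult_right_mono) auto
    ultimately show ?thesis by linarith
  next
    assume a: "real N * \<epsilon>\<^sup>2 \<le> 8192 * d\<^sup>2"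
    have "?l\<^sup>2 = ?x * \<epsilon>\<^sup>2"
    proof -
      have e: "2 * s / (2 * s + 1) + 2 * s / (2 * s + 1) = - 2 / (2 * s + 1) + 2"
      proof -
        have "- 2 / (2 * s + 1) + 2 = (- 2 + 2 * (2 * s + 1)) / (2 * s + 1)"
          using s1 by (subst add_divide_distrib) (simp add: divide_eq_eq)
        then show ?thesis by (simp add: add_divide_distrib[symmetric])
      qed
      have "?l\<^sup>2 = \<epsilon> powr (2 * s / (2 * s + 1) + 2 * s / (2 * s + 1))"
        unfolding power2_eq_square powr_add ..
      also have "\<dots> = ?x * \<epsilon> powr 2" unfolding e powr_add ..
      finally show ?thesis using \<epsilon> by simp
    qed
    also have "\<dots> \<le> real N * \<epsilon>\<^sup>2" using Nx by (intro mult_right_mono) auto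
    \<comment> \<open>100 is a round number whose square exceeds 8192.\<close>
    also have "\<dots> \<le> (100 * d)\<^sup>2"
    proof -
      have "(100 * d)\<^sup>2 = 10000 * d\<^sup>2" by (simp add: power_mult_distrib)
      then show ?thesis using a zero_le_power2[of d] by linarith
    qed
    finally have "?l\<^sup>2 \<le> (100 * d)\<^sup>2" .
    then have "?l \<le> 100 * d" by (rule power2_le_imp_le) (use d in simp)
    then have "1 / 100 * ?l \<le> d" by simp
    moreover have "min (c * 2 powr - s / 4) (1 / 100) * ?l \<le> 1 / 100 * ?l"
      using l by (intro mult_right_mono) auto
    ultimately show ?thesis by linarith
  qed
qed

theorem theorem4p1:
  fixes \<alpha> p q :: real
    and \<delta> :: "real \<Rightarrow> real"
    and Prior :: "real \<Rightarrow> (real \<Rightarrow> real) measure"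
  assumes params: "(\<alpha> > 1 / p \<and> 1 \<le> p \<and> p < 2 \<and> 1 \<le> q) \<or> (\<alpha> = 1 \<and> p = 1 \<and> q = 1)"
    and \<delta>_pos: "\<And>\<epsilon>. \<epsilon> \<in> {0<..<1} \<Longrightarrow> \<delta> \<epsilon> > 0"
    and \<delta>_mono: "mono_on {0<..<1} \<delta>"
    and prior: "\<And>\<epsilon>. \<epsilon> \<in> {0<..<1} \<Longrightarrow> centered_gaussian_L2 (Prior \<epsilon>)"
    and contraction: "\<And>\<eta>. \<eta> > 0 \<Longrightarrow>
      ((\<lambda>\<epsilon>. SUP f0 \<in> besov_unit_ball \<alpha> p q.
          prob_space.prob (data_law \<epsilon> f0)
            {Y. posterior \<epsilon> (Prior \<epsilon>) Y {f. L2norm01 (\<lambda>x. f x - f0 x) \<ge> \<delta> \<epsilon>} \<ge> \<eta>})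
        \<longlongrightarrow> 0) (at_right 0)"
  shows "\<exists>c>0. \<forall>\<epsilon>\<in>{0<..<1}.
    \<delta> \<epsilon> \<ge> c * \<epsilon> powr ((2 * \<alpha> - (2 - p) / p) / (2 * \<alpha> + 1 - (2 - p) / p))"
proof -
  have p: "p \<ge> 1" and q: "q \<ge> 1" using params by auto
  \<comment> \<open>The amplitude exponent of the normalised bumps. It is at least 1/2 in both
    parameter ranges, and \<open>2 * s\<close> is the numerator of the exponent in the rate.\<close>
  define s where "s = \<alpha> - 1 / p + 1 / 2"
  have s: "s > 0" using params by (auto simp: s_def)
  have \<alpha>: "\<alpha> > 0"
  proof -
    have "0 < 1 / p" using p by simp
    with params show ?thesis by (elim disjE conjE) (linarith, simp)
  qed
  have exponent: "(2 * \<alpha> - (2 - p) / p) / (2 * \<alpha> + 1 - (2 - p) / p) = 2 * s / (2 * s + 1)"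
  proof -
    have "(2 - p) / p = 2 / p - 1" using p by (simp add: diff_divide_distrib)
    then have "2 * \<alpha> - (2 - p) / p = 2 * s" "2 * \<alpha> + 1 - (2 - p) / p = 2 * s + 1"
      by (simp_all add: s_def)
    then show ?thesis by simp
  qed
  from besov_unit_ball_bump_basis[OF \<alpha> p q] obtain c where c: "c > 0" and
    c_ball: "\<forall>N>0. \<forall>j. (\<lambda>x. (c * real N powr - (\<alpha> - 1 / p + 1 / 2)) * bump_basis (besov_r \<alpha>) N j x) \<in> besov_unit_ball \<alpha> p q"
    by (elim exE conjE)
  have ball: "(\<lambda>x. (c * real N powr - s) * bump_basis (besov_r \<alpha>) N j x) \<in> besov_unit_ball \<alpha> p q" if "N > 0" for N j
    using c_ball that by (simp add: s_def)
  let ?bad = "\<lambda>\<epsilon> f0. {Y. posterior \<epsilon> (Prior \<epsilon>) Y {f. L2norm01 (\<lambda>x. f x - f0 x) \<ge> \<delta> \<epsilon>} \<ge> 1 / 8}"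
  have "\<forall>\<^sub>F \<epsilon> in at_right 0. (SUP f0 \<in> besov_unit_ball \<alpha> p q. measure (data_law \<epsilon> f0) (?bad \<epsilon> f0)) < 1 / 8"
    using contraction[of "1 / 8"] by (rule order_tendstoD(2)) simp_all
  then obtain b where b: "b > 0" and
    sup: "\<And>\<epsilon>. 0 < \<epsilon> \<Longrightarrow> \<epsilon> < b \<Longrightarrow> (SUP f0 \<in> besov_unit_ball \<alpha> p q. measure (data_law \<epsilon> f0) (?bad \<epsilon> f0)) < 1 / 8"
    unfolding eventually_at_right_field by auto
  \<comment> \<open>Half of the minimum keeps \<open>e0\<close> strictly inside the unit interval
    and below \<open>b\<close>, so that the lower bound holds at \<open>e0\<close> itself and
    \<open>\<delta> e0\<close> is positive.\<close>
  define e0 where "e0 = min b 1 / 2"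
  have e0: "0 < e0" "e0 < b" "e0 < 1" using b by (auto simp: e0_def)
  define c1 where "c1 = min (c * 2 powr - s / 4) (1 / 100)"
  have c1: "c1 > 0" using c by (simp add: c1_def)
  have small: "c1 * \<epsilon> powr (2 * s / (2 * s + 1)) \<le> \<delta> \<epsilon>" if \<epsilon>: "0 < \<epsilon>" "\<epsilon> \<le> e0" for \<epsilon>
  proof -
    have \<epsilon>1: "\<epsilon> \<in> {0<..<1}" "\<epsilon> < b" using \<epsilon> e0 by auto
    interpret gaussian_posterior "Prior \<epsilon>" \<epsilon>
      using prior[OF \<epsilon>1(1)] \<epsilon> by unfold_locales
    define N where "N = nat \<lceil>\<epsilon> powr (- 2 / (2 * s + 1))\<rceil>"
    have N: "N > 0" using \<epsilon> by (simp add: N_def)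
    have le: "measure (data_law \<epsilon> f0) (?bad \<epsilon> f0) < 1 / 8" if "f0 \<in> besov_unit_ball \<alpha> p q" for f0
    proof -
      \<comment> \<open>Boundedness by 1 is what lets the real supremum dominate each individual
        probability.\<close>
      have "bdd_above ((\<lambda>f0. measure (data_law \<epsilon> f0) (?bad \<epsilon> f0)) ` besov_unit_ball \<alpha> p q)"
        by (rule bdd_aboveI2[of _ _ 1]) (rule data_law_prob_le_1[OF \<epsilon>(1)])
      then have "measure (data_law \<epsilon> f0) (?bad \<epsilon> f0) \<le> (SUP f0 \<in> besov_unit_ball \<alpha> p q. measure (data_law \<epsilon> f0) (?bad \<epsilon> f0))"
        by (rule cSUP_upper[OF that])
      also have "\<dots> < 1 / 8" by (rule sup[OF \<epsilon>(1) \<epsilon>1(2)])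
      finally show ?thesis .
    qed
    have "c * real N powr - s < 4 * \<delta> \<epsilon> \<or> real N * \<epsilon>\<^sup>2 \<le> 8192 * (\<delta> \<epsilon>)\<^sup>2"
    proof (rule contraction_rate_dichotomy[where \<psi>="bump_basis (besov_r \<alpha>) N"])
      show "measure (data_law \<epsilon> (\<lambda>x. c * real N powr - s * bump_basis (besov_r \<alpha>) N j x))
          {Y. 1 / 8 \<le> posterior \<epsilon> (Prior \<epsilon>) Y {f. \<delta> \<epsilon> \<le> L2norm01 (\<lambda>x. f x - c * real N powr - s * bump_basis (besov_r \<alpha>) N j x)}} < 1 / 8" for j
        by (rule le[OF ball[OF N]])
      show "measure (data_law \<epsilon> (\<lambda>x. 0)) {Y. 1 / 8 \<le> posterior \<epsilon> (Prior \<epsilon>) Y {f. \<delta> \<epsilon> \<le> L2norm01 (\<lambda>x. f x - 0)}} < 1 / 8"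
        by (rule le[OF zero_in_besov_unit_ball[OF \<alpha> p q]])
      show "0 < c * real N powr - s" using c N by simp
    qed (use N \<delta>_pos[OF \<epsilon>1(1)] bump_basis_L2 bump_basis_orthonormal in auto)
    then show ?thesis
      unfolding c1_def using \<epsilon>1(1) s c \<delta>_pos[OF \<epsilon>1(1)]
      by (intro rate_from_dichotomy[where N=N] N_def) auto
  qed
  \<comment> \<open>Contraction gives nothing for noise levels above \<open>e0\<close>. There
    monotonicity gives \<open>\<delta> \<epsilon> \<ge> \<delta> e0\<close>, and the rate itself is
    at most 1.\<close>
  define c2 where "c2 = min c1 (\<delta> e0)"
  show ?thesis
    unfolding exponent
  proof (intro exI[of _ c2] conjI ballI)
    show "c2 > 0" using c1 \<delta>_pos[of e0] e0 by (simp add: c2_def)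
    fix \<epsilon> :: real assume \<epsilon>: "\<epsilon> \<in> {0<..<1}"
    let ?l = "\<epsilon> powr (2 * s / (2 * s + 1))"
    have l: "0 \<le> ?l" by simp
    have "?l \<le> \<epsilon> powr 0" using \<epsilon> s by (intro powr_mono') auto
    then have l1: "?l \<le> 1" using \<epsilon> by simp
    show "c2 * ?l \<le> \<delta> \<epsilon>"
    proof (cases "\<epsilon> \<le> e0")
      case True
      have "c2 * ?l \<le> c1 * ?l" using l by (intro mult_right_mono) (auto simp: c2_def)
      also have "\<dots> \<le> \<delta> \<epsilon>" using small[of \<epsilon>] True \<epsilon> by auto
      finally show ?thesis .
    next
      case False
      have "c2 * ?l \<le> \<delta> e0 * 1"
        using l l1 \<delta>_pos[of e0] e0 by (intro mult_mono) (auto simp: c2_def)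
      also have "\<dots> \<le> \<delta> \<epsilon>"
        using mono_onD[OF \<delta>_mono, of e0 \<epsilon>] False \<epsilon> e0 by auto
      finally show ?thesis .
    qed
  qed
qed

end
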